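(* $n_6(4) \geq 26$ and $n_7(4) \geq 30$. That is, every graph with chromatic number $4$ and girth at least $6$ has at least $26$ vertices, and every graph with chromatic number $4$ and girth at least $7$ has at least $30$ vertices.
   Context: All graphs are finite and simple. The girth of a graph is the length of its shortest cycle. For integers $g$ and $k$, $n_g(k)$ denotes the smallest order of a graph with chromatic number exactly $k$ and girth at least $g$. *)

theory Defs
  imports "Graph_Theory.Graph_Theory" "HOL-Library.Extended_Nat"
begin

text \<open>
  A finite simple graph is a \<open>pair_graph\<close>: a finite, symmetric, loop-free digraph whose arcs are
  pairs of vertices, each edge \<open>uv\<close> being the two arcs \<open>(u, v)\<close> and \<open>(v, u)\<close>.
\<close>

text \<open>
  In a symmetric digraph, \<open>pre_digraph.cycle\<close> also accepts the closed walk \<open>u, v, u\<close> along a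
  single edge; the cycles of the undirected graph are those of length at least 3.
  The girth of an acyclic graph is \<open>\<infinity>\<close>.
\<close>

definition girth :: "'a pair_pre_digraph \<Rightarrow> enat" where
  "girth G = (INF p \<in> {p. pre_digraph.cycle (with_proj G) p \<and> 3 \<le> length p}. enat (length p))"

definition proper_coloring :: "'a pair_pre_digraph \<Rightarrow> nat \<Rightarrow> ('a \<Rightarrow> nat) \<Rightarrow> bool" where
  "proper_coloring G k c \<longleftrightarrow>
     (\<forall>v \<in> pverts G. c v < k) \<and> (\<forall>(u, v) \<in> parcs G. c u \<noteq> c v)"

definition chromatic_number :: "'a pair_pre_digraph \<Rightarrow> nat" where
  "chromatic_number G = (LEAST k. \<exists>c. proper_coloring G k c)"

text \<open>
  Every finite graph is isomorphic to one with vertices in \<open>nat\<close>, so these suffice for the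
  smallest order. The value is \<open>\<infinity>\<close> if no graph qualifies.
\<close>

definition min_order :: "nat \<Rightarrow> nat \<Rightarrow> enat" where
  "min_order g k =
     (INF G \<in> {G :: nat pair_pre_digraph.
                 pair_graph G \<and> chromatic_number G = k \<and> enat g \<le> girth G}.
        enat (card (pverts G)))"

end

theory Submission
  imports Defs
begin

text \<open>
  A vertex-minimal non-3-colourable induced subgraph has minimum degree at least 3. A graph is
  3-colourable iff deleting some independent set leaves a bipartite graph, so in every such
  deletion an odd cycle survives, and by the girth condition it has length at least 7.

  Girth 6, at most 25 vertices. Let \<open>R\<close> be the set of vertices at distance at least 3 from \<open>v\<close>.
  Colouring all neighbours of \<open>v\<close> alike and extending over \<open>R\<close> around a shortest odd cycle of
  \<open>R\<close> (which has length 7 or 9 because \<open>R\<close> is small) shows first that all degrees are 3 or 4, then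
  that a vertex of degree 4 has at most one neighbour of degree 4, and finally, by using an edge in
  place of \<open>v\<close>, that it has none.

  Then an exchange argument in the spirit of Catlin's proof of Brooks' theorem applies. Let \<open>S\<close> be an
  independent set covering as many edges as possible. All degrees in \<open>V - S\<close> are at most 2, so \<open>V - S\<close>
  is a disjoint union of paths and cycles. Let \<open>C\<close> be an odd cycle among them and \<open>c\<close> a vertex of \<open>C\<close>
  of degree 3, with unique neighbour \<open>x\<close> in \<open>S\<close>. Exchanging \<open>c\<close> and \<open>x\<close> opens \<open>C\<close> and must create a
  new odd cycle, so \<open>x\<close> closes up a path on at least 6 vertices of \<open>V - S - C\<close>. Different \<open>x\<close> have
  different end pairs because there is no 4-cycle, and counting edges leaves at most 6 edges in
  \<open>V - S - C\<close>, which is not enough.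

  Girth 7, at most 29 vertices. Counting the vertices at distance at most 3 from a vertex of degree 4
  shows that there are at most four such vertices and that they are pairwise far apart. In the
  exchange argument at least three of the \<open>x\<close> then have degree 3, and for these the paths are pairwise
  disjoint; this requires 30 vertices.
\<close>

section \<open>Odd cycles\<close>

text \<open>The weight in the exchange argument is the degree sum, so exchanging \<open>c\<close>
  with an \<open>x\<close> of degree 3 stays among the optimal sets, while an \<open>x\<close> of
  degree 4 costs weight 1. Hence two different tools force the new odd cycle. For degree 3 it is the
  secondary minimality of the transversal \<open>X\<close>; the new set being optimal too, the new
  cycle is closed in its complement, so its path is a whole component of \<open>V - S\<close>. For
  degree 4 only the failure of 3-colourability is available, and it helps only if \<open>X\<close>
  is a single vertex. The bound of 6 edges supplies this: a second odd cycle in \<open>V - S\<close>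
  would bring at least 7 edges outside \<open>C\<close>. The same bound leaves each path 5 or 6
  edges, by parity 5. Vertices of degree 4 being pairwise nonadjacent, fewer than half of the
  vertices of \<open>C\<close> have degree 4, so there are at least four such paths, and these do
  not fit into 6 edges without closing a short cycle.\<close>

locale sgraph =
  fixes V :: "'a set" and E :: "'a \<Rightarrow> 'a \<Rightarrow> bool"
  assumes fin: "finite V"
    and Esym: "E x y \<Longrightarrow> E y x"
    and irr: "\<not> E x x"
    and inV: "E x y \<Longrightarrow> x \<in> V"
    \<comment> \<open>Girth at least 6, as closed walks: one of length 3 or 5 with a repeated vertex
      already contains a loop or a triangle, so only \<open>no4\<close> has to allow for degenerate
      walks.\<close>
    and no3: "E a b \<Longrightarrow> E b c \<Longrightarrow> E c a \<Longrightarrow> False"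
    and no4: "E a b \<Longrightarrow> E b c \<Longrightarrow> E c d \<Longrightarrow> E d a \<Longrightarrow> a = c \<or> b = d"
    and no5: "E a b \<Longrightarrow> E b c \<Longrightarrow> E c d \<Longrightarrow> E d e \<Longrightarrow> E e a \<Longrightarrow> False"
begin

lemma E_comm: "E x y \<longleftrightarrow> E y x" using Esym by blast

lemma inV2: "E x y \<Longrightarrow> y \<in> V" using inV Esym by blast

definition nb :: "'a \<Rightarrow> 'a set" where "nb x = {y. E x y}"

lemma nb_V: "nb x \<subseteq> V" by (auto simp: nb_def intro: inV2)

lemma fin_nb [simp]: "finite (nb x)" using nb_V fin finite_subset by blast

lemma mem_nb [simp]: "y \<in> nb x \<longleftrightarrow> E x y" by (simp add: nb_def)

definition indep :: "'a set \<Rightarrow> bool" where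
  "indep A \<longleftrightarrow> (\<forall>x\<in>A. \<forall>y\<in>A. \<not> E x y)"

definition bip :: "'a set \<Rightarrow> bool" where
  "bip A \<longleftrightarrow> (\<exists>f::'a \<Rightarrow> bool. \<forall>x\<in>A. \<forall>y\<in>A. E x y \<longrightarrow> f x \<noteq> f y)"

lemma bip_subset: "bip B \<Longrightarrow> A \<subseteq> B \<Longrightarrow> bip A"
proof -
  assume "bip B" "A \<subseteq> B"
  then obtain f :: "'a \<Rightarrow> bool" where "\<forall>x\<in>B. \<forall>y\<in>B. E x y \<longrightarrow> f x \<noteq> f y" unfolding bip_def by blast
  with \<open>A \<subseteq> B\<close> show "bip A" unfolding bip_def by (intro exI[of _ f]) auto
qed

definition col3 :: bool where
  "col3 \<longleftrightarrow> (\<exists>S\<subseteq>V. indep S \<and> bip (V - S))"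

definition arcs_on :: "'a set \<Rightarrow> ('a \<times> 'a) set" where
  "arcs_on A = {(x, y). x \<in> A \<and> y \<in> A \<and> E x y}"

lemma sym_arcs_on: "(x, y) \<in> arcs_on A ^^ k \<Longrightarrow> (y, x) \<in> arcs_on A ^^ k"
proof (induction k arbitrary: x y)
  case (Suc k)
  then obtain z where "(x, z) \<in> arcs_on A ^^ k" "(z, y) \<in> arcs_on A" by auto
  then have "(z, x) \<in> arcs_on A ^^ k" "(y, z) \<in> arcs_on A"
    using Suc.IH by (auto simp: arcs_on_def E_comm)
  then show ?case by (rule relpow_Suc_I2[rotated])
qed auto

text \<open>Colour each component by parity of walk length from a representative; this is a proper
  2-colouring unless some closed walk is odd.\<close>

lemma not_bip_odd_closed_walk:
  assumes "\<not> bip A"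
  shows "\<exists>k x. odd k \<and> (x, x) \<in> arcs_on A ^^ k"
proof (rule ccontr)
  assume no: "\<not> ?thesis"
  \<comment> \<open>The choice depends only on the set of reachable vertices, so \<open>rep\<close>
    is constant on components.\<close>
  define rep where "rep x = (SOME y. (x, y) \<in> (arcs_on A)\<^sup>*)" for x
  define f where "f x = (\<exists>k. even k \<and> (rep x, x) \<in> arcs_on A ^^ k)" for x
  have rep: "\<exists>k. (rep x, x) \<in> arcs_on A ^^ k" for x
  proof -
    have "(x, rep x) \<in> (arcs_on A)\<^sup>*" unfolding rep_def by (rule someI) (rule rtrancl_refl)
    then show ?thesis using sym_arcs_on unfolding rtrancl_power by blast
  qed
  have "f x \<noteq> f y" if "x \<in> A" "y \<in> A" "E x y" for x y
  proof -
    have xy: "(x, y) \<in> arcs_on A" "(y, x) \<in> arcs_on A"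
      using that Esym by (auto simp: arcs_on_def)
    then have "{z. (x, z) \<in> (arcs_on A)\<^sup>*} = {z. (y, z) \<in> (arcs_on A)\<^sup>*}"
      by (auto intro: converse_rtrancl_into_rtrancl)
    then have eq: "rep y = rep x"
      unfolding rep_def by (metis (mono_tags, lifting) mem_Collect_eq)
    obtain n where n: "(rep x, x) \<in> arcs_on A ^^ n" using rep by blast
    show ?thesis
    proof
      assume e: "f x = f y"
      show False
      proof (cases "f x")
        case True
        then obtain k k' where k: "even k" "(rep x, x) \<in> arcs_on A ^^ k"
          "even k'" "(rep x, y) \<in> arcs_on A ^^ k'"
          using e eq unfolding f_def by auto
        have "(rep x, y) \<in> arcs_on A ^^ Suc k" using k xy by auto
        then have "(rep x, rep x) \<in> arcs_on A ^^ (Suc k + k')"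
          using sym_arcs_on[OF k(4)] by (rule relpow_trans)
        moreover have "odd (Suc k + k')" using k by auto
        ultimately show False using no by blast
      next
        case False
        then have "odd n" using n unfolding f_def by blast
        moreover have "(rep y, y) \<in> arcs_on A ^^ Suc n" using n xy eq by auto
        ultimately have "f y" unfolding f_def by (metis even_Suc)
        then show False using e False by simp
      qed
    qed
  qed
  then show False using assms unfolding bip_def by blast
qed

text \<open>An odd cycle of length \<open>l\<close> is an \<open>l\<close>-periodic function on the integers, so that rotations and
  reflections are reparametrisations.\<close>

definition odd_cycle :: "'a set \<Rightarrow> int \<Rightarrow> (int \<Rightarrow> 'a) \<Rightarrow> bool" where
  "odd_cycle A l c \<longleftrightarrow> odd l \<and> 7 \<le> l \<and> (\<forall>i. c i \<in> A) \<and> (\<forall>i. E (c i) (c (i + 1))) \<and>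
     (\<forall>i j. c i = c j \<longleftrightarrow> l dvd i - j)"

text \<open>A shortest odd closed walk repeats no vertex: cutting it at a repetition gives two
  closed walks whose lengths add up to an odd number, so one of them is odd and shorter. Lengths 1,
  3 and 5 are excluded by \<open>irr\<close>, \<open>no3\<close> and \<open>no5\<close>.\<close>

lemma shortest_odd_cycle:
  assumes "\<not> bip A"
  obtains l c where "odd_cycle A l c"
    and "\<And>k x. odd k \<Longrightarrow> (x, x) \<in> arcs_on A ^^ k \<Longrightarrow> l \<le> int k"
proof -
  define P where "P k \<longleftrightarrow> odd k \<and> (\<exists>x. (x, x) \<in> arcs_on A ^^ k)" for k
  define k where "k = (LEAST k. P k)"
  have "\<exists>k. P k" using not_bip_odd_closed_walk[OF assms] unfolding P_def by blast
  then have Pk: "P k" unfolding k_def by (rule LeastI_ex)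
  have min: "k \<le> j" if "P j" for j unfolding k_def using that by (rule Least_le)
  obtain x f where f0: "f 0 = x" "f k = x" and fs: "\<And>i. i < k \<Longrightarrow> (f i, f (Suc i)) \<in> arcs_on A"
    using Pk unfolding P_def relpow_fun_conv by auto
  have odd: "odd k" using Pk P_def by simp
  have walk: "(f a, f b) \<in> arcs_on A ^^ (b - a)" if "a \<le> b" "b \<le> k" for a b
    unfolding relpow_fun_conv
    by (rule exI[of _ "\<lambda>i. f (a + i)"]) (use that fs in auto)
  have inj: "f a \<noteq> f b" if "a < b" "b < k" for a b
  proof
    assume eq: "f a = f b"
    have 1: "(f a, f a) \<in> arcs_on A ^^ (b - a)" using walk[of a b] that eq by simp
    have "(f b, x) \<in> arcs_on A ^^ (k - b)" "(x, f a) \<in> arcs_on A ^^ a"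
      using walk[of b k] walk[of 0 a] that f0 by auto
    then have 2: "(f a, f a) \<in> arcs_on A ^^ (k - b + a)"
      using eq relpow_trans by metis
    have "odd (b - a) \<or> odd (k - b + a)" using odd that by presburger
    then have "P (b - a) \<or> P (k - b + a)" using 1 2 unfolding P_def by auto
    then show False using min that by fastforce
  qed
  have E: "E (f i) (f (Suc i))" "f i \<in> A" if "i < k" for i
    using fs[OF that] by (auto simp: arcs_on_def)
  have "k \<noteq> 1" using E[of 0] f0 irr by auto
  moreover have "k \<noteq> 3" using E[of 0] E[of 1] E[of 2] f0 no3[of "f 0" "f 1" "f 2"]
    by (auto simp: eval_nat_numeral)
  moreover have "k \<noteq> 5"
    using E[of 0] E[of 1] E[of 2] E[of 3] E[of 4] f0 no5[of "f 0" "f 1" "f 2" "f 3" "f 4"]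
    by (auto simp: eval_nat_numeral)
  ultimately have k7: "7 \<le> k" using odd by presburger
  define l where "l = int k"
  define c where "c i = f (nat (i mod l))" for i
  have l0: "0 < l" using k7 unfolding l_def by simp
  have lt: "nat (i mod l) < k" for i
    using pos_mod_bound[OF l0, of i] pos_mod_sign[OF l0, of i] unfolding l_def by linarith
  have "E (c i) (c (i + 1))" for i
  proof (cases "i mod l = l - 1")
    case True
    then have "(i + 1) mod l = 0" 
      using mod_add_left_eq[of i l 1] by simp
    then have "c (i + 1) = x" unfolding c_def using f0 by simp
    moreover have "Suc (nat (i mod l)) = k" using True k7 unfolding l_def by auto
    ultimately show ?thesis using E(1)[OF lt[of i]] f0 unfolding c_def by simp
  next
    case False
    have "0 \<le> i mod l" "i mod l < l" using k7 unfolding l_def by auto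
    then have "(i + 1) mod l = i mod l + 1" using False

      using mod_add_left_eq[of i l 1] mod_pos_pos_trivial[of "i mod l + 1" l] by simp
    then have "nat ((i + 1) mod l) = Suc (nat (i mod l))" using \<open>0 \<le> i mod l\<close> by auto
    then show ?thesis using E(1)[OF lt[of i]] unfolding c_def by simp
  qed
  moreover have "c i \<in> A" for i unfolding c_def using E(2)[OF lt] .
  moreover have "c i = c j \<longleftrightarrow> l dvd i - j" for i j
  proof -
    have "c i = c j \<longleftrightarrow> nat (i mod l) = nat (j mod l)"
      unfolding c_def using inj lt by (metis linorder_neqE_nat)
    also have "\<dots> \<longleftrightarrow> i mod l = j mod l"
      using pos_mod_sign[OF l0, of i] pos_mod_sign[OF l0, of j] by (simp add: eq_nat_nat_iff)
    finally show ?thesis by (simp add: mod_eq_dvd_iff)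
  qed
  ultimately have "odd_cycle A l c" unfolding odd_cycle_def l_def using odd k7 by auto
  moreover have "l \<le> int j" if "odd j" "(y, y) \<in> arcs_on A ^^ j" for j y
    using min[of j] that unfolding P_def l_def by auto
  ultimately show ?thesis by (rule that)
qed

end

section \<open>Colourings around a vertex\<close>

text \<open>Turns list colouring of a 7-cycle into a finite check: one period, read from any offset
  \<open>k\<close>. \<open>B\<close>, \<open>D\<close> and \<open>P\<close> are the positions where
  colours 3, 1 and 2 are forbidden.\<close>

lemma seven_periodic_listI:
  fixes B D P :: "int \<Rightarrow> bool" and xs :: "nat list"
  assumes per: "\<And>i. B (i + 7) = B i" "\<And>i. D (i + 7) = D i" "\<And>i. P (i + 7) = P i"
    and xs: "\<forall>t\<in>{0,1,2,3,4,5,6::nat}. xs ! t \<in> {1,2,3} \<and> xs ! t \<noteq> xs ! ((t + 1) mod 7) \<and>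
      (B (k + int t) \<longrightarrow> xs ! t \<noteq> 3) \<and> (D (k + int t) \<longrightarrow> xs ! t \<noteq> 1) \<and> (P (k + int t) \<longrightarrow> xs ! t \<noteq> 2)"
  shows "\<exists>g::int \<Rightarrow> nat. \<forall>i. g (i + 7) = g i \<and> g i \<in> {1,2,3} \<and> g i \<noteq> g (i + 1) \<and>
    (B i \<longrightarrow> g i \<noteq> 3) \<and> (D i \<longrightarrow> g i \<noteq> 1) \<and> (P i \<longrightarrow> g i \<noteq> 2)"
proof -
  define g where "g i = xs ! nat ((i - k) mod 7)" for i
  have per': "X (i + 7 * m) = X i" if "\<And>i. X (i + 7) = X i" for X :: "int \<Rightarrow> bool" and i m
  proof (induction m rule: int_induct[where k = 0])
    case (step1 m) then show ?case using that[of "i + 7 * m"] by (simp add: algebra_simps)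
  next
    case (step2 m) then show ?case using that[of "i + 7 * (m - 1)"] by (simp add: algebra_simps)
  qed simp
  have "g (i + 7) = g i \<and> g i \<in> {1,2,3} \<and> g i \<noteq> g (i + 1) \<and>
    (B i \<longrightarrow> g i \<noteq> 3) \<and> (D i \<longrightarrow> g i \<noteq> 1) \<and> (P i \<longrightarrow> g i \<noteq> 2)" for i
  proof -
    define t where "t = nat ((i - k) mod 7)"
    have t: "int t = (i - k) mod 7" unfolding t_def by simp
    then have "t < 7" using pos_mod_bound[of 7 "i - k"] by linarith
    then have tm: "t \<in> {0,1,2,3,4,5,6}" by auto
    have "i = k + int t + 7 * ((i - k) div 7)" using t by (simp add: minus_mod_eq_mult_div [symmetric])
    then have eq: "X i = X (k + int t)" if "\<And>i. X (i + 7) = X i" for X :: "int \<Rightarrow> bool"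
      using per'[of X "k + int t" "(i - k) div 7"] that by simp
    have gi: "g i = xs ! t" unfolding g_def t_def ..
    have "(i + 1 - k) mod 7 = (int t + 1) mod 7" unfolding t
      by (metis add_diff_eq diff_add_eq mod_add_left_eq)
    also have "\<dots> = int ((t + 1) mod 7)" by (simp add: zmod_int add.commute)
    finally have gi1: "g (i + 1) = xs ! ((t + 1) mod 7)" unfolding g_def by simp
    have "(i + 7 - k) mod 7 = (i - k) mod 7" by (metis diff_add_eq mod_add_self2)
    then have "g (i + 7) = g i" unfolding g_def by simp
    then show ?thesis using xs tm unfolding gi gi1 eq[of B, OF per(1)] eq[of D, OF per(2)] eq[of P, OF per(3)] by blast
  qed
  then show ?thesis by blast
qed

text \<open>Alternate 1 and 2; as 7 is odd, this needs one vertex of colour 3, which must avoid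
  \<open>B\<close>. Four consecutive positions always contain a suitable one. If \<open>D k\<close>
  holds, \<open>P\<close> can occur only at \<open>k + 3\<close> or \<open>k + 4\<close>, and not at
  both; the window of four is chosen accordingly.\<close>

lemma seven_cycle_list_colouring:
  fixes B D P :: "int \<Rightarrow> bool"
  assumes per: "\<And>i. B (i + 7) = B i" "\<And>i. D (i + 7) = D i" "\<And>i. P (i + 7) = P i"
    and B: "\<And>i. \<not> (B i \<and> B (i + 1) \<and> B (i + 2) \<and> B (i + 3))"
    and D: "\<And>i t. D i \<Longrightarrow> D (i + t) \<Longrightarrow> t \<in> {1,2,3,4,5,6} \<Longrightarrow> False"
    and P: "\<And>i. \<not> (P i \<and> P (i + 1))"
    and DP: "\<And>i t. D i \<Longrightarrow> P (i + t) \<Longrightarrow> t \<in> {0,1,2,5,6} \<Longrightarrow> False"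
  shows "\<exists>g::int \<Rightarrow> nat. \<forall>i. g (i + 7) = g i \<and> g i \<in> {1,2,3} \<and> g i \<noteq> g (i + 1) \<and>
    (B i \<longrightarrow> g i \<noteq> 3) \<and> (D i \<longrightarrow> g i \<noteq> 1) \<and> (P i \<longrightarrow> g i \<noteq> 2)"
proof -
  note list7 = seven_periodic_listI[of B D P, OF per]
  show ?thesis
  proof (cases "\<exists>k. D k")
    case True
    then obtain k where k: "D k" by blast
    have Dn: "\<not> D (k + 1)" "\<not> D (k + 2)" "\<not> D (k + 3)" "\<not> D (k + 4)" "\<not> D (k + 5)" "\<not> D (k + 6)"
      using D[OF k] by auto
    have Pn: "\<not> P k" "\<not> P (k + 1)" "\<not> P (k + 2)" "\<not> P (k + 5)" "\<not> P (k + 6)"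
      using DP[OF k] DP[OF k, of 0] by auto
    have "B (k + 7) = B k" using per by blast
    then have B1: "\<not> B (k + 4) \<or> \<not> B (k + 5) \<or> \<not> B (k + 6) \<or> \<not> B k"
      using B[of "k + 4"] by (simp add: add.commute)
    have B2: "\<not> B k \<or> \<not> B (k + 1) \<or> \<not> B (k + 2) \<or> \<not> B (k + 3)" using B[of k] by (simp add: add.commute)
    show ?thesis
    proof (cases "P (k + 4)")
      case False
      note [simp] = Dn Pn False
      consider "\<not> B (k + 4)" | "\<not> B (k + 5)" | "\<not> B (k + 6)" | "\<not> B k" using B1 by blast
      then show ?thesis
      proof cases
        case 1 show ?thesis by (rule list7[of "[2,1,2,1,3,2,1]" k]) (use 1 in simp)
      next
        case 2 show ?thesis by (rule list7[of "[2,1,2,1,2,3,1]" k]) (use 2 in simp)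
      next
        case 3 show ?thesis by (rule list7[of "[2,1,2,1,2,1,3]" k]) (use 3 in simp)
      next
        case 4 show ?thesis by (rule list7[of "[3,1,2,1,2,1,2]" k]) (use 4 in simp)
      qed
    next
      case True
      then have "\<not> P (k + 3)" using P[of "k + 3"] by (simp add: add.commute)
      note [simp] = Dn Pn this
      consider "\<not> B (k + 3)" | "\<not> B (k + 2)" | "\<not> B (k + 1)" | "\<not> B k" using B2 by blast
      then show ?thesis
      proof cases
        case 1 show ?thesis by (rule list7[of "[2,1,2,3,1,2,1]" k]) (use 1 in simp)
      next
        case 2 show ?thesis by (rule list7[of "[2,1,3,2,1,2,1]" k]) (use 2 in simp)
      next
        case 3 show ?thesis by (rule list7[of "[2,3,1,2,1,2,1]" k]) (use 3 in simp)
      next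
        case 4 show ?thesis by (rule list7[of "[3,2,1,2,1,2,1]" k]) (use 4 in simp)
      qed
    qed
  next
    case False
    then have Dn: "\<not> D i" for i by blast
    \<comment> \<open>Offsets 1, 3, 5 and 6 are the only places where the four lists below use
      colour 2. Such a \<open>k\<close> exists because \<open>P\<close> never holds at two
      consecutive positions.\<close>
    have "\<exists>k. \<not> P (k + 1) \<and> \<not> P (k + 3) \<and> \<not> P (k + 5) \<and> \<not> P (k + 6)"
    proof (rule ccontr)
      assume "\<not> ?thesis"
      then have no: "P (k + 1) \<or> P (k + 3) \<or> P (k + 5) \<or> P (k + 6)" for k by blast
      have p: "P 7 = P 0" "P 8 = P 1" "P 9 = P 2" "P 10 = P 3" "P 11 = P 4" "P 12 = P 5"
        using per(3)[of 0] per(3)[of 1] per(3)[of 2] per(3)[of 3] per(3)[of 4] per(3)[of 5] by simp_all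
      have q: "\<not> (P 0 \<and> P 1)" "\<not> (P 1 \<and> P 2)" "\<not> (P 2 \<and> P 3)" "\<not> (P 3 \<and> P 4)"
        "\<not> (P 4 \<and> P 5)" "\<not> (P 5 \<and> P 6)" "\<not> (P 6 \<and> P 0)"
        using P[of 0] P[of 1] P[of 2] P[of 3] P[of 4] P[of 5] P[of 6] p by simp_all
      have r: "P 1 \<or> P 3 \<or> P 5 \<or> P 6" "P 2 \<or> P 4 \<or> P 6 \<or> P 0" "P 3 \<or> P 5 \<or> P 0 \<or> P 1"
        "P 4 \<or> P 6 \<or> P 1 \<or> P 2" "P 5 \<or> P 0 \<or> P 2 \<or> P 3" "P 6 \<or> P 1 \<or> P 3 \<or> P 4"
        "P 0 \<or> P 2 \<or> P 4 \<or> P 5"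
        using no[of 0] no[of 1] no[of 2] no[of 3] no[of 4] no[of 5] no[of 6] by (simp_all add: p)
      show False using q r by argo
    qed
    then obtain k where Pn: "\<not> P (k + 1)" "\<not> P (k + 3)" "\<not> P (k + 5)" "\<not> P (k + 6)" by blast
    note [simp] = Dn Pn
    have "B (k + 7) = B k" using per by blast
    then have "\<not> B (k + 4) \<or> \<not> B (k + 5) \<or> \<not> B (k + 6) \<or> \<not> B k"
      using B[of "k + 4"] by (simp add: add.commute)
    then consider "\<not> B (k + 6)" | "\<not> B (k + 5)" | "\<not> B k" | "\<not> B (k + 4)" by blast
    then show ?thesis
    proof cases
      case 1 show ?thesis by (rule list7[of "[1,2,1,2,1,2,3]" k]) (use 1 in simp)
    next
      case 2 show ?thesis by (rule list7[of "[1,2,1,2,1,3,2]" k]) (use 2 in simp)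
    next
      case 3 show ?thesis by (rule list7[of "[3,2,1,2,1,2,1]" k]) (use 3 in simp)
    next
      case 4 show ?thesis by (rule list7[of "[1,2,1,2,3,1,2]" k]) (use 4 in simp)
    qed
  qed
qed

section \<open>Distance classes around a vertex\<close>

context sgraph
begin

definition deg :: "'a \<Rightarrow> nat" where "deg x = card (nb x)"

definition N2 :: "'a \<Rightarrow> 'a set" where
  "N2 v = {a. a \<noteq> v \<and> (\<exists>u. E v u \<and> E u a)}"

text \<open>The set \<open>R\<close> of the overview: the vertices at distance at least 3 from
  \<open>v\<close>.\<close>

definition far :: "'a \<Rightarrow> 'a set" where
  "far v = V - {v} - nb v - N2 v"

lemma N2_not_nb: "a \<in> N2 v \<Longrightarrow> \<not> E v a"
  unfolding N2_def using no3 Esym by blast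

lemma N2_indep: "a \<in> N2 v \<Longrightarrow> b \<in> N2 v \<Longrightarrow> \<not> E a b"
  unfolding N2_def using no5 Esym by blast

lemma N2_V: "N2 v \<subseteq> V" unfolding N2_def using inV2 by auto

lemma far_V: "far v \<subseteq> V" unfolding far_def by auto

lemma nb_not_far: "E v u \<Longrightarrow> E u r \<Longrightarrow> r \<notin> far v"
  unfolding far_def N2_def by blast

lemma finite_N2 [simp]: "finite (N2 v)" using N2_V fin finite_subset by blast

lemma finite_far [simp]: "finite (far v)" using far_V fin finite_subset by blast

lemma N2_unique_parent:
  assumes "E v u" "E u a" "E v u'" "E u' a" "a \<noteq> v"
  shows "u = u'"
  using no4[of v u a u'] assms Esym by blast

lemma N2_nb: assumes "E v u" "E u a" "a \<noteq> v" shows "nb a \<subseteq> insert u (far v)"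
proof
  fix y assume "y \<in> nb a"
  then have y: "E a y" by simp
  have a: "a \<in> N2 v" unfolding N2_def using assms by blast
  have "y \<in> V" "y \<noteq> v" using y inV2 N2_not_nb[OF a] Esym by blast+
  moreover have "y \<notin> N2 v" using N2_indep[OF a] y by blast
  moreover have "y = u" if "E v y" using N2_unique_parent[of v u a y] that assms y Esym by blast
  ultimately show "y \<in> insert u (far v)" unfolding far_def by auto
qed

lemma card_N2_nb_far:
  assumes "a \<in> N2 v" shows "deg a \<le> Suc (card (nb a \<inter> far v))"
proof -
  obtain u where u: "E v u" "E u a" "a \<noteq> v" using assms unfolding N2_def by blast
  have "nb a \<subseteq> insert u (nb a \<inter> far v)" using N2_nb[OF u] by auto
  then have "card (nb a) \<le> card (insert u (nb a \<inter> far v))" by (intro card_mono) auto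
  also have "\<dots> \<le> Suc (card (nb a \<inter> far v))" by (simp add: card_insert_le_m1 card_insert_if)
  finally show ?thesis unfolding deg_def .
qed

text \<open>Without 4-cycles a vertex at distance 2 has a single parent, so the sets of children are
  disjoint.\<close>

lemma card_N2: "card (N2 v) = (\<Sum>u\<in>nb v. deg u - 1)"
proof -
  have "N2 v = (\<Union>u\<in>nb v. nb u - {v})" unfolding N2_def by auto
  also have "card \<dots> = (\<Sum>u\<in>nb v. card (nb u - {v}))"
  proof (rule card_UN_disjoint)
    show "\<forall>i\<in>nb v. \<forall>j\<in>nb v. i \<noteq> j \<longrightarrow> (nb i - {v}) \<inter> (nb j - {v}) = {}"
      using N2_unique_parent by auto
  qed auto
  also have "\<dots> = (\<Sum>u\<in>nb v. deg u - 1)"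
    unfolding deg_def by (intro sum.cong refl) (auto simp: E_comm)
  finally show ?thesis .
qed

lemma card_V_far:
  assumes "v \<in> V" shows "card V = 1 + deg v + card (N2 v) + card (far v)"
proof -
  have V: "V = insert v (nb v \<union> N2 v \<union> far v)"
    unfolding far_def using assms nb_V N2_V by blast
  have 1: "v \<notin> nb v \<union> N2 v \<union> far v" using irr by (auto simp: N2_def far_def)
  have 2: "(nb v \<union> N2 v) \<inter> far v = {}" by (auto simp: far_def)
  have 3: "nb v \<inter> N2 v = {}" using N2_not_nb by auto
  have "card V = Suc (card (nb v \<union> N2 v \<union> far v))" by (subst V) (use 1 in simp)
  also have "\<dots> = Suc (card (nb v) + card (N2 v) + card (far v))"
    using 2 3 by (simp add: card_Un_disjoint)
  finally show ?thesis unfolding deg_def by simp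
qed

text \<open>Colour the neighbours of \<open>v\<close> with 3; the second neighbourhood then takes colours 1 and 2.\<close>

lemma col3_from_far:
  fixes f :: "'a \<Rightarrow> nat"
  assumes proper: "\<And>r r'. r \<in> far v \<Longrightarrow> r' \<in> far v \<Longrightarrow> E r r' \<Longrightarrow> f r \<noteq> f r'"
    and rng: "\<And>r. r \<in> far v \<Longrightarrow> f r \<in> {1,2,3}"
    and N2: "\<And>a r r'. a \<in> N2 v \<Longrightarrow> r \<in> far v \<Longrightarrow> r' \<in> far v \<Longrightarrow> E a r \<Longrightarrow> E a r' \<Longrightarrow>
      f r = 1 \<Longrightarrow> f r' = 2 \<Longrightarrow> False"
  shows col3
proof -
  define S where "S = nb v \<union> {r \<in> far v. f r = 3}"
  have SV: "S \<subseteq> V" unfolding S_def using nb_V far_V by auto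
  have "\<not> E x y" if "x \<in> S" "y \<in> S" for x y
  proof
    assume xy: "E x y"
    have "y \<in> nb v" if "x \<in> nb v" using nb_not_far[of v x y] that xy \<open>y \<in> S\<close> unfolding S_def by auto
    moreover have "x \<in> nb v" if "y \<in> nb v"
      using nb_not_far[of v y x] that Esym[OF xy] \<open>x \<in> S\<close> unfolding S_def by auto
    moreover have "x \<notin> nb v \<or> y \<notin> nb v" using no3[of v x y] xy Esym by auto
    ultimately have "x \<in> far v" "f x = 3" "y \<in> far v" "f y = 3" using that unfolding S_def by auto
    then show False using proper xy by fastforce
  qed
  then have ind: "indep S" unfolding indep_def by blast
  \<comment> \<open>\<open>g x\<close> stands for colour 1: a vertex of \<open>N2 v\<close> takes it
    unless a neighbour in \<open>far v\<close> already has it. In that case it takes colour 2, which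
    by the hypothesis \<open>N2\<close> none of its neighbours in \<open>far v\<close> has.\<close>
  define g where "g x \<longleftrightarrow> (if x \<in> far v then f x = 1 else \<not> (\<exists>r\<in>far v. E x r \<and> f r = 1))" for x
  have key: "g x \<noteq> g y" if h: "x \<in> N2 v" "y \<in> far v" "f y \<noteq> 3" "E x y" for x y
  proof -
    have x: "x \<notin> far v" using h(1) unfolding far_def by blast
    consider "f y = 1" | "f y = 2" using rng[OF h(2)] h(3) by auto
    then show ?thesis
    proof cases
      case 1 then show ?thesis using x h unfolding g_def by auto
    next
      case 2
      then have "\<not> (\<exists>r\<in>far v. E x r \<and> f r = 1)" using N2 h by blast
      then show ?thesis using x h 2 unfolding g_def by auto
    qed
  qed
  have "g x \<noteq> g y" if h: "x \<in> V - S" "y \<in> V - S" "E x y" for x y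
  proof -
    have "z \<in> N2 v \<or> z \<in> far v \<and> f z \<noteq> 3" if "z \<in> V - S" "z \<noteq> v" for z
      using that unfolding S_def far_def by auto
    moreover have "x \<noteq> v" "y \<noteq> v" using h unfolding S_def using Esym by auto
    ultimately consider "x \<in> N2 v" "y \<in> N2 v" | "x \<in> N2 v" "y \<in> far v" "f y \<noteq> 3"
      | "y \<in> N2 v" "x \<in> far v" "f x \<noteq> 3" | "x \<in> far v" "f x \<noteq> 3" "y \<in> far v" "f y \<noteq> 3"
      using h by blast
    then show ?thesis
    proof cases
      case 1 then show ?thesis using N2_indep h by blast
    next
      case 2 then show ?thesis using key h by blast
    next
      case 3 then show ?thesis using key[of y x] h Esym by blast
    next
      case 4
      then have "f x \<noteq> f y" using proper h by blast
      then show ?thesis using 4 rng[of x] rng[of y] unfolding g_def by auto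
    qed
  qed
  then have "bip (V - S)" unfolding bip_def by blast
  then show col3 unfolding col3_def using SV ind by blast
qed

text \<open>A bipartite \<open>far v\<close> could be coloured with 1 and 3 only; then the condition
  on \<open>N2 v\<close> in \<open>col3_from_far\<close> is vacuous.\<close>

lemma far_not_bip:
  assumes "\<not> col3" shows "\<not> bip (far v)"
proof
  assume "bip (far v)"
  then obtain f :: "'a \<Rightarrow> bool" where f: "\<And>x y. x \<in> far v \<Longrightarrow> y \<in> far v \<Longrightarrow> E x y \<Longrightarrow> f x \<noteq> f y"
    unfolding bip_def by blast
  have col3
  proof (rule col3_from_far[of v "\<lambda>x. if f x then 1 else 3"])
    fix r r' assume "r \<in> far v" "r' \<in> far v" "E r r'"
    from f[OF this] show "(if f r then 1 else 3::nat) \<noteq> (if f r' then 1 else 3)" by simp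
  qed (simp_all split: if_splits)
  then show False using assms by blast
qed

lemma odd_cycleD:
  assumes "odd_cycle A l c"
  shows "odd l" "7 \<le> l" "c i \<in> A" "E (c i) (c (i + 1))" "c i = c j \<longleftrightarrow> l dvd i - j" "c (i + l) = c i"
proof -
  show "odd l" "7 \<le> l" "c i \<in> A" "E (c i) (c (i + 1))" and *: "\<And>i j. c i = c j \<longleftrightarrow> l dvd i - j"
    using assms unfolding odd_cycle_def by auto
  show "c (i + l) = c i" using *[of "i + l" i] by simp
qed

lemma odd_cycle_shift: "odd_cycle A l c \<Longrightarrow> odd_cycle A l (\<lambda>i. c (i + k))"
  unfolding odd_cycle_def by (auto simp: add.assoc add.commute[of 1 k]) (metis add.assoc add.commute)

lemma odd_cycle_reflect: assumes "odd_cycle A l c" shows "odd_cycle A l (\<lambda>i. c (- i))"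
proof -
  have "E (c (- i)) (c (- (i + 1)))" for i
    using odd_cycleD(4)[OF assms, of "- (i + 1)"] Esym by simp
  moreover have "c (- i) = c (- j) \<longleftrightarrow> l dvd i - j" for i j
    using odd_cycleD(5)[OF assms, of "- i" "- j"] dvd_minus_iff[of l "i - j"] by simp
  ultimately show ?thesis using assms unfolding odd_cycle_def by auto
qed

lemma odd_cycle_mod:
  assumes "odd_cycle A l c"
  obtains d where "0 \<le> d" "d < l" "c j = c (i + d)"
proof -
  have l: "0 < l" using odd_cycleD(2)[OF assms] by simp
  have "c j = c (i + (j - i) mod l)"
    unfolding odd_cycleD(5)[OF assms] by (metis diff_diff_eq dvd_minus_mod)
  then show ?thesis using that[of "(j - i) mod l"] l by simp
qed

lemma odd_cycle_neq:
  assumes "odd_cycle A l c" "0 < d" "d < l"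
  shows "c (i + d) \<noteq> c i"
  using assms(2,3) zdvd_not_zless by (auto simp: odd_cycleD(5)[OF assms(1)])

lemma odd_cycle_range:
  assumes "odd_cycle A l c"
  shows "range c = c ` {0..<l}" "card (range c) = nat l" "finite (range c)" "range c \<subseteq> A"
proof -
  have l: "0 < l" using odd_cycleD(2)[OF assms] by simp
  show r: "range c = c ` {0..<l}"
  proof
    show "range c \<subseteq> c ` {0..<l}"
    proof
      fix x assume "x \<in> range c"
      then obtain j where "x = c j" by blast
      moreover obtain d where "0 \<le> d" "d < l" "c j = c (0 + d)" using odd_cycle_mod[OF assms] .
      ultimately show "x \<in> c ` {0..<l}" by auto
    qed
  qed auto
  have "inj_on c {0..<l}"
  proof (rule inj_onI)
    fix i j assume "i \<in> {0..<l}" "j \<in> {0..<l}" "c i = c j"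
    then have "l dvd i - j" "\<bar>i - j\<bar> < l" using odd_cycleD(5)[OF assms] by auto
    then show "i = j" by (metis dvd_imp_le_int eq_iff_diff_eq_0 abs_of_pos l linorder_not_less)
  qed
  then show "card (range c) = nat l" unfolding r by (simp add: card_image)
  show "finite (range c)" unfolding r by simp
  show "range c \<subseteq> A" using odd_cycleD(3)[OF assms] by auto
qed

text \<open>Two neighbours of \<open>x\<close> at distance 1, 2 or 3 along the cycle would close a
  cycle of length 3, 4 or 5 through \<open>x\<close>. At distance 2 the vertex \<open>x\<close> may
  itself be the cycle vertex in between.\<close>

lemma odd_cycle_near:
  assumes "odd_cycle A l c" "E x (c i)"
  shows "\<not> E x (c (i + 1))" "x \<noteq> c (i + 1) \<Longrightarrow> \<not> E x (c (i + 2))" "\<not> E x (c (i + 3))"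
    "\<not> E x (c (i - 1))" "x \<noteq> c (i - 1) \<Longrightarrow> \<not> E x (c (i - 2))" "\<not> E x (c (i - 3))"
proof -
  have e: "E (c i) (c (i + 1))" "E (c (i + 1)) (c (i + 2))" "E (c (i + 2)) (c (i + 3))"
    "E (c (i - 1)) (c i)" "E (c (i - 2)) (c (i - 1))" "E (c (i - 3)) (c (i - 2))"
    using odd_cycleD(4)[OF assms(1), of i] odd_cycleD(4)[OF assms(1), of "i + 1"]
      odd_cycleD(4)[OF assms(1), of "i + 2"] odd_cycleD(4)[OF assms(1), of "i - 1"]
      odd_cycleD(4)[OF assms(1), of "i - 2"] odd_cycleD(4)[OF assms(1), of "i - 3"]
    by (simp_all add: algebra_simps)
  have ne: "c (i + 2) \<noteq> c i" "c (i - 2) \<noteq> c i"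
    using odd_cycle_neq[OF assms(1), of 2 i] odd_cycle_neq[OF assms(1), of 2 "i - 2"]
      odd_cycleD(2)[OF assms(1)] by auto
  show "\<not> E x (c (i + 1))" "\<not> E x (c (i - 1))" using e no3 assms(2) Esym by blast+
  show "\<not> E x (c (i + 2))" if "x \<noteq> c (i + 1)"
    using no4[OF assms(2) e(1,2)] that ne Esym by metis
  show "\<not> E x (c (i - 2))" if "x \<noteq> c (i - 1)"
    using no4[of x "c i" "c (i - 1)" "c (i - 2)"] assms(2) e that ne Esym by metis
  show "\<not> E x (c (i + 3))" "\<not> E x (c (i - 3))"
    using e no5 assms(2) Esym by blast+
qed

text \<open>Any two positions on a 7-cycle are at most 3 apart, so \<open>odd_cycle_near\<close>
  covers all of them.\<close>

lemma seven_cycle_one_nb: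
  assumes c: "odd_cycle A 7 c" and "E x (c i)" "E x (c j)" "x \<notin> range c"
  shows "c j = c i"
proof -
  obtain d where d: "0 \<le> d" "d < 7" "c j = c (i + d)" using odd_cycle_mod[OF c] .
  have x: "x \<noteq> c k" for k using assms(4) by auto
  have "c (i + 4) = c (i - 3)" "c (i + 5) = c (i - 2)" "c (i + 6) = c (i - 1)"
    using odd_cycleD(6)[OF c, of "i - 3"] odd_cycleD(6)[OF c, of "i - 2"] odd_cycleD(6)[OF c, of "i - 1"]
    by (simp_all add: add.commute)
  moreover have "d = 0 \<or> d = 1 \<or> d = 2 \<or> d = 3 \<or> d = 4 \<or> d = 5 \<or> d = 6" using d by auto
  ultimately show ?thesis using odd_cycle_near[OF c assms(2)] d(3) assms(3) x by auto
qed

lemma seven_cycle_induced: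
  assumes c: "odd_cycle A 7 c" and "E (c i) (c j)"
  shows "c j = c (i + 1) \<or> c j = c (i - 1)"
proof -
  obtain d where d: "0 \<le> d" "d < 7" "c j = c (i + d)" using odd_cycle_mod[OF c] .
  have e: "E (c i) (c (i + 1))" "E (c i) (c (i - 1))"
    using odd_cycleD(4)[OF c, of i] odd_cycleD(4)[OF c, of "i - 1"] Esym by simp_all
  have ne: "c i \<noteq> c (i + 2)" "c i \<noteq> c (i - 2)"
    using odd_cycle_neq[OF c, of 2 i] odd_cycle_neq[OF c, of 2 "i - 2"] by auto
  have "\<not> E (c i) (c (i + 2))" "\<not> E (c i) (c (i + 3))" "\<not> E (c i) (c (i - 2))" "\<not> E (c i) (c (i - 3))"
    using odd_cycle_near(1)[OF c e(1)] odd_cycle_near(2)[OF c e(1)]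
      odd_cycle_near(4)[OF c e(2)] odd_cycle_near(5)[OF c e(2)] ne by (simp_all add: algebra_simps)
  moreover have "c (i + 4) = c (i - 3)" "c (i + 5) = c (i - 2)" "c (i + 6) = c (i - 1)"
    using odd_cycleD(6)[OF c, of "i - 3"] odd_cycleD(6)[OF c, of "i - 2"] odd_cycleD(6)[OF c, of "i - 1"]
    by (simp_all add: add.commute)
  moreover have "d = 0 \<or> d = 1 \<or> d = 2 \<or> d = 3 \<or> d = 4 \<or> d = 5 \<or> d = 6" using d by auto
  ultimately show ?thesis using d(3) assms(2) irr[of "c i"] by auto
qed

end

section \<open>Extending colourings around cycles of length 7 and 9\<close>

context sgraph
begin

lemma indep_subset: "indep B \<Longrightarrow> A \<subseteq> B \<Longrightarrow> indep A"
  unfolding indep_def by auto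

lemma cycle_colour:
  fixes g :: "int \<Rightarrow> 'b"
  assumes c: "odd_cycle A l c" and g: "\<And>i. g (i + l) = g i"
  obtains f where "\<And>i. f (c i) = g i"
proof -
  have per: "g (i + l * m) = g i" for i m
  proof (induction m rule: int_induct[where k = 0])
    case (step1 m) then show ?case using g[of "i + l * m"] by (simp add: algebra_simps)
  next
    case (step2 m) then show ?case using g[of "i + l * (m - 1)"] by (simp add: algebra_simps)
  qed simp
  have "g (inv c (c i)) = g i" for i
  proof -
    have "c (inv c (c i)) = c i" by (simp add: f_inv_into_f)
    then obtain m where "inv c (c i) - i = l * m" using odd_cycleD(5)[OF c] by blast
    then have "inv c (c i) = i + l * m" by simp
    then show ?thesis using per[of i m] by (simp only:)
  qed
  then show ?thesis using that[of "\<lambda>x. g (inv c x)"] by blast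
qed

text \<open>The vertices off the cycle get colour 3, except that \<open>j\<close> gets colour 1. This leaves a list colouring
  problem on the cycle: neighbours of the former must avoid 3, the neighbour of \<open>j\<close> must avoid 1, and
  vertices joined to \<open>j\<close> through the second neighbourhood of \<open>v\<close> must avoid 2.\<close>

lemma col3_seven_cycle:
  assumes c: "odd_cycle (far v) 7 c" and Q: "card (far v - range c) \<le> 4"
    and j: "indep (far v - range c - {j})"
  shows col3
proof -
  define Q where "Q = far v - range c"
  have finQ: "finite Q" unfolding Q_def by simp
  \<comment> \<open>At most three vertices may forbid colour 3, since the list colouring must avoid
    four consecutive such positions. If \<open>Q\<close> is already independent, an arbitrary vertex
    is moved to \<open>J\<close> to reach this bound.\<close>
  have "\<exists>J\<subseteq>Q. card J \<le> 1 \<and> card (Q - J) \<le> 3 \<and> indep (Q - J)"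
  proof (cases "j \<in> Q")
    case True
    then show ?thesis using Q j finQ unfolding Q_def[symmetric]
      by (intro exI[of _ "{j}"]) (auto simp: card_Diff_singleton)
  next
    case False
    then have i: "indep Q" using j unfolding Q_def[symmetric] by simp
    show ?thesis
    proof (cases "Q = {}")
      case True then show ?thesis by (intro exI[of _ "{}"]) (auto simp: indep_def)
    next
      case False
      then obtain k where "k \<in> Q" by blast
      then show ?thesis using Q i finQ unfolding Q_def[symmetric]
        by (intro exI[of _ "{k}"]) (auto simp: card_Diff_singleton intro: indep_subset)
    qed
  qed
  then obtain J where J: "J \<subseteq> Q" "card J \<le> 1" "card (Q - J) \<le> 3" "indep (Q - J)" by blast
  define I where "I = Q - J"
  have finJ: "finite J" using J(1) finQ finite_subset by blast
  have J1: "q = q'" if "q \<in> J" "q' \<in> J" for q q'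
    using J(2) finJ that card_le_Suc0_iff_eq[of J] by auto
  have QC: "q \<notin> range c" "q \<in> far v" if "q \<in> Q" for q using that unfolding Q_def by auto
  have cfar: "c i \<in> far v" for i using odd_cycleD(3)[OF c] .
  have N2C: "a \<notin> range c" if "a \<in> N2 v" for a using that cfar unfolding far_def by auto
  define B where "B i \<longleftrightarrow> (\<exists>q\<in>I. E q (c i))" for i
  define D where "D i \<longleftrightarrow> (\<exists>q\<in>J. E q (c i))" for i
  define P where "P i \<longleftrightarrow> (\<exists>q\<in>J. \<exists>a\<in>N2 v. E q a \<and> E a (c i))" for i
  have c7: "c (i + 7) = c i" for i using odd_cycleD(6)[OF c] .
  have ce: "E (c i) (c (i + 1))" for i using odd_cycleD(4)[OF c] .
  have "\<exists>g::int \<Rightarrow> nat. \<forall>i. g (i + 7) = g i \<and> g i \<in> {1,2,3} \<and> g i \<noteq> g (i + 1) \<and>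
    (B i \<longrightarrow> g i \<noteq> 3) \<and> (D i \<longrightarrow> g i \<noteq> 1) \<and> (P i \<longrightarrow> g i \<noteq> 2)"
  proof (rule seven_cycle_list_colouring)
    fix i
    show "B (i + 7) = B i" "D (i + 7) = D i" "P (i + 7) = P i"
      unfolding B_def D_def P_def c7 by auto
    show "\<not> (B i \<and> B (i + 1) \<and> B (i + 2) \<and> B (i + 3))"
    proof
      assume "B i \<and> B (i + 1) \<and> B (i + 2) \<and> B (i + 3)"
      then obtain q0 q1 q2 q3 where q: "q0 \<in> I" "q1 \<in> I" "q2 \<in> I" "q3 \<in> I"
        "E q0 (c i)" "E q1 (c (i + 1))" "E q2 (c (i + 2))" "E q3 (c (i + 3))"
        unfolding B_def by blast
      \<comment> \<open>Each vertex of \<open>I\<close> sees at most one cycle vertex, so four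
        forbidden positions would need four vertices of \<open>I\<close>.\<close>
      have one: "c k = c m" if "q \<in> I" "E q (c m)" "E q (c k)" for q k m
        using seven_cycle_one_nb[OF c, of q m k] that QC unfolding I_def by blast
      have ne: "c i \<noteq> c (i + 1)" "c i \<noteq> c (i + 2)" "c i \<noteq> c (i + 3)" "c (i + 1) \<noteq> c (i + 2)"
        "c (i + 1) \<noteq> c (i + 3)" "c (i + 2) \<noteq> c (i + 3)"
        unfolding odd_cycleD(5)[OF c] by simp_all
      have "q0 \<noteq> q1" "q0 \<noteq> q2" "q0 \<noteq> q3" "q1 \<noteq> q2" "q1 \<noteq> q3" "q2 \<noteq> q3"
        using one q ne by metis+
      then have "card {q0, q1, q2, q3} = 4" by simp
      moreover have "card {q0, q1, q2, q3} \<le> card I"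
        by (rule card_mono) (use q finQ in \<open>auto simp: I_def\<close>)
      ultimately show False using J(3) unfolding I_def by simp
    qed
    \<comment> \<open>Otherwise \<open>q\<close>, \<open>a\<close>, \<open>c i\<close>,
      \<open>c (i + 1)\<close>, \<open>a'\<close> is a closed walk of length 5.\<close>
    show "\<not> (P i \<and> P (i + 1))"
    proof
      assume "P i \<and> P (i + 1)"
      then obtain q a q' a' where h: "q \<in> J" "q' \<in> J" "E q a" "E a (c i)" "E q' a'" "E a' (c (i + 1))"
        unfolding P_def by blast
      then have "q' = q" using J1 by blast
      then show False using no5[of q a "c i" "c (i + 1)" a'] h ce Esym by blast
    qed
    show "False" if h: "D i" "D (i + t)" "t \<in> {1,2,3,4,5,6}" for t
    proof -
      obtain q q' where q: "q \<in> J" "q' \<in> J" "E q (c i)" "E q' (c (i + t))" using h unfolding D_def by blast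
      then have "c (i + t) = c i" using seven_cycle_one_nb[OF c, of q i "i + t"] J1[of q q'] QC J(1) by blast
      then show False using odd_cycle_neq[OF c, of t i] h by auto
    qed
    \<comment> \<open>Offsets 5 and 6 are -2 and -1, so the walk from \<open>q\<close> through
      \<open>a\<close> to \<open>c (i + t)\<close>, along the cycle to \<open>c i\<close> and back
      to \<open>q\<close> has length at most 5.\<close>
    show "False" if h: "D i" "P (i + t)" "t \<in> {0,1,2,5,6}" for t
    proof -
      obtain q q' a where q: "q \<in> J" "q' \<in> J" "E q (c i)" "a \<in> N2 v" "E q' a" "E a (c (i + t))"
        using h unfolding D_def P_def by blast
      then have qa: "E q a" using J1 by blast
      have qn: "q \<notin> range c" using q J QC by blast
      have an: "a \<notin> range c" using N2C q by blast
      have e: "E (c (i + 1)) (c (i + 2))" "E (c (i - 1)) (c i)" "E (c (i - 2)) (c (i - 1))"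
        using ce[of "i + 1"] ce[of "i - 1"] ce[of "i - 2"] by (simp_all add: add.commute)
      have s: "c (i + 6) = c (i - 1)" "c (i + 5) = c (i - 2)"
        using c7[of "i - 1"] c7[of "i - 2"] by (simp_all add: add.commute)
      have aq: "E a q" using qa Esym by blast
      have n0: "\<not> E a (c i)" using no3[of q a "c i"] q(3) qa Esym by blast
      have n1: "\<not> E a (c (i + 1))"
        using no4[OF q(3) ce[of i], of a] aq qn an Esym by blast
      have n2: "\<not> E a (c (i + 2))"
        using no5[OF q(3) ce[of i] e(1) _ aq] Esym by blast
      have m1: "\<not> E a (c (i - 1))"
        using no4[OF q(3) Esym[OF e(2)], of a] aq qn an Esym by blast
      have m2: "\<not> E a (c (i - 2))"
        using no5[OF q(3) Esym[OF e(2)] Esym[OF e(3)] _ aq] Esym by blast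
      show False using q(6) h(3) n0 n1 n2 m1 m2 s by auto
    qed
  qed
  then obtain g :: "int \<Rightarrow> nat" where g: "\<And>i. g (i + 7) = g i" "\<And>i. g i \<in> {1,2,3}" "\<And>i. g i \<noteq> g (i + 1)"
    "\<And>i. B i \<Longrightarrow> g i \<noteq> 3" "\<And>i. D i \<Longrightarrow> g i \<noteq> 1" "\<And>i. P i \<Longrightarrow> g i \<noteq> 2" by blast
  obtain f0 where f0: "\<And>i. f0 (c i) = g i" using cycle_colour[OF c, of g] g(1) by blast
  define f where "f x = (if x \<in> range c then f0 x else if x \<in> I then 3 else 1)" for x
  have fc: "f (c i) = g i" for i unfolding f_def using f0 by simp
  have fI: "f x = 3" if "x \<in> I" for x using that QC unfolding f_def I_def by auto
  have fJ: "f x = 1" if "x \<in> J" for x using that QC J(1) unfolding f_def I_def by auto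
  have far_cases: "(\<exists>i. r = c i) \<or> r \<in> I \<or> r \<in> J" if "r \<in> far v" for r
    using that unfolding I_def Q_def by blast
  have cI: "f (c i) \<noteq> f q" if "q \<in> I" "E q (c i)" for i q
    using g(4)[of i] that fI fc unfolding B_def by auto
  have cJ: "f (c i) \<noteq> f q" if "q \<in> J" "E q (c i)" for i q
    using g(5)[of i] that fJ fc unfolding D_def by auto
  show col3
  proof (rule col3_from_far[of v f])
    fix r assume r: "r \<in> far v"
    then show "f r \<in> {1,2,3}" using far_cases[OF r] fI fJ fc g(2) by (metis insertCI)
  next
    fix r r' assume r: "r \<in> far v" "r' \<in> far v" "E r r'"
    have cc: "f (c i) \<noteq> f (c k)" if "E (c i) (c k)" for i k
    proof -
      from seven_cycle_induced[OF c that] show ?thesis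
      proof
        assume "c k = c (i + 1)" then show ?thesis using g(3)[of i] fc by metis
      next
        assume "c k = c (i - 1)" then show ?thesis using g(3)[of "i - 1"] fc by (metis diff_add_cancel)
      qed
    qed
    from far_cases[OF r(1)] far_cases[OF r(2)] show "f r \<noteq> f r'"
    proof (elim disjE exE)
      fix i k assume "r = c i" "r' = c k" then show ?thesis using cc r by blast
    next
      fix i assume "r = c i" "r' \<in> I" then show ?thesis using cI[of r' i] r Esym by blast
    next
      fix i assume "r = c i" "r' \<in> J" then show ?thesis using cJ[of r' i] r Esym by blast
    next
      fix i assume "r' = c i" "r \<in> I" then show ?thesis using cI[of r i] r by metis
    next
      fix i assume "r' = c i" "r \<in> J" then show ?thesis using cJ[of r i] r by metis
    next
      assume "r \<in> I" "r' \<in> I" then show ?thesis using J(4) r unfolding I_def indep_def by blast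
    next
      assume "r \<in> J" "r' \<in> J" then show ?thesis using J1 r irr by blast
    qed (use fI fJ in auto)
  next
    \<comment> \<open>Colour 2 occurs only on the cycle. If \<open>r\<close> is on the cycle as
      well, \<open>a\<close> has two neighbours there; if \<open>r\<close> is in \<open>J\<close>,
      the position of \<open>r'\<close> satisfies \<open>P\<close>.\<close>
    fix a r r' assume a: "a \<in> N2 v" "r \<in> far v" "r' \<in> far v" "E a r" "E a r'" "f r = 1" "f r' = 2"
    obtain k where k: "r' = c k" using far_cases[OF a(3)] fI fJ a(7) by fastforce
    have "r \<notin> I" using fI a(6) by fastforce
    with far_cases[OF a(2)] consider i where "r = c i" | "r \<in> J" by blast
    then show False
    proof cases
      case 1
      then have "c k = c i" using seven_cycle_one_nb[OF c, of a i k] a k N2C by blast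
      then show False using a 1 k by simp
    next
      case 2
      then have "P k" unfolding P_def using a k Esym by blast
      then show False using g(6) fc a k by metis
    qed
  qed
qed

text \<open>Offsets up to 3 are excluded as on the 7-cycle; on a 9-cycle only 4 and -4
  remain.\<close>

lemma nine_cycle_nb:
  assumes c: "odd_cycle A 9 c" and "E x (c i)" "E x (c j)" "x \<notin> range c"
  shows "c j = c i \<or> c j = c (i + 4) \<or> c j = c (i - 4)"
proof -
  obtain d where d: "0 \<le> d" "d < 9" "c j = c (i + d)" using odd_cycle_mod[OF c] .
  have x: "x \<noteq> c k" for k using assms(4) by auto
  have "c (i + 5) = c (i - 4)" "c (i + 6) = c (i - 3)" "c (i + 7) = c (i - 2)" "c (i + 8) = c (i - 1)"
    using odd_cycleD(6)[OF c, of "i - 4"] odd_cycleD(6)[OF c, of "i - 3"]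
      odd_cycleD(6)[OF c, of "i - 2"] odd_cycleD(6)[OF c, of "i - 1"]
    by (simp_all add: add.commute)
  moreover have "d = 0 \<or> d = 1 \<or> d = 2 \<or> d = 3 \<or> d = 4 \<or> d = 5 \<or> d = 6 \<or> d = 7 \<or> d = 8" using d by auto
  ultimately show ?thesis using odd_cycle_near[OF c assms(2)] d(3) assms(3) x by auto
qed

lemma nine_cycle_induced:
  assumes c: "odd_cycle A 9 c" and "E (c i) (c j)"
  shows "c j = c (i + 1) \<or> c j = c (i - 1)"
proof -
  obtain d where d: "0 \<le> d" "d < 9" "c j = c (i + d)" using odd_cycle_mod[OF c] .
  have e: "E (c i) (c (i + 1))" "E (c i) (c (i - 1))"
    using odd_cycleD(4)[OF c, of i] odd_cycleD(4)[OF c, of "i - 1"] Esym by simp_all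
  have ne: "c i \<noteq> c (i + 2)" "c i \<noteq> c (i - 2)"
    using odd_cycle_neq[OF c, of 2 i] odd_cycle_neq[OF c, of 2 "i - 2"] by auto
  have "\<not> E (c i) (c (i + 2))" "\<not> E (c i) (c (i + 3))" "\<not> E (c i) (c (i - 2))" "\<not> E (c i) (c (i - 3))"
    "\<not> E (c i) (c (i + 4))" "\<not> E (c i) (c (i - 4))"
    using odd_cycle_near(1)[OF c e(1)] odd_cycle_near(2)[OF c e(1)] odd_cycle_near(3)[OF c e(1)]
      odd_cycle_near(4)[OF c e(2)] odd_cycle_near(5)[OF c e(2)] odd_cycle_near(6)[OF c e(2)] ne
    by (simp_all add: algebra_simps)
  moreover have "c (i + 5) = c (i - 4)" "c (i + 6) = c (i - 3)" "c (i + 7) = c (i - 2)" "c (i + 8) = c (i - 1)"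
    using odd_cycleD(6)[OF c, of "i - 4"] odd_cycleD(6)[OF c, of "i - 3"]
      odd_cycleD(6)[OF c, of "i - 2"] odd_cycleD(6)[OF c, of "i - 1"]
    by (simp_all add: add.commute)
  moreover have "d = 0 \<or> d = 1 \<or> d = 2 \<or> d = 3 \<or> d = 4 \<or> d = 5 \<or> d = 6 \<or> d = 7 \<or> d = 8" using d by auto
  ultimately show ?thesis using d(3) assms(2) irr[of "c i"] by auto
qed

text \<open>The vertices off the cycle get colour 3, and the cycle is coloured 1 and 3 except for a
  single vertex of colour 2. A vertex of \<open>N2 v\<close> can then be in conflict only through
  one pair of cycle vertices at offset 4, the pair excluded by \<open>N\<close>.\<close>

lemma col3_nine_cycle:
  assumes c: "odd_cycle (far v) 9 c" and Q: "indep (far v - range c)"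
    and QC: "\<And>q k. q \<in> far v - range c \<Longrightarrow> k \<in> {1,-1,3,-3} \<Longrightarrow> \<not> E q (c k)"
    and N: "\<And>a. a \<in> N2 v \<Longrightarrow> E a (c 0) \<Longrightarrow> E a (c 4) \<Longrightarrow> False"
  shows col3
proof -
  \<comment> \<open>Colour 3 sits at 1, 3, 6, 8, that is at 1, 3, -3, -1 modulo 9. Colour 2 sits at
    4; the positions at offset 4 from it are 8, of colour 3, and 0, of colour 1.\<close>
  define xs :: "nat list" where "xs = [1,3,1,3,2,1,3,1,3]"
  define g where "g i = xs ! nat (i mod 9)" for i :: int
  have m9: "i mod 9 \<in> {0,1,2,3,4,5,6,7,8}" for i :: int
  proof -
    have "0 \<le> i mod 9" "i mod 9 < 9" by simp_all
    then have "i mod 9 = 0 \<or> i mod 9 = 1 \<or> i mod 9 = 2 \<or> i mod 9 = 3 \<or> i mod 9 = 4 \<or> i mod 9 = 5 \<or>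
      i mod 9 = 6 \<or> i mod 9 = 7 \<or> i mod 9 = 8" by presburger
    then show ?thesis by auto
  qed
  have g9: "g (i + 9) = g i" for i unfolding g_def by simp
  have grng: "g i \<in> {1,2,3}" for i using m9[of i] unfolding g_def xs_def by auto
  have gadj: "g i \<noteq> g (i + 1)" for i
  proof -
    have "(i + 1) mod 9 = (i mod 9 + 1) mod 9" by (simp add: mod_add_left_eq)
    then show ?thesis using m9[of i] unfolding g_def xs_def by auto
  qed
  obtain f0 where f0: "\<And>i. f0 (c i) = g i" using cycle_colour[OF c, of g] g9 by blast
  define f where "f x = (if x \<in> range c then f0 x else 3)" for x
  have fc: "f (c i) = g i" for i unfolding f_def using f0 by simp
  have cm: "c i = c (i mod 9)" for i unfolding odd_cycleD(5)[OF c] by (simp add: minus_mod_eq_mult_div)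
  have c9: "c (i - 9) = c i" for i using odd_cycleD(6)[OF c, of "i - 9"] by simp
  have cfar: "c i \<in> far v" for i using odd_cycleD(3)[OF c] .
  have cQ: "f (c i) \<noteq> 3" if "q \<in> far v - range c" "E q (c i)" for q i
  proof -
    have "c (-1) = c 8" "c (-3) = c 6" using c9[of 8] c9[of 6] by simp_all
    then have "\<not> E q (c 1)" "\<not> E q (c 3)" "\<not> E q (c 6)" "\<not> E q (c 8)"
      using QC[OF that(1), of 1] QC[OF that(1), of 3] QC[OF that(1), of "-3"] QC[OF that(1), of "-1"] by auto
    then have "i mod 9 \<notin> {1,3,6,8}" using that(2) cm[of i] by auto
    then show ?thesis using m9[of i] unfolding fc g_def xs_def by auto
  qed
  show col3
  proof (rule col3_from_far[of v f])
    fix r assume "r \<in> far v"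
    then show "f r \<in> {1,2,3}" using f0 grng unfolding f_def by (cases "r \<in> range c") (auto simp del: One_nat_def, metis)
  next
    fix r r' assume r: "r \<in> far v" "r' \<in> far v" "E r r'"
    show "f r \<noteq> f r'"
    proof (cases "r \<in> range c")
      case True
      then obtain i where i: "r = c i" by blast
      show ?thesis
      proof (cases "r' \<in> range c")
        case True
        then obtain k where k: "r' = c k" by blast
        from nine_cycle_induced[OF c, of i k] r i k have "c k = c (i + 1) \<or> c k = c (i - 1)" by blast
        then show ?thesis
        proof
          assume "c k = c (i + 1)" then show ?thesis using gadj[of i] fc i k by metis
        next
          assume "c k = c (i - 1)" then show ?thesis using gadj[of "i - 1"] fc i k by (metis diff_add_cancel)
        qed
      next
        case False
        then have "f r' = 3" unfolding f_def by simp
        moreover have "f (c i) \<noteq> 3" using cQ[of r' i] False r i Esym by blast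
        ultimately show ?thesis using i by simp
      qed
    next
      case False
      then have 1: "f r = 3" unfolding f_def by simp
      show ?thesis
      proof (cases "r' \<in> range c")
        case True
        then show ?thesis using cQ[of r] 1 False r by auto
      next
        case f: False
        then show ?thesis using Q False r unfolding indep_def by blast
      qed
    qed
  next
    fix a r r' assume a: "a \<in> N2 v" "r \<in> far v" "r' \<in> far v" "E a r" "E a r'" "f r = 1" "f r' = 2"
    obtain i where i: "r = c i" using a(6) unfolding f_def by (auto split: if_splits)
    obtain k where k: "r' = c k" using a(7) unfolding f_def by (auto split: if_splits)
    have an: "a \<notin> range c" using a(1) cfar unfolding far_def by auto
    have "g k = 2" "g i = 1" using a i k fc by auto
    then have k4: "k mod 9 = 4" and i4: "i mod 9 \<noteq> 8" "i mod 9 \<noteq> 4"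
      using m9[of k] m9[of i] unfolding g_def xs_def by auto
    have "c i = c k \<or> c i = c (k + 4) \<or> c i = c (k - 4)" using nine_cycle_nb[OF c, of a k i] a i k an by blast
    moreover have ck: "c k = c 4" using cm[of k] k4 by simp
    moreover have "c (k + 4) = c 8" using cm[of "k + 4"] k4 mod_add_left_eq[of k 9 4] by simp
    moreover have "c (k - 4) = c 0" using cm[of "k - 4"] k4 mod_diff_left_eq[of k 9 4] by simp
    moreover have "c i \<noteq> c 8" "c i \<noteq> c 4" using i4 unfolding odd_cycleD(5)[OF c] by presburger+
    ultimately have "c i = c 0" by simp
    then show False using N[of a] a i k ck by simp
  qed
qed

text \<open>A triangle-free graph on at most three vertices has a vertex meeting all its
  edges.\<close>

lemma card_3_indep_minus:
  assumes "card Q \<le> 3" "finite Q"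
  obtains j where "indep (Q - {j})"
proof (cases "indep Q")
  case True
  then show ?thesis using that[of undefined] indep_subset by blast
next
  case False
  then obtain a b where ab: "a \<in> Q" "b \<in> Q" "E a b" unfolding indep_def by blast
  then have "a \<noteq> b" using irr by blast
  then have "card (Q - {a, b}) \<le> 1" using assms ab by (simp add: card_Diff_subset)
  then have one: "x = y" if "x \<in> Q - {a, b}" "y \<in> Q - {a, b}" for x y
    using assms(2) that by (metis One_nat_def card_le_Suc0_iff_eq finite_Diff)
  show ?thesis
  proof (cases "indep (Q - {a})")
    case True then show ?thesis using that by blast
  next
    case False
    then obtain x y where xy: "x \<in> Q - {a}" "y \<in> Q - {a}" "E x y" unfolding indep_def by blast
    then have "x \<noteq> y" using irr by blast
    then obtain d where d: "d \<in> Q - {a, b}" "E b d" using xy one[of x y] Esym by blast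
    then have "\<not> E a d" "\<not> E d a" using ab no3[of a b d] Esym by blast+
    moreover have "x = a \<or> x = d" if "x \<in> Q - {b}" for x using one[of x d] d that by blast
    ultimately have "indep (Q - {b})" unfolding indep_def using irr by metis
    then show ?thesis using that by blast
  qed
qed

end

section \<open>Critical graphs: few far vertices give a 3-colouring\<close>

locale crit = sgraph +
  assumes deg3: "x \<in> V \<Longrightarrow> 3 \<le> deg x"
    and nc: "\<not> col3"
begin

lemma N2_two_far:
  assumes "a \<in> N2 v" shows "2 \<le> card (nb a \<inter> far v)"
  using card_N2_nb_far[OF assms] deg3[of a] assms N2_V[of v] by fastforce

lemma distinct5_deg:
  assumes "E x a" "E x b" "E x d" "E x e" "E x f" "distinct [a, b, d, e, f]"
  shows "5 \<le> deg x"
proof -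
  have "card {a, b, d, e, f} = 5" using assms(6) by simp
  moreover have "card {a, b, d, e, f} \<le> card (nb x)" by (rule card_mono) (use assms in auto)
  ultimately show ?thesis unfolding deg_def by simp
qed

text \<open>A 7-cycle in \<open>far v\<close> leaves at most three vertices and a 9-cycle at most
  one. On the 9-cycle each failed colouring produces a vertex of \<open>N2 v\<close> joining two
  cycle vertices at offset 4; too many of these give some \<open>c i\<close> five neighbours. That
  needs a degree bound only when a vertex is left over, whence the condition in
  \<open>D\<close>.\<close>

lemma far_small_False:
  assumes v: "v \<in> V" and N: "10 \<le> card (N2 v)" and R: "card (far v) \<le> 10"
    and D: "card (far v) = 10 \<Longrightarrow> \<forall>x. deg x \<le> 4"
  shows False
proof -
  obtain l c where c: "odd_cycle (far v) l c" using shortest_odd_cycle[OF far_not_bip[OF nc]] by metis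
  define Q where "Q = far v - range c"
  have cQ: "card (far v) = card Q + nat l"
    unfolding Q_def using odd_cycle_range[OF c] by (metis card_Diff_subset card_mono finite_far le_add_diff_inverse2)
  have l: "odd l" "7 \<le> l" using odd_cycleD[OF c] by auto
  have "l \<le> 10" using cQ R by simp
  then have "l = 7 \<or> l = 9" using l by presburger
  then consider "l = 7" | "l = 9" by blast
  then show False
  proof cases
    case 1
    then have "card Q \<le> 3" using cQ R by simp
    moreover obtain j where "indep (Q - {j})"
      using card_3_indep_minus[of Q] \<open>card Q \<le> 3\<close> unfolding Q_def by auto
    ultimately show False using col3_seven_cycle[of v c j] c 1 nc unfolding Q_def by simp
  next
    case 2
    note c = c[unfolded 2]
    have cq1: "card Q \<le> 1" using cQ R 2 by simp
    have finQ: "finite Q" unfolding Q_def by simp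
    have q1: "x = y" if "x \<in> Q" "y \<in> Q" for x y
      using cq1 finQ that by (metis One_nat_def card_le_Suc0_iff_eq)
    have indQ: "indep Q" unfolding indep_def using q1 irr by metis
    have cfar: "c i \<in> far v" for i using odd_cycleD(3)[OF c] .
    have N2C: "a \<notin> range c" if "a \<in> N2 v" for a using that cfar unfolding far_def by auto
    have ce: "E (c i) (c (i + 1))" "E (c i) (c (i - 1))" for i
      using odd_cycleD(4)[OF c, of i] odd_cycleD(4)[OF c, of "i - 1"] Esym by simp_all
    \<comment> \<open>\<open>c (i + 4)\<close> and \<open>c (i - 4)\<close> are consecutive on a
      9-cycle, so a common neighbour would form a triangle.\<close>
    have dist4: "a \<noteq> a'" if "a \<in> N2 v" "E a (c i)" "E a (c (i + 4))" "E a' (c (i - 4))" for a a' i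
    proof
      assume "a = a'"
      moreover have "c (i + 4) = c (i - 4 - 1)" unfolding odd_cycleD(5)[OF c] by simp
      ultimately show False using odd_cycle_near(4)[OF c that(4)] that(3) by simp
    qed
    have five: "5 \<le> deg (c i)" if "a \<in> N2 v" "E a (c i)" "E a (c (i + 4))" "a' \<in> N2 v" "E a' (c i)" "E a' (c (i - 4))"
      "E q (c i)" "q \<noteq> a" "q \<noteq> a'" "q \<notin> range c" for a a' q i
    proof -
      have "c (i - 1) \<noteq> c (i + 1)" unfolding odd_cycleD(5)[OF c] by simp
      moreover have "a \<noteq> a'" using dist4 that by blast
      ultimately show ?thesis
        using distinct5_deg[OF ce(1)[of i] ce(2)[of i] Esym[OF that(2)] Esym[OF that(5)] Esym[OF that(7)]]
          N2C[OF that(1)] N2C[OF that(4)] that by auto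
    qed
    have colour: False if "\<And>q k. q \<in> Q \<Longrightarrow> k \<in> {1,-1,3,-3} \<Longrightarrow> \<not> E q (c (i + k))"
      "\<And>a. a \<in> N2 v \<Longrightarrow> E a (c i) \<Longrightarrow> E a (c (i + 4)) \<Longrightarrow> False" for i
    proof -
      have r: "range (\<lambda>k. c (k + i)) = range c"
      proof -
        have "x \<in> range (\<lambda>k. c (k + i))" if x: "x \<in> range c" for x
        proof -
          obtain j where "x = c j" using x by blast
          then have "x = c ((j - i) + i)" by simp
          then show ?thesis by blast
        qed
        then show ?thesis by auto
      qed
      have col3
      proof (rule col3_nine_cycle[OF odd_cycle_shift[OF c, of i]])
        show "indep (far v - range (\<lambda>k. c (k + i)))" unfolding r Q_def[symmetric] by (rule indQ)
        fix q k assume "q \<in> far v - range (\<lambda>k. c (k + i))" "k \<in> {1, - 1, 3, - (3::int)}"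
        then show "\<not> E q (c (k + i))" using that(1)[of q k] unfolding r Q_def[symmetric] add.commute[of k i] by blast
      next
        fix a assume "a \<in> N2 v" "E a (c (0 + i))" "E a (c (4 + i))"
        then show False using that(2)[of a] unfolding add.commute[of 4 i] by simp
      qed
      then show False using nc by blast
    qed
    \<comment> \<open>The same colouring in the opposite direction along the cycle, so the pair in
      conflict is \<open>c i\<close>, \<open>c (i - 4)\<close>.\<close>
    have colour': False if "\<And>q k. q \<in> Q \<Longrightarrow> k \<in> {1,-1,3,-3} \<Longrightarrow> \<not> E q (c (i + k))"
      "\<And>a. a \<in> N2 v \<Longrightarrow> E a (c i) \<Longrightarrow> E a (c (i - 4)) \<Longrightarrow> False" for i
    proof -
      have r: "range (\<lambda>k. c (- k + i)) = range c"
      proof -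
        have "x \<in> range (\<lambda>k. c (- k + i))" if x: "x \<in> range c" for x
        proof -
          obtain j where "x = c j" using x by blast
          then have "x = c (- (i - j) + i)" by simp
          then show ?thesis by blast
        qed
        then show ?thesis by auto
      qed
      have col3
      proof (rule col3_nine_cycle[OF odd_cycle_reflect[OF odd_cycle_shift[OF c, of i]]])
        show "indep (far v - range (\<lambda>k. c (- k + i)))" unfolding r Q_def[symmetric] by (rule indQ)
        fix q k assume "q \<in> far v - range (\<lambda>k. c (- k + i))" "k \<in> {1, - 1, 3, - (3::int)}"
        then have "q \<in> Q" "- k \<in> {1, - 1, 3, - (3::int)}" unfolding r Q_def[symmetric] by auto
        then show "\<not> E q (c (- k + i))" using that(1)[of q "- k"] by (metis add.commute)
      next
        fix a assume "a \<in> N2 v" "E a (c (- 0 + i))" "E a (c (- 4 + i))"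
        then show False using that(2)[of a] by simp
      qed
      then show False using nc by blast
    qed
    show False
    proof (cases "\<exists>q\<in>Q. \<exists>i. E q (c i)")
      case True
      then obtain q i where q: "q \<in> Q" "E q (c i)" by blast
      have "card (far v) = 10" using cQ 2 cq1 q(1) finQ R
        card_gt_0_iff[of Q] by fastforce
      then have dc: "deg (c i) \<le> 4" using D by blast
      have near: "\<not> E q' (c (i + k))" if "q' \<in> Q" "k \<in> {1,-1,3,-3}" for q' k
        using q1[OF that(1) q(1)] odd_cycle_near[OF c q(2)] that(2) by auto
      have qn: "q \<notin> range c" "q \<notin> N2 v" using q(1) unfolding Q_def far_def by auto
      obtain a where a: "a \<in> N2 v" "E a (c i)" "E a (c (i + 4))" using colour[of i] near by blast
      obtain a' where a': "a' \<in> N2 v" "E a' (c i)" "E a' (c (i - 4))" using colour'[of i] near by blast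
      have "5 \<le> deg (c i)" using five[OF a a' q(2)] qn a a' by blast
      then show False using dc by simp
    next
      case False
      then have ex: "\<exists>a. a \<in> N2 v \<and> E a (c i) \<and> E a (c (i + 4))" for i using colour[of i] by blast
      \<comment> \<open>One connecting vertex per position accounts for at most 9 of the at least 10
        vertices of \<open>N2 v\<close>; a further one, \<open>a\<close>, yields the contradiction:
        through a 4-cycle if both its far neighbours are on the cycle, through degree 5 if a vertex
        lies off the cycle.\<close>
      define A where "A i = (SOME a. a \<in> N2 v \<and> E a (c i) \<and> E a (c (i + 4)))" for i
      have A: "A i \<in> N2 v" "E (A i) (c i)" "E (A i) (c (i + 4))" for i
        using someI_ex[OF ex[of i]] unfolding A_def by blast+
      have A9: "A (i + 9) = A i" for i
      proof -
        have "c (i + 9) = c i" "c (i + 9 + 4) = c (i + 4)" unfolding odd_cycleD(5)[OF c] by simp_all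
        then show ?thesis unfolding A_def by (simp only:)
      qed
      obtain FA where FA: "\<And>i. FA (c i) = A i" using cycle_colour[OF c, of A] A9 by blast
      have "range A \<subseteq> FA ` range c" using FA[symmetric] by auto
      then have "card (range A) \<le> 9"
        using odd_cycle_range[OF c] card_image_le[of "range c" FA] card_mono[of "FA ` range c" "range A"] by simp
      have "\<not> N2 v \<subseteq> range A"
      proof
        assume "N2 v \<subseteq> range A"
        moreover have "finite (range A)" using \<open>range A \<subseteq> FA ` range c\<close> odd_cycle_range(3)[OF c] finite_subset by blast
        ultimately have "card (N2 v) \<le> card (range A)" by (intro card_mono)
        then show False using N \<open>card (range A) \<le> 9\<close> by simp
      qed
      then obtain a where a: "a \<in> N2 v" "a \<notin> range A" by blast
      then have "2 \<le> card (nb a \<inter> far v)" using N2_two_far by blast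
      show False
      proof (cases "Q = {}")
        case True
        then have sub: "nb a \<inter> far v \<subseteq> range c" unfolding Q_def by blast
        have "\<not> card (nb a \<inter> far v) \<le> Suc 0" using \<open>2 \<le> card (nb a \<inter> far v)\<close> by simp
        then obtain x y where xy: "x \<in> nb a \<inter> far v" "y \<in> nb a \<inter> far v" "x \<noteq> y"
          using card_le_Suc0_iff_eq[of "nb a \<inter> far v"] fin_nb finite_Int by blast
        then obtain i k where ik: "x = c i" "y = c k" using sub by blast
        then have ai: "E a (c i)" "E a (c k)" "c i \<noteq> c k" using xy by auto
        then consider "c k = c (i + 4)" | "c k = c (i - 4)" using nine_cycle_nb[OF c, of a i k] N2C[OF a(1)] by metis
        then show False
        proof cases
          case 1
          then have "a = A i" using no4[of a "c i" "A i" "c k"] ai A(2,3)[of i] Esym by metis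
          then show False using a by blast
        next
          case 2
          then have "a = A (i - 4)" using no4[of a "c i" "A (i - 4)" "c k"] ai A(2,3)[of "i - 4"] Esym
            by (metis diff_add_cancel)
          then show False using a by blast
        qed
      next
        case nQ: False
        then have "card Q = 1" using cq1 finQ by (metis One_nat_def card_0_eq le_SucE le_zero_eq)
        then have "card (far v) = 10" using cQ 2 by simp
        then have dc: "deg (c i) \<le> 4" for i using D by blast
        have "\<not> nb a \<inter> far v \<subseteq> Q"
        proof
          assume "nb a \<inter> far v \<subseteq> Q"
          then have "card (nb a \<inter> far v) \<le> card Q" using finQ by (rule card_mono[rotated])
          then show False using \<open>2 \<le> card (nb a \<inter> far v)\<close> cq1 by simp
        qed
        then obtain i where i: "E a (c i)" unfolding Q_def by auto
        have "5 \<le> deg (c i)"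
          using five[of "A i" i "A (i - 4)" a] A(1,2,3)[of i] A(1,2,3)[of "i - 4"] i a N2C[OF a(1)] by auto
        then show False using dc[of i] by simp
      qed
    qed
  qed
qed

end

section \<open>At most 25 vertices: degrees near a vertex of degree 4\<close>

locale crit25 = crit + assumes n25: "card V \<le> 25"
begin

text \<open>Degree 5 or more gives at least 10 vertices at distance 2 and leaves at most 25 - 1 - 5
  - 10 = 9 far ones. So the degree bound \<open>D\<close>, which is not yet available, is not asked
  for.\<close>

lemma deg_le_4: "deg v \<le> 4"
proof (rule ccontr)
  assume d: "\<not> deg v \<le> 4"
  then have "nb v \<noteq> {}" unfolding deg_def by auto
  then have v: "v \<in> V" using inV by auto
  have "deg v * 2 \<le> card (N2 v)"
  proof -
    have "2 \<le> deg u - 1" if "u \<in> nb v" for u using deg3[of u] that nb_V by fastforce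
    then have "(\<Sum>u\<in>nb v. 2) \<le> (\<Sum>u\<in>nb v. deg u - 1)" by (intro sum_mono)
    then show ?thesis unfolding card_N2 deg_def by simp
  qed
  then show False using far_small_False[OF v] card_V_far[OF v] n25 d by linarith
qed

text \<open>Two neighbours of degree 4 raise \<open>card (N2 v)\<close> from 8 to 10 and leave at
  most 25 - 1 - 4 - 10 = 10 far vertices.\<close>

lemma high_nb_unique:
  assumes "deg v = 4" "E v u" "deg u = 4" "E v w" "deg w = 4"
  shows "u = w"
proof (rule ccontr)
  assume uw: "u \<noteq> w"
  have v: "v \<in> V" using assms inV by blast
  have "(\<Sum>x\<in>nb v. (if x = u \<or> x = w then 3 else 2 :: nat)) \<le> card (N2 v)" unfolding card_N2
  proof (rule sum_mono)
    fix x assume "x \<in> nb v"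
    then have "3 \<le> deg x" using deg3 nb_V by blast
    then show "(if x = u \<or> x = w then 3 else 2) \<le> deg x - 1" using assms by auto
  qed
  moreover have "(\<Sum>x\<in>nb v. (if x = u \<or> x = w then 3 else 2 :: nat)) = (\<Sum>x\<in>nb v. 2 + ((if x = u then 1 else 0) + (if x = w then 1 else 0)))"
    using uw by (intro sum.cong) auto
  moreover have "\<dots> = 10" using assms unfolding sum.distrib by (simp add: deg_def)
  ultimately have "10 \<le> card (N2 v)" by simp
  then show False using far_small_False[OF v] card_V_far[OF v] n25 assms(1) deg_le_4 by simp
qed

end

section \<open>Adjacent vertices of degree 4\<close>

context sgraph
begin

lemma odd_cycle_succ:
  assumes c: "odd_cycle A l c"
  obtains s where "\<And>i. s (c i) = c (i + 1)" "inj_on s (range c)"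
proof -
  have "c (i + l + 1) = c (i + 1)" for i using odd_cycleD(6)[OF c, of "i + 1"] by (simp add: ac_simps)
  then obtain s where s: "\<And>i. s (c i) = c (i + 1)" using cycle_colour[OF c, of "\<lambda>i. c (i + 1)"] by blast
  have "inj_on s (range c)"
  proof (rule inj_onI)
    fix x y assume "x \<in> range c" "y \<in> range c" "s x = s y"
    then obtain i j where "x = c i" "y = c j" "c (i + 1) = c (j + 1)" using s by auto
    then show "x = y" unfolding odd_cycleD(5)[OF c] using odd_cycleD(5)[OF c, of i j] by simp
  qed
  with s show ?thesis using that by blast
qed

text \<open>The set and its shift by one step are disjoint and of equal size inside a cycle of odd
  length.\<close>

lemma odd_cycle_indep:
  assumes c: "odd_cycle A l c" and X: "indep X"
  shows "2 * card (X \<inter> range c) < nat l"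
proof -
  obtain s where s: "\<And>i. s (c i) = c (i + 1)" "inj_on s (range c)" using odd_cycle_succ[OF c] by blast
  define Z where "Z = X \<inter> range c"
  have "s ` Z \<subseteq> range c" unfolding Z_def using s(1) by auto
  moreover have "Z \<inter> s ` Z = {}"
  proof -
    have "c (i + 1) \<notin> X" if "c i \<in> X" for i
      using X odd_cycleD(4)[OF c, of i] that unfolding indep_def by blast
    then show ?thesis unfolding Z_def using s(1) by auto
  qed
  moreover have "card (s ` Z) = card Z"
    by (rule card_image) (use s(2) in \<open>auto simp: Z_def intro: inj_on_subset\<close>)
  moreover have "finite Z" "Z \<subseteq> range c" unfolding Z_def using odd_cycle_range(3)[OF c] by auto
  ultimately have "card Z + card Z \<le> card (range c)"
    using card_mono[of "range c" "Z \<union> s ` Z"] card_Un_disjoint[of Z "s ` Z"] odd_cycle_range(3)[OF c] by simp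
  then have "2 * card Z \<le> nat l" using odd_cycle_range(2)[OF c] by simp
  moreover have "2 * card Z \<noteq> nat l" using odd_cycleD(1,2)[OF c]
    by (metis dvd_triv_left even_nat_iff order_trans zero_le_numeral)
  ultimately show ?thesis unfolding Z_def by simp
qed

lemma odd_cycle_not_bip:
  assumes c: "odd_cycle A l c"
  shows "\<not> bip (range c)"
proof
  assume "bip (range c)"
  then obtain f :: "'a \<Rightarrow> bool" where f: "\<And>x y. x \<in> range c \<Longrightarrow> y \<in> range c \<Longrightarrow> E x y \<Longrightarrow> f x \<noteq> f y"
    unfolding bip_def by blast
  have alt: "f (c (i + 1)) \<noteq> f (c i)" for i using f[of "c i" "c (i + 1)"] odd_cycleD(4)[OF c, of i] by auto
  have "f (c (int n)) = (f (c 0) = even n)" for n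
  proof (induction n)
    case (Suc n) then show ?case using alt[of "int n"] by (auto simp: add.commute)
  qed simp
  from this[of "nat l"] show False using odd_cycleD(6)[OF c, of 0] odd_cycleD(1,2)[OF c] by (auto simp: even_nat_iff)
qed

definition onb :: "'a \<Rightarrow> 'a \<Rightarrow> 'a set" where "onb u v = nb u - {v}"

definition onb2 :: "'a \<Rightarrow> 'a \<Rightarrow> 'a set" where "onb2 u v = (\<Union>p\<in>onb u v. nb p - {u})"

text \<open>For an edge \<open>uv\<close>: the vertices at distance at least 3 from both
  ends.\<close>

definition rest :: "'a \<Rightarrow> 'a \<Rightarrow> 'a set" where
  "rest u v = V - ({u, v} \<union> onb u v \<union> onb v u \<union> onb2 u v \<union> onb2 v u)"

lemma onb2_I: "E u p \<Longrightarrow> p \<noteq> v \<Longrightarrow> E p t \<Longrightarrow> t \<noteq> u \<Longrightarrow> t \<in> onb2 u v"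
  unfolding onb2_def onb_def by auto

lemma onb2_E: assumes "t \<in> onb2 u v" obtains p where "E u p" "p \<noteq> v" "E p t" "t \<noteq> u"
  using assms unfolding onb2_def onb_def by (metis DiffE UN_E mem_nb singletonI)

lemma onb2_indep: "indep (onb2 u v)"
proof -
  have "onb2 u v \<subseteq> N2 u" unfolding N2_def by (auto elim: onb2_E)
  then show ?thesis unfolding indep_def using N2_indep by blast
qed

lemma N2_edge: assumes "E u v" shows "N2 v = onb u v \<union> onb2 v u"
proof
  show "N2 v \<subseteq> onb u v \<union> onb2 v u"
  proof
    fix a assume "a \<in> N2 v"
    then obtain w where w: "a \<noteq> v" "E v w" "E w a" unfolding N2_def by blast
    show "a \<in> onb u v \<union> onb2 v u"
    proof (cases "w = u")
      case True then show ?thesis using w unfolding onb_def by auto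
    next
      case False then show ?thesis using onb2_I[of v w u a] w by blast
    qed
  qed
  show "onb u v \<union> onb2 v u \<subseteq> N2 v"
  proof
    fix a assume "a \<in> onb u v \<union> onb2 v u"
    then show "a \<in> N2 v"
    proof
      assume "a \<in> onb u v" then show ?thesis using assms Esym unfolding onb_def N2_def by auto
    next
      assume "a \<in> onb2 v u" then show ?thesis unfolding N2_def by (auto elim: onb2_E)
    qed
  qed
qed

lemma onb2_far: assumes "E u v" shows "onb2 u v \<subseteq> far v"
proof
  fix t assume "t \<in> onb2 u v"
  then obtain p where p: "E u p" "p \<noteq> v" "E p t" "t \<noteq> u" by (rule onb2_E)
  have pv: "\<not> E p v" "\<not> E v p" using no3[of u p v] p assms Esym by blast+
  have "t \<noteq> v" using pv p by blast
  moreover have "\<not> E v t" using no4[of u p t v] p assms Esym by blast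
  moreover have "t \<notin> N2 v"
  proof
    assume "t \<in> N2 v"
    then obtain w where w: "E v w" "E w t" unfolding N2_def by blast
    show False
    proof (cases "w = u")
      case True then show False using no3[of u p t] p w Esym by blast
    next
      case False then show False using no5[of v w t p u] w p assms Esym by blast
    qed
  qed
  ultimately show "t \<in> far v" unfolding far_def using p inV2 by auto
qed

text \<open>Vertices far from \<open>v\<close> are at distance 2 from \<open>u\<close> or far from
  both ends. The first kind is independent, so odd cycles in \<open>far v\<close> must use many
  vertices of the small set \<open>rest u v\<close>.\<close>

lemma far_edge: assumes "E u v" shows "far v = onb2 u v \<union> rest u v" "onb2 u v \<inter> rest u v = {}"
proof -
  have "nb v = insert u (onb v u)" using assms Esym unfolding onb_def by auto
  then show "far v = onb2 u v \<union> rest u v"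
    using onb2_far[OF assms] unfolding far_def N2_edge[OF assms] rest_def by auto
  show "onb2 u v \<inter> rest u v = {}" unfolding rest_def by auto
qed

text \<open>The analogue of \<open>col3_from_far\<close> for an edge \<open>uv\<close>: all other neighbours of \<open>u\<close> and \<open>v\<close> get colour 3.\<close>

lemma col3_from_edge:
  assumes uv: "E u v" and I: "I \<subseteq> rest u v" "indep I"
    and b: "bip (onb2 u v \<union> onb2 v u \<union> (rest u v - I))"
  shows col3
proof -
  define S where "S = onb u v \<union> onb v u \<union> I"
  have vu: "E v u" using uv Esym by blast
  have SV: "S \<subseteq> V" using I nb_V unfolding S_def onb_def rest_def by blast
  have PI: "\<not> E p i" if "p \<in> onb u v \<union> onb v u" "i \<in> I" for p i
  proof
    assume "E p i"
    have "i \<noteq> u" "i \<noteq> v" "i \<notin> onb2 u v" "i \<notin> onb2 v u" using that(2) I(1) unfolding rest_def by auto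
    then show False using that(1) \<open>E p i\<close> onb2_I[of u p v i] onb2_I[of v p u i] unfolding onb_def by auto
  qed
  have PP: "\<not> E p q" if "p \<in> onb u v" "q \<in> onb v u" for p q
    using no4[of u p q v] that uv Esym unfolding onb_def by auto
  have P1: "\<not> E p q" if "p \<in> onb x y" "q \<in> onb x y" for p q x y
    using no3[of x p q] that Esym unfolding onb_def by auto
  have "\<not> E x y" if "x \<in> S" "y \<in> S" for x y
    using that PI[of x y] PI[of y x] PP[of x y] PP[of y x] P1[of x u v y] P1[of x v u y] I(2) Esym[of x y]
    unfolding S_def indep_def by blast
  then have ind: "indep S" unfolding indep_def by blast
  obtain f :: "'a \<Rightarrow> bool" where f: "\<forall>x\<in>onb2 u v \<union> onb2 v u \<union> (rest u v - I).
    \<forall>y\<in>onb2 u v \<union> onb2 v u \<union> (rest u v - I). E x y \<longrightarrow> f x \<noteq> f y" using b unfolding bip_def by blast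
  define g where "g x = (if x = u then True else if x = v then False else f x)" for x
  have uS: "y = v" if "y \<in> V - S" "E u y" for y using that unfolding S_def onb_def by auto
  have vS: "y = u" if "y \<in> V - S" "E v y" for y using that unfolding S_def onb_def by auto
  have "u \<noteq> v" using uv irr by blast
  have "g x \<noteq> g y" if xy: "x \<in> V - S" "y \<in> V - S" "E x y" for x y
  proof (cases "x \<in> {u, v} \<or> y \<in> {u, v}")
    case True
    then have "x = u \<and> y = v \<or> x = v \<and> y = u"
      using uS[of x] uS[of y] vS[of x] vS[of y] xy Esym[OF xy(3)] by blast
    then show ?thesis using \<open>u \<noteq> v\<close> unfolding g_def by auto
  next
    case False
    then have "x \<in> onb2 u v \<union> onb2 v u \<union> (rest u v - I)" "y \<in> onb2 u v \<union> onb2 v u \<union> (rest u v - I)"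
      using xy unfolding S_def rest_def by blast+
    then have "f x \<noteq> f y" using f xy by blast
    then show ?thesis using False unfolding g_def by auto
  qed
  then have "bip (V - S)" unfolding bip_def by blast
  then show col3 unfolding col3_def using SV ind by blast
qed

end

context crit25
begin

lemma deg_cases: "x \<in> V \<Longrightarrow> deg x = 3 \<or> deg x = 4"
  using deg3[of x] deg_le_4[of x] by linarith

context
  fixes u v assumes uv: "E u v" and du: "deg u = 4" and dv: "deg v = 4"
begin

lemma onb_low: "p \<in> onb u v \<Longrightarrow> deg p = 3"
  using high_nb_unique[OF du, of v p] deg_cases[of p] uv dv inV2 unfolding onb_def by auto

text \<open>By \<open>high_nb_unique\<close> the three other neighbours of \<open>u\<close> have
  degree 3, hence two children each.\<close>

lemma card_onb2: "card (onb2 u v) = 6"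
proof -
  have "card (onb2 u v) = (\<Sum>p\<in>onb u v. card (nb p - {u}))" unfolding onb2_def
  proof (rule card_UN_disjoint)
    show "\<forall>i\<in>onb u v. \<forall>j\<in>onb u v. i \<noteq> j \<longrightarrow> (nb i - {u}) \<inter> (nb j - {u}) = {}"
      using N2_unique_parent unfolding onb_def by auto
  qed (auto simp: onb_def)
  also have "\<dots> = (\<Sum>p\<in>onb u v. 2)"
  proof (rule sum.cong[OF refl])
    fix p assume p: "p \<in> onb u v"
    then have "u \<in> nb p" using Esym unfolding onb_def by auto
    then show "card (nb p - {u}) = 2" using onb_low[OF p] unfolding deg_def by simp
  qed
  also have "\<dots> = 6" using du uv unfolding onb_def deg_def by simp
  finally show ?thesis .
qed

text \<open>As \<open>u\<close> has degree 4, \<open>card (N2 v)\<close> is at least 9, so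
  \<open>far v\<close> has at most 25 - 1 - 4 - 9 = 11 vertices, 6 of them in
  \<open>onb2 u v\<close>.\<close>

lemma card_rest: "card (rest u v) \<le> 5"
proof -
  have v: "v \<in> V" using uv inV2 by blast
  have "(\<Sum>x\<in>nb v. 2 + (if x = u then 1 else 0)) \<le> card (N2 v)" unfolding card_N2
  proof (rule sum_mono)
    fix x assume "x \<in> nb v"
    then have "3 \<le> deg x" using deg3 nb_V by blast
    then show "2 + (if x = u then 1 else 0) \<le> deg x - 1" using du by auto
  qed
  moreover have "(\<Sum>x\<in>nb v. 2 + (if x = u then 1 else 0)) = (9::nat)"
    unfolding sum.distrib using dv uv Esym by (simp add: deg_def)
  ultimately have "card (far v) \<le> 11" using card_V_far[OF v] n25 dv by linarith
  moreover have "finite (rest u v)" "finite (onb2 u v)"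
    using far_edge(1)[OF uv] finite_far[of v] by (metis finite_Un)+
  ultimately show ?thesis using far_edge[OF uv] card_onb2 by (simp add: card_Un_disjoint)
qed

text \<open>Less than half of an odd cycle in \<open>far v\<close> lies in the independent set
  \<open>onb2 u v\<close> and at most 5 of its vertices in \<open>rest u v\<close>, so its length is
  7 or 9. A 7-cycle uses at least four vertices of \<open>rest u v\<close>; the at most one left
  over is the exceptional vertex of \<open>col3_seven_cycle\<close>. For a 9-cycle both bounds are
  attained.\<close>

lemma edge_nine_cycle:
  obtains c where "odd_cycle (far v) 9 c" "rest u v \<subseteq> range c" "card (rest u v) = 5"
    "card (onb2 u v \<inter> range c) = 4"
proof -
  obtain l c where c: "odd_cycle (far v) l c" using shortest_odd_cycle[OF far_not_bip[OF nc]] by metis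
  have fins: "finite (rest u v)" "finite (onb2 u v)"
    using far_edge(1)[OF uv] finite_far[of v] by (metis finite_Un)+
  have rsub: "range c \<subseteq> onb2 u v \<union> rest u v" using odd_cycle_range(4)[OF c] far_edge(1)[OF uv] by simp
  have "card (range c) = card (onb2 u v \<inter> range c) + card (rest u v \<inter> range c)"
  proof -
    have "range c = (onb2 u v \<inter> range c) \<union> (rest u v \<inter> range c)" using rsub by blast
    moreover have "(onb2 u v \<inter> range c) \<inter> (rest u v \<inter> range c) = {}" using far_edge(2)[OF uv] by blast
    ultimately show ?thesis using fins by (metis card_Un_disjoint finite_Int)
  qed
  then have sum: "nat l = card (onb2 u v \<inter> range c) + card (rest u v \<inter> range c)"
    using odd_cycle_range(2)[OF c] by simp
  have T: "2 * card (onb2 u v \<inter> range c) < nat l" using odd_cycle_indep[OF c onb2_indep] .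
  have R: "card (rest u v \<inter> range c) \<le> card (rest u v)" using fins by (intro card_mono) auto
  have l: "odd l" "7 \<le> l" using odd_cycleD[OF c] by auto
  have "nat l \<le> 9 \<or> nat l = 10" using sum T R card_rest by linarith
  then have "l \<le> 10" by auto
  then have "l = 7 \<or> l = 9" using l by presburger
  then show ?thesis
  proof
    assume l7: "l = 7"
    then have "4 \<le> card (rest u v \<inter> range c)" using sum T by simp
    moreover have "card (rest u v - range c) = card (rest u v) - card (rest u v \<inter> range c)"
      using fins by (simp add: card_Diff_subset_Int)
    ultimately have "card (rest u v - range c) \<le> 1" using card_rest by linarith
    then have "\<exists>j. rest u v - range c \<subseteq> {j}"
      using fins(1) by (metis One_nat_def card_le_Suc0_iff_eq finite_Diff singletonI subsetI)
    then obtain j where j: "rest u v - range c \<subseteq> {j}" by blast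
    have "indep (far v - range c - {j})"
      by (rule indep_subset[OF onb2_indep[of u v]]) (use j far_edge(1)[OF uv] in blast)
    moreover have "card (far v - range c) \<le> 4"
    proof -
      have "card (far v) = 6 + card (rest u v)"
        using far_edge[OF uv] fins card_onb2 by (simp add: card_Un_disjoint)
      then show ?thesis using odd_cycle_range[OF c] l7 card_rest by (simp add: card_Diff_subset)
    qed
    ultimately have col3 using col3_seven_cycle[of v c j] c l7 by simp
    then show ?thesis using nc by blast
  next
    assume l9: "l = 9"
    then have "card (rest u v \<inter> range c) = 5" "card (onb2 u v \<inter> range c) = 4" using sum T R card_rest by auto
    moreover have "card (rest u v) = 5" using calculation R card_rest by simp
    moreover have "rest u v \<subseteq> range c"
      using calculation card_subset_eq[of "rest u v" "rest u v \<inter> range c"] fins by auto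
    ultimately show ?thesis using that c l9 by simp
  qed
qed

text \<open>Vertices of \<open>onb2 u v\<close> on the 9-cycle have two neighbours on it and a parent, so at most one more.\<close>

lemma edge_exceptional:
  obtains Q where "Q \<subseteq> onb2 u v" "card Q \<le> 2"
    "\<And>t. t \<in> onb2 u v - Q \<Longrightarrow> card (nb t \<inter> (onb2 u v \<union> onb2 v u)) \<le> 1"
proof -
  obtain c where c: "odd_cycle (far v) 9 c" "rest u v \<subseteq> range c" "card (rest u v) = 5"
    "card (onb2 u v \<inter> range c) = 4" by (rule edge_nine_cycle)
  have "card (onb2 u v - range c) \<le> 2"
    using card_onb2 c(4) odd_cycle_range(3)[OF c(1)] by (simp add: card_Diff_subset_Int Int_commute)
  moreover have "card (nb t \<inter> (onb2 u v \<union> onb2 v u)) \<le> 1" if t: "t \<in> onb2 u v - (onb2 u v - range c)" for t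
  proof -
    obtain i where i: "t = c i" using t by blast
    have tT: "t \<in> onb2 u v" using t by blast
    then obtain p where p: "E u p" "p \<noteq> v" "E p t" "t \<noteq> u" by (rule onb2_E)
    have e: "E (c i) (c (i + 1))" "E (c i) (c (i - 1))"
      using odd_cycleD(4)[OF c(1), of i] odd_cycleD(4)[OF c(1), of "i - 1"] Esym by simp_all
    have r: "c (i + 1) \<in> rest u v" "c (i - 1) \<in> rest u v"
      using odd_cycleD(3)[OF c(1)] far_edge(1)[OF uv] onb2_indep[of u v] e tT i unfolding indep_def by blast+
    have ne: "c (i + 1) \<noteq> c (i - 1)" unfolding odd_cycleD(5)[OF c(1)] by simp
    have pon: "p \<in> onb u v" using p unfolding onb_def by auto
    have pT: "p \<notin> onb2 u v \<union> onb2 v u"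
    proof -
      have "p \<notin> far v" using N2_edge[OF uv] pon unfolding far_def by blast
      moreover have "p \<notin> onb2 v u" using onb2_far[OF Esym[OF uv]] p unfolding far_def by auto
      ultimately show ?thesis using onb2_far[OF uv] by blast
    qed
    have pr: "p \<notin> rest u v" using pon unfolding rest_def by blast
    have rT: "c (i + 1) \<notin> onb2 u v \<union> onb2 v u" "c (i - 1) \<notin> onb2 u v \<union> onb2 v u"
      using r unfolding rest_def by blast+
    have d3: "card {p, c (i + 1), c (i - 1)} = 3" using ne pr r by (metis card_3_iff)
    have "nb t \<inter> (onb2 u v \<union> onb2 v u) \<subseteq> nb t - {p, c (i + 1), c (i - 1)}" using pT rT by blast
    then have "card (nb t \<inter> (onb2 u v \<union> onb2 v u)) \<le> card (nb t - {p, c (i + 1), c (i - 1)})"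
      by (intro card_mono) auto
    also have "\<dots> = deg t - 3"
      unfolding deg_def d3[symmetric] by (rule card_Diff_subset) (use e i p Esym in auto)
    finally show ?thesis using deg_le_4[of t] by simp
  qed
  ultimately show ?thesis using that[of "onb2 u v - range c"] by blast
qed

text \<open>Around the 9-cycle four independent vertices of \<open>onb2 u v\<close> separate the
  five of \<open>rest u v\<close>, except at one place where two of the latter are consecutive. The
  9-cycle being induced, this is the only edge inside \<open>rest u v\<close>.\<close>

lemma rest_edge:
  obtains r1 r2 where "r1 \<in> rest u v" "r2 \<in> rest u v" "E r1 r2"
    "indep (rest u v - {r1})" "indep (rest u v - {r2})"
proof -
  obtain c where c: "odd_cycle (far v) 9 c" "rest u v \<subseteq> range c" "card (rest u v) = 5"
    "card (onb2 u v \<inter> range c) = 4" by (rule edge_nine_cycle)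
  obtain s where s: "\<And>i. s (c i) = c (i + 1)" "inj_on s (range c)" using odd_cycle_succ[OF c(1)] by blast
  define R where "R = rest u v"
  define T where "T = onb2 u v \<inter> range c"
  have finR: "finite R" using c(2) odd_cycle_range(3)[OF c(1)] finite_subset unfolding R_def by blast
  have rT: "x \<in> T \<or> x \<in> R" if "x \<in> range c" for x
    using that odd_cycle_range(4)[OF c(1)] far_edge(1)[OF uv] unfolding T_def R_def by blast
  have "T \<subseteq> s ` R"
  proof
    fix t assume t: "t \<in> T"
    then obtain i where i: "t = c i" unfolding T_def by blast
    have "c (i - 1) \<notin> onb2 u v"
      using odd_cycleD(4)[OF c(1), of "i - 1"] onb2_indep[of u v] t i unfolding T_def indep_def by auto
    then have "c (i - 1) \<in> R" using rT[of "c (i - 1)"] unfolding T_def by auto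
    moreover have "t = s (c (i - 1))" using s(1)[of "i - 1"] i by simp
    ultimately show "t \<in> s ` R" by blast
  qed
  moreover have "card (s ` R) = 5"
    using card_image[OF inj_on_subset[OF s(2), of R]] c(2,3) unfolding R_def by simp
  ultimately have "card (s ` R - T) = 1"
    using c(4) finR unfolding T_def[symmetric] by (simp add: card_Diff_subset finite_subset)
  \<comment> \<open>\<open>w\<close> is the end of the only step along the cycle from
    \<open>R\<close> to \<open>R\<close>.\<close>
  then obtain w where w: "s ` R - T = {w}" by (auto simp: card_1_singleton_iff)
  then have "w \<in> s ` R" "w \<notin> T" by blast+
  then obtain i where i: "c i \<in> R" "w = c (i + 1)" using s(1) c(2) unfolding R_def by blast
  then have w1: "c (i + 1) \<in> R" using \<open>w \<notin> T\<close> rT by blast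
  have unique: "c k = c i \<and> c (k + 1) = c (i + 1)" if "c k \<in> R" "c (k + 1) \<in> R" for k
  proof -
    have "c (k + 1) \<notin> T" using that(2) far_edge(2)[OF uv] unfolding T_def R_def by blast
    moreover have "c (k + 1) \<in> s ` R" using s(1)[of k] that(1) by (metis imageI)
    ultimately have eq: "c (k + 1) = c (i + 1)" using w i(2) by blast
    then have "c k = c i" unfolding odd_cycleD(5)[OF c(1)] by simp
    then show ?thesis using eq by simp
  qed
  have edges: "x = c i \<and> y = c (i + 1) \<or> y = c i \<and> x = c (i + 1)" if h: "x \<in> R" "y \<in> R" "E x y" for x y
  proof -
    obtain a b where ab: "x = c a" "y = c b" using h c(2) unfolding R_def by blast
    then have "c b = c (a + 1) \<or> c b = c (a - 1)" using nine_cycle_induced[OF c(1)] h by blast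
    then show ?thesis
    proof
      assume "c b = c (a + 1)" then show ?thesis using unique[of a] ab h by simp
    next
      assume "c b = c (a - 1)" then show ?thesis using unique[of "a - 1"] ab h by simp
    qed
  qed
  have "indep (R - {c i})" "indep (R - {c (i + 1)})" unfolding indep_def using edges by blast+
  then show ?thesis using that i(1) w1 odd_cycleD(4)[OF c(1), of i] unfolding R_def by blast
qed

end

text \<open>Both ends \<open>r1\<close>, \<open>r2\<close> of the edge in \<open>rest u v\<close> lie on a 7-cycle whose four vertices farthest from
  them are the same set \<open>Q\<close>; this forces a cycle of length at most 5.\<close>

lemma highs_indep:
  assumes "E u v" "deg u = 4" "deg v = 4"
  shows False
proof -
  have vu: "E v u" using assms(1) Esym by blast
  note uv = assms
  define TT where "TT = onb2 u v \<union> onb2 v u"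
  obtain r1 r2 where r: "r1 \<in> rest u v" "r2 \<in> rest u v" "E r1 r2"
    "indep (rest u v - {r1})" "indep (rest u v - {r2})" using rest_edge[OF uv] by blast
  obtain Q1 where Q1: "card Q1 \<le> 2" "Q1 \<subseteq> onb2 u v"
    "\<And>t. t \<in> onb2 u v - Q1 \<Longrightarrow> card (nb t \<inter> TT) \<le> 1"
    using edge_exceptional[OF uv] unfolding TT_def by blast
  obtain Q2 where Q2: "card Q2 \<le> 2" "Q2 \<subseteq> onb2 v u"
    "\<And>t. t \<in> onb2 v u - Q2 \<Longrightarrow> card (nb t \<inter> TT) \<le> 1"
    using edge_exceptional[OF vu uv(3,2)] unfolding TT_def by (metis sup_commute)
  define Q where "Q = Q1 \<union> Q2"
  have Q4: "card Q \<le> 4" using card_Un_le[of Q1 Q2] Q1(1) Q2(1) unfolding Q_def by linarith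
  have finT: "finite TT" using far_edge(1)[OF uv(1)] far_edge(1)[OF vu] finite_far unfolding TT_def by (metis finite_Un)
  have finQ: "finite Q" using finT Q1(2) Q2(2) finite_subset unfolding Q_def TT_def by blast
  have Qmem: "t \<in> Q" if "t \<in> TT" "E t x" "E t y" "x \<in> TT" "y \<in> TT" "x \<noteq> y" for t x y
  proof (rule ccontr)
    assume "t \<notin> Q"
    then have "card (nb t \<inter> TT) \<le> 1" using that(1) Q1(3) Q2(3) unfolding TT_def Q_def by blast
    moreover have "card {x, y} \<le> card (nb t \<inter> TT)" by (rule card_mono) (use that in auto)
    ultimately show False using that(6) by simp
  qed
  have bipT: "bip TT" unfolding bip_def
  proof (intro exI[of _ "\<lambda>x. x \<in> onb2 u v"] ballI impI)
    fix x y assume "x \<in> TT" "y \<in> TT" "E x y"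
    then show "(x \<in> onb2 u v) \<noteq> (y \<in> onb2 u v)"
      using onb2_indep[of u v] onb2_indep[of v u] unfolding TT_def indep_def by blast
  qed
  \<comment> \<open>Giving colour 3 to \<open>rest u v - {r}\<close> must leave an odd cycle, and
    \<open>TT\<close> alone is bipartite; so this cycle passes through \<open>r\<close> and runs in
    \<open>TT\<close> otherwise.\<close>
  have path: "\<exists>d1 d2 d3 d4 d5 d6. E r d1 \<and> E d1 d2 \<and> E d2 d3 \<and> E d3 d4 \<and> E d4 d5 \<and> E d5 d6 \<and> E d6 r \<and>
      Q = {d2, d3, d4, d5} \<and> distinct [d2, d3, d4, d5]"
    if rr: "r \<in> rest u v" "indep (rest u v - {r})" for r
  proof -
    have rT: "r \<notin> TT" using rr(1) unfolding rest_def TT_def by blast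
    have "rest u v - (rest u v - {r}) = {r}" using rr(1) by blast
    then have "\<not> bip (insert r TT)"
      using col3_from_edge[OF uv(1) _ rr(2)] nc unfolding TT_def by (metis Diff_subset Un_commute insert_is_Un)
    then obtain l d0 where d0: "odd_cycle (insert r TT) l d0" using shortest_odd_cycle by metis
    have "\<exists>k. d0 k = r"
    proof (rule ccontr)
      assume "\<nexists>k. d0 k = r"
      then have "range d0 \<subseteq> TT" using odd_cycleD(3)[OF d0] by blast
      then show False using odd_cycle_not_bip[OF d0] bipT bip_subset by blast
    qed
    then obtain k where k: "d0 k = r" by blast
    define d where "d i = d0 (i + k)" for i
    have d: "odd_cycle (insert r TT) l d" unfolding d_def by (rule odd_cycle_shift[OF d0])
    have d0r: "d 0 = r" unfolding d_def using k by simp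
    have l: "odd l" "7 \<le> l" using odd_cycleD[OF d] by auto
    have dT: "d i \<in> TT" if "0 < i" "i < l" for i
      using odd_cycleD(3)[OF d, of i] odd_cycle_neq[OF d that, of 0] d0r by auto
    have e: "E (d i) (d (i + 1))" for i using odd_cycleD(4)[OF d] .
    \<comment> \<open>At two or more steps from \<open>r\<close> both cycle neighbours lie in
      \<open>TT\<close>, which makes the vertex exceptional. There are \<open>l - 3\<close> such
      positions and at most four exceptional vertices, so \<open>l = 7\<close> and they fill
      \<open>Q\<close>.\<close>
    have dQ: "d i \<in> Q" if "2 \<le> i" "i \<le> l - 2" for i
    proof (rule Qmem)
      show "E (d i) (d (i + 1))" "E (d i) (d (i - 1))" using e[of i] e[of "i - 1"] Esym by simp_all
      show "d (i + 1) \<noteq> d (i - 1)" using odd_cycle_neq[OF d, of 2 "i - 1"] l by (simp add: algebra_simps)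
    qed (use dT that in auto)
    have inj: "inj_on d {0..<l}"
    proof (rule inj_onI)
      fix a b assume ab: "a \<in> {0..<l}" "b \<in> {0..<l}" "d a = d b"
      show "a = b" using odd_cycle_neq[OF d, of "a - b" b] odd_cycle_neq[OF d, of "b - a" a] ab by (cases a b rule: linorder_cases) auto
    qed
    have "card (d ` {2..l-2}) = nat (l - 3)" using l by (subst card_image) (auto intro: inj_on_subset[OF inj])
    moreover have "card (d ` {2..l-2}) \<le> card Q" using dQ finQ by (intro card_mono) auto
    ultimately have l7: "l = 7" using Q4 l by linarith
    have dist: "distinct [d 2, d 3, d 4, d 5]"
      using odd_cycleD(5)[OF d] l7 by simp
    have "{d 2, d 3, d 4, d 5} \<subseteq> Q" using dQ l7 by auto
    moreover have "card {d 2, d 3, d 4, d 5} = 4" using dist by simp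
    ultimately have "Q = {d 2, d 3, d 4, d 5}" using Q4 finQ by (metis card_seteq)
    moreover have "d 7 = r" using odd_cycleD(6)[OF d, of 0] l7 d0r by simp
    ultimately have "E r (d 1) \<and> E (d 1) (d 2) \<and> E (d 2) (d 3) \<and> E (d 3) (d 4) \<and> E (d 4) (d 5) \<and>
      E (d 5) (d 6) \<and> E (d 6) r \<and> Q = {d 2, d 3, d 4, d 5} \<and> distinct [d 2, d 3, d 4, d 5]"
      using e[of 0] e[of 1] e[of 2] e[of 3] e[of 4] e[of 5] e[of 6] d0r dist by simp
    then show ?thesis by blast
  qed
  obtain d1 d2 d3 d4 d5 d6 where d: "E r1 d1" "E d1 d2" "E d2 d3" "E d3 d4" "E d4 d5" "E d5 d6" "E d6 r1"
    "Q = {d2, d3, d4, d5}" "distinct [d2, d3, d4, d5]" using path[OF r(1,4)] by blast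
  obtain e1 e2 e3 e4 e5 e6 where e: "E r2 e1" "E e1 e2" "E e2 e3" "E e3 e4" "E e4 e5" "E e5 e6" "E e6 r2"
    "Q = {e2, e3, e4, e5}" using path[OF r(2,5)] by blast
  have r21: "E r2 r1" using r(3) Esym by blast
  \<comment> \<open>\<open>d2\<close>, \<open>d5\<close> are two steps from \<open>r1\<close>, and
    \<open>e2\<close>, \<open>e5\<close> two steps from its neighbour \<open>r2\<close>; a
    coincidence would be a closed walk of length 5. So \<open>d2\<close> and \<open>d5\<close> are
    \<open>e3\<close> and \<open>e4\<close>, hence adjacent, and close a 4-cycle with
    \<open>d3\<close>, \<open>d4\<close>.\<close>
  have "d2 \<noteq> e2" using no5[OF d(1,2) _ _ r21, of e1] e(1,2) Esym by blast
  moreover have "d2 \<noteq> e5" using no5[OF d(1,2) _ e(7) r21] e(6) by blast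
  moreover have "d5 \<noteq> e2" using no5[OF Esym[OF d(7)] Esym[OF d(6)] _ _ r21, of e1] e(1,2) Esym by blast
  moreover have "d5 \<noteq> e5" using no5[OF Esym[OF d(7)] Esym[OF d(6)] _ e(7) r21] e(6) by blast
  moreover have "d2 \<in> {e2, e3, e4, e5}" "d5 \<in> {e2, e3, e4, e5}" using d(8) e(8) by blast+
  ultimately have "E d5 d2" using e(4) Esym d(9) by auto
  then show False using no4[OF d(3,4,5)] d(9) by auto
qed

end

section \<open>Independent sets covering the most edges\<close>

context sgraph
begin

lemma nb_split: "deg c = card (nb c \<inter> S) + card (nb c \<inter> (V - S))"
proof -
  have "nb c = (nb c \<inter> S) \<union> (nb c \<inter> (V - S))" using nb_V by blast
  moreover have "(nb c \<inter> S) \<inter> (nb c \<inter> (V - S)) = {}" by blast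
  ultimately show ?thesis unfolding deg_def by (metis card_Un_disjoint fin_nb finite_Int)
qed

lemma double_count:
  assumes "finite A" "finite B"
  shows "(\<Sum>x\<in>A. card (nb x \<inter> B)) = (\<Sum>y\<in>B. card (nb y \<inter> A))"
proof -
  have cnt: "card (nb x \<inter> D) = (\<Sum>y\<in>D. if E x y then 1 else 0)" if "finite D" for x D
  proof -
    have "nb x \<inter> D = {y \<in> D. E x y}" by auto
    then show ?thesis using that by (simp add: sum.If_cases Int_def)
  qed
  have "(\<Sum>x\<in>A. card (nb x \<inter> B)) = (\<Sum>x\<in>A. \<Sum>y\<in>B. if E x y then 1 else 0)"
    using cnt assms by simp
  also have "\<dots> = (\<Sum>y\<in>B. \<Sum>x\<in>A. if E x y then 1 else 0)" by (rule sum.swap)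
  also have "\<dots> = (\<Sum>y\<in>B. \<Sum>x\<in>A. if E y x then 1 else 0)" by (simp add: E_comm)
  also have "\<dots> = (\<Sum>y\<in>B. card (nb y \<inter> A))" using cnt assms by simp
  finally show ?thesis .
qed

lemma odd_cycle_mono: "odd_cycle A l c \<Longrightarrow> range c \<subseteq> B \<Longrightarrow> odd_cycle B l c"
  unfolding odd_cycle_def by (simp add: image_subset_iff)

text \<open>For an independent set this is the number of edges it covers.\<close>

definition wt :: "'a set \<Rightarrow> nat" where "wt A = (\<Sum>x\<in>A. deg x)"

definition maxw :: "'a set \<Rightarrow> bool" where
  "maxw S \<longleftrightarrow> S \<subseteq> V \<and> indep S \<and> (\<forall>T. T \<subseteq> V \<longrightarrow> indep T \<longrightarrow> wt T \<le> wt S)"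

lemma maxwD: "maxw S \<Longrightarrow> T \<subseteq> V \<Longrightarrow> indep T \<Longrightarrow> wt T \<le> wt S"
  by (simp add: maxw_def)

text \<open>Replacing the neighbours of \<open>A\<close> in \<open>S\<close> by \<open>A\<close>
  gives another independent set, which cannot be heavier.\<close>

lemma exchange:
  assumes S: "maxw S" and A: "A \<subseteq> V - S" "indep A"
  shows "wt A \<le> wt {x \<in> S. \<exists>a\<in>A. E a x}"
proof -
  define N where "N = {x \<in> S. \<exists>a\<in>A. E a x}"
  have SV: "S \<subseteq> V" "indep S" using S unfolding maxw_def by auto
  have fs: "finite S" "finite A" "finite N"
    using finite_subset[OF SV(1) fin] finite_subset[OF A(1)] fin unfolding N_def by auto
  have "\<not> E x y" if xy: "x \<in> (S - N) \<union> A" "y \<in> (S - N) \<union> A" for x y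
  proof -
    have m: "\<not> E a s" if "a \<in> A" "s \<in> S - N" for a s using that unfolding N_def by blast
    show ?thesis using xy m[of x y] m[of y x] Esym[of x y] SV(2) A(2) unfolding indep_def by blast
  qed
  then have "indep ((S - N) \<union> A)" unfolding indep_def by blast
  moreover have "(S - N) \<union> A \<subseteq> V" using A SV by blast
  ultimately have le: "wt ((S - N) \<union> A) \<le> wt S" using maxwD[OF S] by blast
  have "wt ((S - N) \<union> A) = wt (S - N) + wt A"
    unfolding wt_def by (rule sum.union_disjoint) (use fs A in auto)
  moreover have "wt S = wt (S - N) + wt N"
    unfolding wt_def using sum.subset_diff[of N S deg] fs unfolding N_def by auto
  ultimately show ?thesis using le unfolding N_def by linarith
qed

end

section \<open>Exchanges when vertices of degree 4 are pairwise nonadjacent\<close>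

locale sub4 = crit +
  assumes dle4: "deg x \<le> 4"
    and hi: "E u v \<Longrightarrow> deg u = 4 \<Longrightarrow> deg v = 4 \<Longrightarrow> False"
begin

lemma deg34: "x \<in> V \<Longrightarrow> deg x = 3 \<or> deg x = 4"
  using deg3[of x] dle4[of x] by linarith

lemma maxw_nb:
  assumes S: "maxw S" and c: "c \<in> V - S"
  shows "deg c \<le> wt (nb c \<inter> S)"
proof -
  have "wt {c} \<le> wt {x \<in> S. \<exists>a\<in>{c}. E a x}"
    by (rule exchange[OF S]) (use c irr in \<open>auto simp: indep_def\<close>)
  moreover have "{x \<in> S. \<exists>a\<in>{c}. E a x} = nb c \<inter> S" by auto
  ultimately show ?thesis unfolding wt_def by simp
qed

text \<open>All neighbours of \<open>c\<close> have degree 3, and by \<open>maxw_nb\<close> those in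
  \<open>S\<close> weigh at least 4 together.\<close>

lemma maxw_high:
  assumes S: "maxw S" and c: "c \<in> V - S" "deg c = 4"
  shows "2 \<le> card (nb c \<inter> S)" "x \<in> nb c \<inter> S \<Longrightarrow> deg x = 3"
proof -
  have low: "deg x = 3" if "x \<in> nb c \<inter> S" for x
    using that hi[of c x] c deg34[of x] inV2[of c x] by auto
  then show "x \<in> nb c \<inter> S \<Longrightarrow> deg x = 3" .
  have "wt (nb c \<inter> S) = card (nb c \<inter> S) * 3" unfolding wt_def using low by simp
  then show "2 \<le> card (nb c \<inter> S)" using maxw_nb[OF S c(1)] c(2) by linarith
qed

lemma maxw_deg2:
  assumes S: "maxw S" and c: "c \<in> V - S"
  shows "card (nb c \<inter> (V - S)) \<le> 2"
proof (cases "deg c = 4")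
  case True
  then show ?thesis using maxw_high(1)[OF S c] nb_split[of c S] by simp
next
  case False
  then have "deg c = 3" using deg34 c by blast
  moreover have "nb c \<inter> S \<noteq> {}"
  proof
    assume "nb c \<inter> S = {}"
    then show False using maxw_nb[OF S c] calculation unfolding wt_def by simp
  qed
  ultimately show ?thesis using nb_split[of c S] card_gt_0_iff[of "nb c \<inter> S"] by auto
qed

text \<open>By \<open>maxw_deg2\<close> the two cycle neighbours exhaust the neighbours in
  \<open>V - S\<close>: an odd cycle in \<open>V - S\<close> is a component of it.\<close>

lemma cycle_closed:
  assumes S: "maxw S" and d: "odd_cycle A k d" "A \<subseteq> V - S"
  shows "nb (d j) \<inter> (V - S) = {d (j + 1), d (j - 1)}"
proof -
  have ne: "d (j + 1) \<noteq> d (j - 1)" using odd_cycle_neq[OF d(1), of 2 "j - 1"] odd_cycleD(2)[OF d(1)]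
    by (simp add: algebra_simps)
  have m: "d i \<in> V - S" for i using odd_cycleD(3)[OF d(1), of i] d(2) by blast
  have "{d (j + 1), d (j - 1)} \<subseteq> nb (d j) \<inter> (V - S)"
    using m odd_cycleD(4)[OF d(1), of j] odd_cycleD(4)[OF d(1), of "j - 1"] Esym by auto
  moreover have "card {d (j + 1), d (j - 1)} = 2" using ne by simp
  ultimately show ?thesis using maxw_deg2[OF S m[of j]] by (metis card_seteq fin_nb finite_Int)
qed

lemma cycles_meet:
  assumes S: "maxw S" and c: "odd_cycle A l c" "A \<subseteq> V - S" and d: "odd_cycle B k d" "B \<subseteq> V - S"
    and e: "c i = d j"
  shows "range c \<subseteq> range d"
proof -
  have cm: "c m \<in> V - S" for m using odd_cycleD(3)[OF c(1), of m] c(2) by blast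
  have nx: "y \<in> range d" if h: "x \<in> range d" "E x y" "y \<in> V - S" for x y
  proof -
    obtain j where "x = d j" using h(1) by blast
    then have "y \<in> nb (d j) \<inter> (V - S)" using h by simp
    then show ?thesis unfolding cycle_closed[OF S d] by blast
  qed
  have "c m \<in> range d" for m
  proof (induction m rule: int_induct[where k = i])
    case base then show ?case using e by simp
  next
    case (step1 m) then show ?case using nx odd_cycleD(4)[OF c(1), of m] cm by blast
  next
    case (step2 m) then show ?case using nx[of "c m" "c (m - 1)"] odd_cycleD(4)[OF c(1), of "m - 1"] cm Esym by auto
  qed
  then show ?thesis by blast
qed

end

text \<open>Among the independent sets \<open>S\<close> of maximal weight, choose one for which the odd cycle transversal
  number of \<open>V - S\<close>, attained by \<open>X\<close>, is minimal; \<open>c\<close> is an odd cycle met by \<open>X\<close> only in \<open>x0\<close>.\<close>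

locale catlin = sub4 +
  fixes S X :: "'a set" and x0 :: 'a and l :: int and c :: "int \<Rightarrow> 'a"
  assumes S: "maxw S" and X: "X \<subseteq> V - S" and bX: "bip (V - S - X)"
    and Xmin: "\<And>S' X'. maxw S' \<Longrightarrow> X' \<subseteq> V - S' \<Longrightarrow> bip (V - S' - X') \<Longrightarrow> card X \<le> card X'"
    and x0: "x0 \<in> X" and cyc: "odd_cycle (V - S - (X - {x0})) l c"
begin

definition F where "F = V - S"
definition C where "C = range c"
definition Y where "Y = F - C"
text \<open>The pairs that are exchanged: when \<open>y\<close> enters \<open>S\<close>, only
  \<open>x\<close> has to leave.\<close>

definition priv where "priv x y \<longleftrightarrow> y \<in> F \<and> deg y = 3 \<and> nb y \<inter> S = {x}"

lemma cF: "c i \<in> F" using odd_cycleD(3)[OF cyc, of i] unfolding F_def by blast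

lemma CF: "C \<subseteq> F" unfolding C_def using cF by blast

lemma finF [simp]: "finite F" unfolding F_def using fin by simp

lemma finS [simp]: "finite S" using S fin finite_subset unfolding maxw_def by blast

lemma finC [simp]: "finite C" using CF finite_subset finF by blast

lemma finY [simp]: "finite Y" unfolding Y_def by simp

lemma SV: "S \<subseteq> V" and Sind: "indep S" using S unfolding maxw_def by auto

lemma YV: "Y \<subseteq> V" unfolding Y_def F_def by blast

lemma nbC: "nb (c i) \<inter> F = {c (i + 1), c (i - 1)}"
  unfolding F_def by (rule cycle_closed[OF S cyc]) auto

lemma C_closed: "a \<in> C \<Longrightarrow> E a y \<Longrightarrow> y \<in> F \<Longrightarrow> y \<in> C"
proof -
  assume a: "a \<in> C" "E a y" "y \<in> F"
  then obtain j where "a = c j" unfolding C_def by blast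
  then have "y \<in> nb (c j) \<inter> F" using a by simp
  then show "y \<in> C" unfolding nbC C_def by blast
qed

lemma cardC: "card C = nat l" unfolding C_def by (rule odd_cycle_range(2)[OF cyc])

lemma l7: "odd l" "7 \<le> l" using odd_cycleD[OF cyc] by auto

lemma C_nbF: assumes "a \<in> C" shows "card (nb a \<inter> F) = 2"
proof -
  obtain i where i: "a = c i" using assms unfolding C_def by blast
  have "c (i + 1) \<noteq> c (i - 1)" using odd_cycle_neq[OF cyc, of 2 "i - 1"] l7 by (simp add: algebra_simps)
  then show ?thesis using nbC[of i] i by simp
qed

lemma C_low: assumes "a \<in> C" "deg a = 3" shows "\<exists>x. priv x a"
proof -
  have "card (nb a \<inter> S) = 1" using nb_split[of a S] C_nbF[OF assms(1)] assms(2) unfolding F_def by simp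
  then obtain x where "nb a \<inter> S = {x}" by (auto simp: card_1_singleton_iff)
  then show ?thesis unfolding priv_def using assms CF by blast
qed

lemma C_high: assumes "a \<in> C" "deg a = 4" shows "card (nb a \<inter> S) = 2"
  using nb_split[of a S] C_nbF[OF assms(1)] assms(2) unfolding F_def by simp

lemma privD:
  assumes "priv x y"
  shows "x \<in> S" "E x y" "E y x" "y \<in> F" "deg y = 3"
proof -
  show "y \<in> F" "deg y = 3" using assms unfolding priv_def by auto
  have "x \<in> nb y \<inter> S" using assms unfolding priv_def by auto
  then show "x \<in> S" "E y x" "E x y" using Esym[of y x] by auto
qed

text \<open>Otherwise exchanging \<open>x\<close> for \<open>y\<close> and \<open>y'\<close> would
  gain 6 and lose at most 4.\<close>

lemma priv_unique:
  assumes "priv x y" "priv x y'" shows "y = y'"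
proof (rule ccontr)
  assume ne: "y \<noteq> y'"
  have "\<not> E y y'" using no3[of x y y'] privD[OF assms(1)] privD[OF assms(2)] by blast
  then have i: "indep {y, y'}" unfolding indep_def using irr Esym by blast
  have "wt {y, y'} \<le> wt {z \<in> S. \<exists>a\<in>{y, y'}. E a z}"
    by (rule exchange[OF S _ i]) (use privD(4)[OF assms(1)] privD(4)[OF assms(2)] in \<open>simp add: F_def\<close>)
  moreover have "{z \<in> S. \<exists>a\<in>{y, y'}. E a z} = (nb y \<inter> S) \<union> (nb y' \<inter> S)" by auto
  moreover have "(nb y \<inter> S) \<union> (nb y' \<inter> S) = {x}" using assms unfolding priv_def by simp
  moreover have "wt {y, y'} = 6" using ne privD(5)[OF assms(1)] privD(5)[OF assms(2)] unfolding wt_def by simp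
  ultimately show False using dle4[of x] unfolding wt_def by simp
qed

text \<open>Exchanging the two neighbours of \<open>h\<close> in \<open>S\<close>, one of them
  \<open>x\<close>, for \<open>y\<close> and \<open>h\<close> would gain 3 + 4 and lose 3 +
  3.\<close>

lemma priv_high:
  assumes "priv x y" "h \<in> F" "deg h = 4" "card (nb h \<inter> S) = 2" "E h x"
  shows False
proof -
  have ne: "y \<noteq> h" using assms privD(5) by fastforce
  have "\<not> E y h" using no3[of x y h] privD[OF assms(1)] assms(5) Esym by blast
  then have i: "indep {y, h}" unfolding indep_def using irr Esym by blast
  have "wt {y, h} \<le> wt {z \<in> S. \<exists>a\<in>{y, h}. E a z}"
    by (rule exchange[OF S _ i]) (use privD(4)[OF assms(1)] assms(2) in \<open>simp add: F_def\<close>)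
  moreover have "{z \<in> S. \<exists>a\<in>{y, h}. E a z} = (nb y \<inter> S) \<union> (nb h \<inter> S)" by auto
  moreover have "(nb y \<inter> S) \<union> (nb h \<inter> S) = nb h \<inter> S"
    using assms(1,5) privD(1)[OF assms(1)] unfolding priv_def by auto
  moreover have "wt (nb h \<inter> S) = 6"
    unfolding wt_def using maxw_high(2)[OF S, of h] assms unfolding F_def by simp
  moreover have "wt {y, h} = 7" using ne assms privD(5)[OF assms(1)] unfolding wt_def by simp
  ultimately show False by simp
qed

lemma x0C: "x0 \<in> C"
proof (rule ccontr)
  assume "x0 \<notin> C"
  then have "range c \<subseteq> V - S - X" using odd_cycle_range(4)[OF cyc] unfolding C_def by blast
  then show False using odd_cycle_not_bip[OF cyc] bX bip_subset by blast
qed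

text \<open>An odd cycle avoiding \<open>x\<close> would lie in \<open>F\<close> and, by
  \<open>bX\<close>, contain \<open>x0\<close>; by \<open>cycles_meet\<close> it would contain all
  of \<open>C\<close>, including the removed \<open>c i\<close>. A cycle through \<open>x\<close>
  cannot enter \<open>C\<close>, because \<open>x\<close> has no second neighbour there by
  \<open>priv_unique\<close> and \<open>priv_high\<close>.\<close>

lemma swap_cycle:
  assumes p: "priv x (c i)" and nb: "\<not> bip (insert x (F - (X - {x0}) - {c i}))"
  obtains k d where "odd_cycle (insert x (F - (X - {x0}) - {c i})) k d" "d 0 = x"
    "\<And>j. 0 < j \<Longrightarrow> j < k \<Longrightarrow> d j \<in> Y"
proof -
  obtain k d0 where d0: "odd_cycle (insert x (F - (X - {x0}) - {c i})) k d0"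
    by (rule shortest_odd_cycle[OF nb])
  have "\<exists>m. d0 m = x"
  proof (rule ccontr)
    assume no: "\<nexists>m. d0 m = x"
    have rd: "range d0 \<subseteq> F - (X - {x0}) - {c i}" using odd_cycleD(3)[OF d0] no by (metis image_subsetI insertE)
    then have d1: "odd_cycle F k d0" by (intro odd_cycle_mono[OF d0]) blast
    have "x0 \<in> range d0"
    proof (rule ccontr)
      assume "x0 \<notin> range d0"
      then have "range d0 \<subseteq> V - S - X" using rd unfolding F_def by blast
      then show False using odd_cycle_not_bip[OF d0] bX bip_subset by blast
    qed
    then obtain a b where "c a = d0 b" using x0C unfolding C_def by (metis imageE)
    then have "range c \<subseteq> range d0" by (rule cycles_meet[OF S cyc _ d1, rotated 2]) (auto simp: F_def)
    then have "c i \<in> range d0" by blast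
    then show False using rd by blast
  qed
  then obtain m where m: "d0 m = x" by blast
  define d where "d j = d0 (j + m)" for j
  have d: "odd_cycle (insert x (F - (X - {x0}) - {c i})) k d"
    unfolding d_def by (rule odd_cycle_shift[OF d0])
  have dx: "d 0 = x" unfolding d_def using m by simp
  have dF: "d j \<in> F" "d j \<noteq> c i" if "0 < j" "j < k" for j
    using odd_cycleD(3)[OF d, of j] odd_cycle_neq[OF d that, of 0] dx by auto
  have k: "7 \<le> k" using odd_cycleD(2)[OF d] .
  have dn: "E (d j) (d (j + 1))" for j using odd_cycleD(4)[OF d] .
  have "d j \<in> Y" if j: "0 < j" "j < k" for j
  proof (rule ccontr)
    assume "d j \<notin> Y"
    then have dj: "d j \<in> C" using dF[OF j] unfolding Y_def by blast
    \<comment> \<open>\<open>C\<close> is closed in \<open>F\<close>, so membership propagates back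
      along the cycle to \<open>d 1\<close>, a neighbour of \<open>x\<close>.\<close>
    have "d m \<in> C" if "0 < m" "m \<le> j" for m
      using that(2,1)
    proof (induction rule: int_le_induct)
      case base then show ?case using dj by blast
    next
      case (step m)
      then have "d m \<in> C" by simp
      moreover have "E (d m) (d (m - 1))" using dn[of "m - 1"] Esym by simp
      moreover have "d (m - 1) \<in> F" using dF(1)[of "m - 1"] step j by simp
      ultimately show ?case using C_closed by blast
    qed
    then have d1: "d 1 \<in> C" using j by auto
    have e1: "E x (d 1)" using dn[of 0] dx by simp
    have ne: "d 1 \<noteq> c i" using dF(2)[of 1] k by simp
    have "d 1 \<in> V" using d1 CF unfolding F_def by blast
    then consider "deg (d 1) = 3" | "deg (d 1) = 4" using deg34 by blast
    then show False
    proof cases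
      case 1
      then obtain x' where x': "priv x' (d 1)" using C_low d1 by blast
      moreover have "x \<in> nb (d 1) \<inter> S" using e1 Esym privD(1)[OF p] by simp
      ultimately have "x' = x" unfolding priv_def by simp
      then show False using priv_unique[OF p, of "d 1"] x' ne by simp
    next
      case 2
      then show False using priv_high[OF p _ 2 C_high[OF d1 2]] dF(1)[of 1] k e1 Esym by simp
    qed
  qed
  then show ?thesis using that[of k d] d dx by blast
qed

lemma swap_indep:
  assumes p: "priv x (c i)"
  shows "indep (insert (c i) (S - {x}))" "insert (c i) (S - {x}) \<subseteq> V"
    "V - insert (c i) (S - {x}) = insert x (F - {c i})"
proof -
  let ?S = "insert (c i) (S - {x})"
  have xS: "x \<in> S" using privD(1)[OF p] .
  have ciS: "c i \<notin> S" "c i \<in> V" using cF[of i] unfolding F_def by auto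
  have n: "\<not> E (c i) s" if "s \<in> S - {x}" for s
  proof
    assume "E (c i) s"
    then have "s \<in> nb (c i) \<inter> S" using that by simp
    moreover have "nb (c i) \<inter> S = {x}" using p unfolding priv_def by simp
    ultimately show False using that by simp
  qed
  have "\<not> E a b" if "a \<in> ?S" "b \<in> ?S" for a b
  proof (cases "a = c i")
    case True then show ?thesis using that n[of b] irr[of a] by auto
  next
    case False
    then show ?thesis using that n[of a] Esym[of a b] Sind unfolding indep_def by auto
  qed
  then show "indep ?S" unfolding indep_def by simp
  show "?S \<subseteq> V" using SV ciS by blast
  have "x \<in> V" "x \<noteq> c i" using xS SV ciS by auto
  then show "V - ?S = insert x (F - {c i})" using ciS unfolding F_def by auto
qed

text \<open>Both vertices have degree 3, so the weight is unchanged and the choice of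
  \<open>X\<close> applies to the new set: \<open>X - {x0}\<close> is too small to be a transversal
  of its complement.\<close>

lemma swap_maxw:
  assumes p: "priv x (c i)" and x: "deg x = 3"
  shows "maxw (insert (c i) (S - {x}))" "\<not> bip (insert x (F - (X - {x0}) - {c i}))"
proof -
  let ?S = "insert (c i) (S - {x})"
  note eq = swap_indep(3)[OF p]
  have xS: "x \<in> S" using privD(1)[OF p] .
  have "wt ?S = wt S"
  proof -
    have "c i \<notin> S" using cF[of i] unfolding F_def by simp
    then have "wt ?S = deg (c i) + wt (S - {x})" unfolding wt_def by simp
    also have "\<dots> = deg x + wt (S - {x})" using x privD(5)[OF p] by simp
    also have "\<dots> = wt S" unfolding wt_def using xS by (simp add: sum.remove[symmetric])
    finally show ?thesis .
  qed
  then show m: "maxw ?S" using S swap_indep[OF p] unfolding maxw_def by simp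
  show "\<not> bip (insert x (F - (X - {x0}) - {c i}))"
  proof
    assume b: "bip (insert x (F - (X - {x0}) - {c i}))"
    have ciX: "c i \<notin> X - {x0}" using odd_cycleD(3)[OF cyc, of i] by blast
    have "card X \<le> card (X - {x0})"
    proof (rule Xmin[OF m])
      show "X - {x0} \<subseteq> V - ?S" unfolding eq using X ciX unfolding F_def by auto
      have "V - ?S - (X - {x0}) \<subseteq> insert x (F - (X - {x0}) - {c i})" unfolding eq by auto
      then show "bip (V - ?S - (X - {x0}))" by (rule bip_subset[OF b])
    qed
    moreover have "finite X" using X fin finite_subset by blast
    ultimately show False using x0 by (metis card_Diff1_less not_le)
  qed
qed

text \<open>Unions of components of the graph on \<open>F\<close>.\<close>

definition Fclosed where "Fclosed Q \<longleftrightarrow> (\<forall>p\<in>Q. \<forall>y\<in>F. E p y \<longrightarrow> y \<in> Q)"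

text \<open>The new set has maximal weight too, so the new odd cycle is closed in its complement,
  and removing \<open>x\<close> leaves a component \<open>P\<close> of \<open>F\<close>.
  Connectedness is stated as minimality among closed sets, and the ends as the vertices with at most
  one neighbour in \<open>F\<close>, so that both depend on \<open>P\<close> alone.\<close>

lemma low_path:
  assumes p: "priv x (c i)" and x: "deg x = 3"
  shows "\<exists>P\<subseteq>Y. 6 \<le> card P \<and> Fclosed P \<and> (\<forall>Q. Fclosed Q \<longrightarrow> Q \<inter> P \<noteq> {} \<longrightarrow> P \<subseteq> Q) \<and>
    (\<exists>e f. e \<noteq> f \<and> E x e \<and> E x f \<and> {y \<in> P. card (nb y \<inter> F) \<le> 1} = {e, f})"
proof -
  note sw = swap_maxw[OF p x]
  obtain k d where d: "odd_cycle (insert x (F - (X - {x0}) - {c i})) k d" and d0: "d 0 = x"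
    and dY: "\<And>j. 0 < j \<Longrightarrow> j < k \<Longrightarrow> d j \<in> Y" using swap_cycle[OF p sw(2)] by blast
  have k: "7 \<le> k" using odd_cycleD(2)[OF d] .
  have xF: "x \<notin> F" using privD(1)[OF p] unfolding F_def by blast
  have nbd: "nb (d j) \<inter> insert x (F - {c i}) = {d (j + 1), d (j - 1)}" for j
    using cycle_closed[OF sw(1) d, of j] unfolding swap_indep(3)[OF p] by blast
  have dk: "d k = x" using odd_cycleD(6)[OF d, of 0] d0 by simp
  have inj: "d a \<noteq> d b" if "0 \<le> a" "a < b" "b < k" for a b
    using odd_cycle_neq[OF d, of "b - a" a] that by simp
  define P where "P = d ` {1..k-1}"
  have PY: "P \<subseteq> Y" unfolding P_def using dY by auto
  have nF: "y = d (j + 1) \<or> y = d (j - 1)" if "0 < j" "j < k" "y \<in> F" "E (d j) y" for j y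
  proof -
    have dj: "d j \<in> F" "d j \<notin> C" using dY[OF that(1,2)] unfolding Y_def by simp_all
    have "y \<noteq> c i"
    proof
      assume "y = c i"
      then have "E (c i) (d j)" using Esym[OF that(4)] by simp
      moreover have "c i \<in> C" unfolding C_def by simp
      ultimately show False using C_closed[of "c i" "d j"] dj by simp
    qed
    then have "y \<in> nb (d j) \<inter> insert x (F - {c i})" using that by simp
    then show ?thesis unfolding nbd by simp
  qed
  have dn: "E (d j) (d (j + 1))" "E (d j) (d (j - 1))" for j
    using odd_cycleD(4)[OF d, of j] odd_cycleD(4)[OF d, of "j - 1"] Esym by simp_all
  have "6 \<le> card P"
  proof -
    have "inj_on d {1..k-1}" by (rule linorder_inj_onI) (use inj in auto)
    then show ?thesis unfolding P_def using k by (simp add: card_image)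
  qed
  moreover have "Fclosed P" unfolding Fclosed_def
  proof (intro ballI impI)
    fix q y assume q: "q \<in> P" "y \<in> F" "E q y"
    then obtain j where j: "q = d j" "1 \<le> j" "j \<le> k - 1" unfolding P_def by auto
    have y: "y \<noteq> d 0" "y \<noteq> d k" using q(2) xF d0 dk by auto
    have "y = d (j + 1) \<or> y = d (j - 1)" using nF[of j y] q j by simp
    then show "y \<in> P"
    proof
      assume e: "y = d (j + 1)"
      then have "j + 1 \<noteq> k" using y by metis
      then have "j + 1 \<in> {1..k-1}" using j by simp
      then show ?thesis unfolding P_def e by (rule imageI)
    next
      assume e: "y = d (j - 1)"
      then have "j - 1 \<noteq> 0" using y by metis
      then have "j - 1 \<in> {1..k-1}" using j by simp
      then show ?thesis unfolding P_def e by (rule imageI)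
    qed
  qed
  moreover have "P \<subseteq> Q" if Q: "Fclosed Q" "Q \<inter> P \<noteq> {}" for Q
  proof -
    obtain q where "q \<in> Q" "q \<in> P" using Q(2) by blast
    then obtain j where "d j \<in> Q" "j \<in> {1..k-1}" unfolding P_def by blast
    then have j: "d j \<in> Q" "0 < j" "j < k" by auto
    have up: "m < k \<longrightarrow> d m \<in> Q" if "j \<le> m" for m
      using that
    proof (induction rule: int_ge_induct)
      case (step m)
      show ?case
      proof
        assume "m + 1 < k"
        then show "d (m + 1) \<in> Q"
          using step j dn(1)[of m] dY[of "m + 1"] Q(1) unfolding Fclosed_def Y_def by auto
      qed
    qed (use j in blast)
    have down: "0 < m \<longrightarrow> d m \<in> Q" if "m \<le> j" for m
      using that
    proof (induction rule: int_le_induct)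
      case (step m)
      show ?case
      proof
        assume "0 < m - 1"
        then show "d (m - 1) \<in> Q"
          using step j dn(2)[of m] dY[of "m - 1"] Q(1) unfolding Fclosed_def Y_def by auto
      qed
    qed (use j in blast)
    have "d m \<in> Q" if "1 \<le> m" "m \<le> k - 1" for m using up[of m] down[of m] that by (cases "j \<le> m") auto
    then show ?thesis unfolding P_def by auto
  qed
  moreover have "{y \<in> P. card (nb y \<inter> F) \<le> 1} = {d 1, d (k - 1)}"
  proof -
    have "card (nb (d 1) \<inter> F) \<le> 1"
    proof -
      have "y = d 2" if "E (d 1) y" "y \<in> F" for y
        using nF[of 1 y] that k d0 xF by auto
      then have "nb (d 1) \<inter> F \<subseteq> {d 2}" by auto
      then show ?thesis using card_mono[of "{d 2}" "nb (d 1) \<inter> F"] by simp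
    qed
    moreover have "card (nb (d (k - 1)) \<inter> F) \<le> 1"
    proof -
      have "y = d (k - 2)" if "E (d (k - 1)) y" "y \<in> F" for y
        using nF[of "k - 1" y] that k dk xF by auto
      then have "nb (d (k - 1)) \<inter> F \<subseteq> {d (k - 2)}" by auto
      then show ?thesis using card_mono[of "{d (k - 2)}" "nb (d (k - 1)) \<inter> F"] by simp
    qed
    moreover have "\<not> card (nb (d j) \<inter> F) \<le> 1" if "1 < j" "j < k - 1" for j
    proof -
      have "{d (j + 1), d (j - 1)} \<subseteq> nb (d j) \<inter> F"
        using dn[of j] dY[of "j + 1"] dY[of "j - 1"] that unfolding Y_def by auto
      then have "card {d (j + 1), d (j - 1)} \<le> card (nb (d j) \<inter> F)" by (intro card_mono) auto
      moreover have "d (j - 1) \<noteq> d (j + 1)" using inj[of "j - 1" "j + 1"] that by simp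
      ultimately show ?thesis by simp
    qed
    moreover have "d 1 \<in> P" "d (k - 1) \<in> P" unfolding P_def using k by auto
    moreover have "j = 1 \<or> j = k - 1 \<or> 1 < j \<and> j < k - 1" if "j \<in> {1..k-1}" for j using that by auto
    ultimately show ?thesis unfolding P_def
      by (intro equalityI subsetI) (blast, blast)
  qed
  moreover have "d 1 \<noteq> d (k - 1)" using inj[of 1 "k - 1"] k by simp
  moreover have "E x (d 1)" "E x (d (k - 1))"
    using dn(1)[of 0] dn(1)[of "k - 1"] d0 dk Esym by simp_all
  ultimately show ?thesis using PY by blast
qed

text \<open>The exchange partners of vertices of \<open>C\<close>, split by degree: for
  \<open>Lx\<close> the exchange keeps the weight, for \<open>Hx\<close> it lowers it.\<close>

definition Lx where "Lx = {x \<in> S. deg x = 3 \<and> (\<exists>i. priv x (c i))}"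
definition Hx where "Hx = {x \<in> S. deg x = 4 \<and> (\<exists>i. priv x (c i))}"

lemma card_Lx_Y: "6 * card Lx \<le> card Y"
proof -
  define good where "good x P \<longleftrightarrow> P \<subseteq> Y \<and> 6 \<le> card P \<and> Fclosed P \<and>
    (\<forall>Q. Fclosed Q \<longrightarrow> Q \<inter> P \<noteq> {} \<longrightarrow> P \<subseteq> Q) \<and>
    (\<exists>e f. e \<noteq> f \<and> E x e \<and> E x f \<and> {y \<in> P. card (nb y \<inter> F) \<le> 1} = {e, f})" for x P
  have "\<forall>x\<in>Lx. \<exists>P. good x P" unfolding good_def Lx_def using low_path by blast
  then obtain P where P: "\<And>x. x \<in> Lx \<Longrightarrow> good x (P x)" by metis
  have disj: "P x \<inter> P y = {}" if xy: "x \<in> Lx" "y \<in> Lx" "x \<noteq> y" for x y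
  proof (rule ccontr)
    assume ne: "P x \<inter> P y \<noteq> {}"
    have gx: "good x (P x)" and gy: "good y (P y)" using P xy by auto
    have g: "Fclosed A" "Fclosed Q \<Longrightarrow> Q \<inter> A \<noteq> {} \<Longrightarrow> A \<subseteq> Q" if "good z A" for z A Q
      using that unfolding good_def by simp_all
    have "P x \<subseteq> P y" using g(2)[OF gx g(1)[OF gy]] ne by (simp add: Int_commute)
    moreover have "P y \<subseteq> P x" using g(2)[OF gy g(1)[OF gx]] ne by simp
    ultimately have eq: "P x = P y" by blast
    have g3: "\<exists>e f. e \<noteq> f \<and> E z e \<and> E z f \<and> {y \<in> A. card (nb y \<inter> F) \<le> 1} = {e, f}" if "good z A" for z A
      using that unfolding good_def by (elim conjE)
    obtain e f where ef: "e \<noteq> f" "E x e" "E x f" "{y \<in> P x. card (nb y \<inter> F) \<le> 1} = {e, f}"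
      using g3[OF gx] by (elim exE conjE)
    obtain e' f' where ef': "e' \<noteq> f'" "E y e'" "E y f'" "{w \<in> P y. card (nb w \<inter> F) \<le> 1} = {e', f'}"
      using g3[OF gy] by (elim exE conjE)
    \<comment> \<open>The ends are determined by the component, so \<open>x\<close>,
      \<open>e\<close>, \<open>y\<close>, \<open>f\<close> would form a 4-cycle.\<close>
    have "{e, f} = {e', f'}" using ef(4) ef'(4) eq by simp
    then have "E y e" "E y f" using ef'(2,3) by (metis insertCI insertE singletonD)+
    then show False using no4[OF ef(2) _ _ Esym[OF ef(3)], of y] ef(1) xy(3) Esym[of y e] by blast
  qed
  have finL: "finite Lx" unfolding Lx_def by simp
  have PY: "P x \<subseteq> Y" "6 \<le> card (P x)" if "x \<in> Lx" for x using P[OF that] unfolding good_def by auto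
  have "6 * card Lx = (\<Sum>x\<in>Lx. 6)" by simp
  also have "\<dots> \<le> (\<Sum>x\<in>Lx. card (P x))" by (rule sum_mono) (use PY in auto)
  also have "\<dots> = card (\<Union>x\<in>Lx. P x)"
    by (rule card_UN_disjoint[symmetric]) (use finL PY disj finite_subset[OF _ finY] in auto)
  also have "\<dots> \<le> card Y" by (rule card_mono) (use PY in auto)
  finally show ?thesis .
qed

end

section \<open>Counting\<close>

text \<open>Read \<open>e, sh, sl, l, ch, y, yh, n, m, lx, hx, k\<close> as the sizes of
  \<open>EY, SH, SL, C, CH, Y, YH, V, M, Lx, Hx, K\<close>. Each exchange partner in
  \<open>Lx\<close> costs six vertices of \<open>Y\<close>, so there is at most one of them.\<close>

lemma edge_bound_arith:
  fixes e sh sl ch y yh n m lx hx k l :: nat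
  assumes "2 * e + 4 * sh + 3 * sl = l + ch + 3 * y + yh" "m + ch = l" "m = lx + hx" "hx \<le> sh"
    "k + lx \<le> sl" "2 * ch \<le> 3 * k" "2 * ch < l" "2 * (ch + yh) + lx \<le> 3 * sl"
    "n = sh + sl + l + y" "6 * lx \<le> y" "n \<le> 25" "7 \<le> l" "odd l"
    "l = 7 \<Longrightarrow> 2 * ch \<le> k" "ch + yh \<noteq> 0 \<Longrightarrow> 2 \<le> sl"
  shows "e \<le> 6"
proof -
  have V: "sh + sl + l + y \<le> 25" using assms(9,11) by simp
  \<comment> \<open>The degree count is doubled to match the bound on \<open>ch\<close> and
    \<open>yh\<close>; six times the bound on the order then eliminates \<open>y\<close>.\<close>
  have "4 * e + 8 * sh + 6 * sl = 2 * l + 2 * ch + 6 * y + 2 * yh" using assms(1) by linarith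
  moreover have "2 * ch + 2 * yh + lx \<le> 3 * sl" using assms(8) by simp
  ultimately have "4 * e + 8 * sh + 3 * sl + lx \<le> 2 * l + 6 * y" by linarith
  moreover have "6 * sh + 6 * sl + 6 * l + 6 * y \<le> 150" using V by linarith
  ultimately have 1: "4 * e + 14 * sh + 9 * sl + lx + 4 * l \<le> 150" by linarith
  have 2: "l \<le> sh + ch + lx" using assms(2,3,4) by linarith
  show ?thesis
  proof (cases "l = 7")
    case True
    have 3: "lx + 2 * ch \<le> sl" using assms(5,14) True by linarith
    have "7 + ch \<le> sh + sl" using 2 3 True by linarith
    then have "lx \<le> 1" using V True assms(10) by linarith
    have 5: "4 * e + 4 * ch \<le> 24 + 4 * lx" using 1 2 3 True by linarith
    consider "lx = 0" | "lx = 1" "1 \<le> ch" | "lx = 1" "ch = 0" "yh = 0" | "lx = 1" "ch = 0" "1 \<le> yh"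
      using \<open>lx \<le> 1\<close> by linarith
    then show ?thesis
    proof cases
      case 1 then show ?thesis using 5 by linarith
    next
      case 2 then show ?thesis using 5 by linarith
    next
      case h: 3
      \<comment> \<open>Here inequality 5 only gives 7. The exact degree count yields
        \<open>2 * e\<close> at most 61 - 7 * 6 - 6 * 1 = 13, and parity does the rest.\<close>
      have "6 \<le> sh" "1 \<le> sl" using 2 3 h True by linarith+
      moreover have "2 * e + 4 * sh + 3 * sl = 7 + 3 * y" using assms(1) h True by simp
      moreover have "3 * y + 3 * sh + 3 * sl \<le> 54" using V True by linarith
      ultimately show ?thesis by linarith
    next
      case h: 4
      then have "2 \<le> sl" using assms(15) by simp
      moreover have "6 \<le> sh" using 2 h True by linarith
      ultimately show ?thesis using h 1 True by linarith
    qed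
  next
    case False
    then have l9: "9 \<le> l" using assms(12,13) by presburger
    have 3: "3 * lx + 2 * ch \<le> 3 * sl" using assms(5,6) by linarith
    have 4: "4 * e + 18 * l \<le> 150 + 8 * ch + 4 * lx" using 1 2 3 by linarith
    have "3 * l \<le> 3 * sh + 3 * sl + ch" using 2 3 by linarith
    then have "6 * l + 18 * lx \<le> 75 + ch" using V assms(10) by linarith
    then have "lx \<le> 1" using assms(7) l9 by linarith
    then show ?thesis using 4 assms(7) l9 by linarith
  qed
qed

section \<open>Sizes of the degree classes\<close>

context catlin
begin

definition M where "M = {y \<in> C. deg y = 3}"
definition CH where "CH = {y \<in> C. deg y = 4}"
definition YH where "YH = {y \<in> Y. deg y = 4}"
definition SL where "SL = {x \<in> S. deg x = 3}"
definition SH where "SH = {x \<in> S. deg x = 4}"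
definition K where "K = {x \<in> S. \<exists>h\<in>CH. E h x}"

lemma fins [simp]: "finite M" "finite CH" "finite YH" "finite SL" "finite SH" "finite K" "finite Lx" "finite Hx"
  unfolding M_def CH_def YH_def SL_def SH_def K_def Lx_def Hx_def by simp_all

lemma card_by_deg:
  assumes "A \<subseteq> V"
  shows "card A = card {y \<in> A. deg y = 3} + card {y \<in> A. deg y = 4}"
proof -
  have "A = {y \<in> A. deg y = 3} \<union> {y \<in> A. deg y = 4}" using assms deg34 by auto
  moreover have "finite A" using assms fin finite_subset by blast
  moreover have "{y \<in> A. deg y = 3} \<inter> {y \<in> A. deg y = 4} = {}" by auto
  ultimately show ?thesis by (metis (no_types, lifting) card_Un_disjoint finite_Un)
qed

lemma card_C: "card M + card CH = nat l"
proof -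
  have "C \<subseteq> V" using CF unfolding F_def by blast
  then show ?thesis using card_by_deg[of C] cardC unfolding M_def CH_def by simp
qed

lemma card_S: "card S = card SL + card SH"
  using card_by_deg[OF SV] unfolding SL_def SH_def by simp

text \<open>By \<open>priv_unique\<close> distinct vertices of degree 3 on \<open>C\<close> have
  distinct exchange partners.\<close>

lemma card_M: "card M = card Lx + card Hx"
proof -
  define pr where "pr y = (SOME x. priv x y)" for y
  have pr: "priv (pr y) y" if "y \<in> M" for y
    unfolding pr_def using C_low[of y] that unfolding M_def by (metis (mono_tags, lifting) mem_Collect_eq someI_ex)
  have uniq: "x = x'" if "priv x y" "priv x' y" for x x' y using that unfolding priv_def by simp
  have "inj_on pr M" by (rule inj_onI) (metis pr priv_unique)
  moreover have "pr ` M = Lx \<union> Hx"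
  proof
    show "pr ` M \<subseteq> Lx \<union> Hx"
    proof
      fix x assume "x \<in> pr ` M"
      then obtain y where y: "y \<in> M" "x = pr y" by blast
      then have p: "priv x y" using pr by blast
      obtain i where "y = c i" using y(1) unfolding M_def C_def by blast
      then show "x \<in> Lx \<union> Hx"
        using p privD(1)[OF p] deg34[of x] SV unfolding Lx_def Hx_def by blast
    qed
    show "Lx \<union> Hx \<subseteq> pr ` M"
    proof
      fix x assume "x \<in> Lx \<union> Hx"
      then obtain i where p: "priv x (c i)" unfolding Lx_def Hx_def by blast
      then have m: "c i \<in> M" unfolding M_def C_def using privD(5) by blast
      have "x = pr (c i)" using uniq[OF p pr[OF m]] .
      then show "x \<in> pr ` M" using m by blast
    qed
  qed
  moreover have "Lx \<inter> Hx = {}" unfolding Lx_def Hx_def by auto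
  ultimately show ?thesis using card_image[of pr M] card_Un_disjoint[of Lx Hx] by simp
qed

lemma card_Hx: "card Hx \<le> card SH"
  by (rule card_mono) (auto simp: Hx_def SH_def)

lemma CHF: "h \<in> CH \<Longrightarrow> h \<in> V - S" "h \<in> CH \<Longrightarrow> h \<in> F" "h \<in> CH \<Longrightarrow> deg h = 4" "h \<in> CH \<Longrightarrow> h \<in> C"
  unfolding CH_def using CF F_def by auto

text \<open>By \<open>priv_high\<close> an exchange partner has no neighbour of degree 4 on
  \<open>C\<close>, so \<open>K\<close> and \<open>Lx\<close> are disjoint; both consist of vertices
  of degree 3 by \<open>maxw_high\<close>.\<close>

lemma K_Lx: "card K + card Lx \<le> card SL"
proof -
  have "K \<subseteq> SL"
  proof
    fix x assume "x \<in> K"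
    then obtain h where h: "x \<in> S" "h \<in> CH" "E h x" unfolding K_def by blast
    then have "deg x = 3" using maxw_high(2)[OF S CHF(1)[OF h(2)] CHF(3)[OF h(2)], of x] by simp
    then show "x \<in> SL" using h unfolding SL_def by simp
  qed
  moreover have "Lx \<subseteq> SL" unfolding Lx_def SL_def by blast
  moreover have "K \<inter> Lx = {}"
  proof -
    have False if "x \<in> K" "x \<in> Lx" for x
    proof -
      obtain h where h: "h \<in> CH" "E h x" using \<open>x \<in> K\<close> unfolding K_def by blast
      obtain i where p: "priv x (c i)" using \<open>x \<in> Lx\<close> unfolding Lx_def by blast
      show False using priv_high[OF p CHF(2)[OF h(1)] CHF(3)[OF h(1)] C_high[OF CHF(4)[OF h(1)] CHF(3)[OF h(1)]] h(2)] .
    qed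
    then show ?thesis by blast
  qed
  ultimately show ?thesis using card_mono[of SL "K \<union> Lx"] card_Un_disjoint[of K Lx] by simp
qed

lemma CH_K: "2 * card CH = (\<Sum>x\<in>K. card (nb x \<inter> CH))"
proof -
  have "card (nb h \<inter> K) = 2" if "h \<in> CH" for h
  proof -
    have "nb h \<inter> K = nb h \<inter> S" using that unfolding K_def by auto
    then show ?thesis using C_high[OF CHF(4)[OF that] CHF(3)[OF that]] by simp
  qed
  then have "(\<Sum>h\<in>CH. card (nb h \<inter> K)) = 2 * card CH" by simp
  then show ?thesis using double_count[of CH K] by simp
qed

lemma K_deg: "x \<in> K \<Longrightarrow> deg x = 3"
proof -
  assume "x \<in> K"
  then obtain h where h: "x \<in> S" "h \<in> CH" "E h x" unfolding K_def by blast
  then show "deg x = 3" using maxw_high(2)[OF S CHF(1)[OF h(2)] CHF(3)[OF h(2)], of x] by simp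
qed

lemma CH_K3: "2 * card CH \<le> 3 * card K"
proof -
  have "(\<Sum>x\<in>K. card (nb x \<inter> CH)) \<le> (\<Sum>x\<in>K. 3)"
  proof (rule sum_mono)
    fix x assume "x \<in> K"
    then show "card (nb x \<inter> CH) \<le> 3" using K_deg[of x] card_mono[of "nb x" "nb x \<inter> CH"] unfolding deg_def by simp
  qed
  then show ?thesis using CH_K by simp
qed

lemma CH_K1: assumes "l = 7" shows "2 * card CH \<le> card K"
proof -
  have cyc7: "odd_cycle (V - S - (X - {x0})) 7 c" using cyc assms by simp
  have "(\<Sum>x\<in>K. card (nb x \<inter> CH)) \<le> (\<Sum>x\<in>K. 1)"
  proof (rule sum_mono)
    fix x assume x: "x \<in> K"
    have "a = b" if ab: "a \<in> nb x \<inter> CH" "b \<in> nb x \<inter> CH" for a b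
    proof -
      obtain i j where ij: "a = c i" "b = c j" using ab CHF(4) unfolding C_def by blast
      have "x \<notin> range c" using x CF unfolding K_def C_def F_def by blast
      then show ?thesis using seven_cycle_one_nb[OF cyc7, of x i j] ab ij by simp
    qed
    then show "card (nb x \<inter> CH) \<le> 1" using card_le_Suc0_iff_eq[of "nb x \<inter> CH"] by simp
  qed
  then show ?thesis using CH_K by simp
qed

lemma CH_indep: "2 * card CH < nat l"
proof -
  have "indep CH" unfolding indep_def CH_def using hi by blast
  moreover have "CH \<inter> range c = CH" unfolding CH_def C_def by blast
  ultimately show ?thesis using odd_cycle_indep[OF cyc, of CH] by simp
qed

text \<open>Count edges between the vertices of degree 4 in \<open>F\<close> and \<open>SL\<close>:
  at least two at each of the former, at most three at each of the latter. A vertex of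
  \<open>Lx\<close> spends one of its three on its exchange partner, which has degree 3.\<close>

lemma card_high_F: "2 * (card CH + card YH) + card Lx \<le> 3 * card SL"
proof -
  define HF where "HF = CH \<union> YH"
  have HF: "h \<in> V - S" "deg h = 4" if "h \<in> HF" for h
    using that CHF unfolding HF_def YH_def Y_def F_def by auto
  have finHF: "finite HF" unfolding HF_def by simp
  have "card HF = card CH + card YH"
    unfolding HF_def by (rule card_Un_disjoint) (auto simp: CH_def YH_def Y_def)
  then have "2 * (card CH + card YH) = (\<Sum>h\<in>HF. 2)" by simp
  also have "\<dots> \<le> (\<Sum>h\<in>HF. card (nb h \<inter> SL))"
  proof (rule sum_mono)
    fix h assume h: "h \<in> HF"
    have "nb h \<inter> SL = nb h \<inter> S" using maxw_high(2)[OF S HF[OF h]] unfolding SL_def by auto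
    then show "2 \<le> card (nb h \<inter> SL)" using maxw_high(1)[OF S HF[OF h]] by simp
  qed
  also have "\<dots> = (\<Sum>x\<in>SL. card (nb x \<inter> HF))" by (rule double_count) (use finHF in simp_all)
  finally have 1: "2 * (card CH + card YH) \<le> (\<Sum>x\<in>SL. card (nb x \<inter> HF))" .
  have "(\<Sum>x\<in>SL. card (nb x \<inter> HF) + (if x \<in> Lx then 1 else 0)) \<le> (\<Sum>x\<in>SL. 3)"
  proof (rule sum_mono)
    fix x assume x: "x \<in> SL"
    then have d: "card (nb x) = 3" unfolding SL_def deg_def by simp
    show "card (nb x \<inter> HF) + (if x \<in> Lx then 1 else 0) \<le> 3"
    proof (cases "x \<in> Lx")
      case True
      then obtain i where p: "priv x (c i)" unfolding Lx_def by blast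
      have "c i \<notin> HF" using HF(2)[of "c i"] privD(5)[OF p] by auto
      then have "nb x \<inter> HF \<subseteq> nb x - {c i}" by blast
      then have "card (nb x \<inter> HF) \<le> card (nb x - {c i})" by (intro card_mono) auto
      also have "\<dots> = 2" using privD(2)[OF p] d by simp
      finally show ?thesis by simp
    next
      case False
      then show ?thesis using card_mono[of "nb x" "nb x \<inter> HF"] d by simp
    qed
  qed
  moreover have "(\<Sum>x\<in>SL. (if x \<in> Lx then 1 else 0)) = card Lx"
  proof -
    have "SL \<inter> Lx = Lx" unfolding SL_def Lx_def by blast
    then show ?thesis by (simp add: sum.If_cases Int_def)
  qed
  ultimately show ?thesis using 1 by (simp add: sum.distrib)
qed

lemma two_SL: assumes "card CH + card YH \<noteq> 0" shows "2 \<le> card SL"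
proof -
  have "CH \<union> YH \<noteq> {}" using assms by auto
  then obtain h where "h \<in> CH \<union> YH" by blast
  then have h: "h \<in> V - S" "deg h = 4" using CHF unfolding YH_def Y_def F_def by auto
  have "nb h \<inter> S \<subseteq> SL" using maxw_high(2)[OF S h] unfolding SL_def by auto
  then have "card (nb h \<inter> S) \<le> card SL" by (intro card_mono) simp
  then show ?thesis using maxw_high(1)[OF S h] by simp
qed

lemma sum_deg: assumes "A \<subseteq> V" shows "(\<Sum>y\<in>A. deg y) = 3 * card A + card {y \<in> A. deg y = 4}"
proof -
  have "finite A" using assms fin finite_subset by blast
  have "(\<Sum>y\<in>A. deg y) = (\<Sum>y\<in>A. 3 + (if deg y = 4 then 1 else 0))"
    by (rule sum.cong) (use assms deg34 in auto)
  also have "\<dots> = 3 * card A + card {y \<in> A. deg y = 4}"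
    unfolding sum.distrib using \<open>finite A\<close> by (simp add: sum.If_cases Int_def)
  finally show ?thesis .
qed

lemma nbYF: assumes "y \<in> Y" shows "nb y \<inter> F = nb y \<inter> Y"
proof
  show "nb y \<inter> F \<subseteq> nb y \<inter> Y"
  proof
    fix a assume "a \<in> nb y \<inter> F"
    then have a: "E y a" "a \<in> F" by auto
    have "a \<notin> C" using C_closed[of a y] a Esym[OF a(1)] assms unfolding Y_def by blast
    then show "a \<in> nb y \<inter> Y" using a unfolding Y_def by simp
  qed
qed (auto simp: Y_def)

text \<open>Edges between \<open>S\<close> and \<open>F\<close> counted from both sides:
  \<open>S\<close> is independent, a vertex of \<open>C\<close> has two neighbours in
  \<open>F\<close>, and a vertex of \<open>Y\<close> has all its neighbours in \<open>F\<close>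
  inside \<open>Y\<close>.\<close>

lemma degree_count:
  "(\<Sum>y\<in>Y. card (nb y \<inter> Y)) + 4 * card SH + 3 * card SL = nat l + card CH + 3 * card Y + card YH"
proof -
  have "(\<Sum>x\<in>S. card (nb x \<inter> F)) = (\<Sum>x\<in>S. deg x)"
  proof (rule sum.cong[OF refl])
    fix x assume x: "x \<in> S"
    have "nb x \<inter> F = nb x" using x Sind nb_V unfolding F_def indep_def by auto
    then show "card (nb x \<inter> F) = deg x" unfolding deg_def by simp
  qed
  also have "\<dots> = 4 * card SH + 3 * card SL"
    using sum_deg[OF SV] card_S unfolding SH_def[symmetric] by simp
  finally have 1: "(\<Sum>y\<in>F. card (nb y \<inter> S)) = 4 * card SH + 3 * card SL"
    using double_count[of S F] by simp
  have "(\<Sum>y\<in>F. card (nb y \<inter> S)) = (\<Sum>y\<in>Y. card (nb y \<inter> S)) + (\<Sum>y\<in>C. card (nb y \<inter> S))"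
    unfolding Y_def using sum.subset_diff[OF CF finF] by blast
  moreover have "(\<Sum>y\<in>C. card (nb y \<inter> S)) = nat l + card CH"
  proof -
    have "(\<Sum>y\<in>C. card (nb y \<inter> S)) + 2 * card C = (\<Sum>y\<in>C. card (nb y \<inter> S) + card (nb y \<inter> F))"
      unfolding sum.distrib using C_nbF by simp
    also have "\<dots> = (\<Sum>y\<in>C. deg y)" by (rule sum.cong[OF refl]) (simp add: nb_split[of _ S] F_def)
    also have "\<dots> = 3 * card C + card CH" using sum_deg[of C] CF unfolding CH_def F_def by auto
    finally show ?thesis using cardC by simp
  qed
  moreover have "(\<Sum>y\<in>Y. card (nb y \<inter> S)) + (\<Sum>y\<in>Y. card (nb y \<inter> Y)) = 3 * card Y + card YH"
  proof -
    have "(\<Sum>y\<in>Y. card (nb y \<inter> S)) + (\<Sum>y\<in>Y. card (nb y \<inter> Y)) = (\<Sum>y\<in>Y. deg y)"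
      unfolding sum.distrib[symmetric]
    proof (rule sum.cong[OF refl])
      fix y assume "y \<in> Y"
      then show "card (nb y \<inter> S) + card (nb y \<inter> Y) = deg y"
        using nb_split[of y S] nbYF[of y] unfolding F_def by simp
    qed
    then show ?thesis using sum_deg[OF YV] unfolding YH_def by simp
  qed
  ultimately show ?thesis using 1 by linarith
qed

lemma card_V: "card V = card SH + card SL + nat l + card Y"
proof -
  have "card V = card S + card F"
    using card_Un_disjoint[of S F] SV unfolding F_def by (simp add: Un_absorb1 fin)
  moreover have "card F = card C + card Y" unfolding Y_def using CF
    by (metis card_Diff_subset card_mono finC finF le_add_diff_inverse)
  ultimately show ?thesis using card_S cardC by simp
qed

definition EY where "EY = {{a, b} | a b. a \<in> Y \<and> b \<in> Y \<and> E a b}"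

lemma EY_I: "a \<in> Y \<Longrightarrow> b \<in> Y \<Longrightarrow> E a b \<Longrightarrow> {a, b} \<in> EY"
  unfolding EY_def by blast

lemma EY_E: assumes "e \<in> EY" obtains a b where "e = {a, b}" "a \<in> Y" "b \<in> Y" "E a b"
  using assms unfolding EY_def by blast

lemma finEY [simp]: "finite EY"
proof -
  have "EY \<subseteq> Pow Y" unfolding EY_def by auto
  then show ?thesis using finite_subset by fastforce
qed

lemma handshake: "(\<Sum>y\<in>Y. card (nb y \<inter> Y)) = 2 * card EY"
proof -
  have "card (nb y \<inter> Y) = card {e \<in> EY. y \<in> e}" if y: "y \<in> Y" for y
  proof (rule bij_betw_same_card)
    show "bij_betw (\<lambda>b. {y, b}) (nb y \<inter> Y) {e \<in> EY. y \<in> e}"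
    proof (rule bij_betw_imageI)
      show "inj_on (\<lambda>b. {y, b}) (nb y \<inter> Y)" by (rule inj_onI) (auto simp: doubleton_eq_iff)
      show "(\<lambda>b. {y, b}) ` (nb y \<inter> Y) = {e \<in> EY. y \<in> e}"
      proof
        show "(\<lambda>b. {y, b}) ` (nb y \<inter> Y) \<subseteq> {e \<in> EY. y \<in> e}"
        proof (rule image_subsetI)
          fix b assume "b \<in> nb y \<inter> Y"
          then show "{y, b} \<in> {e \<in> EY. y \<in> e}" using EY_I[OF y, of b] by simp
        qed
        show "{e \<in> EY. y \<in> e} \<subseteq> (\<lambda>b. {y, b}) ` (nb y \<inter> Y)"
        proof
          fix e assume "e \<in> {e \<in> EY. y \<in> e}"
          then have e: "e \<in> EY" "y \<in> e" by simp_all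
          obtain a b where ab: "e = {a, b}" "a \<in> Y" "b \<in> Y" "E a b" using EY_E[OF e(1)] .
          have "y = a \<or> y = b" using e(2) ab(1) by simp
          then show "e \<in> (\<lambda>b. {y, b}) ` (nb y \<inter> Y)"
          proof
            assume "y = a" then have "e = {y, b}" "b \<in> nb y \<inter> Y" using ab by simp_all
            then show ?thesis by (rule image_eqI)
          next
            assume "y = b" then have "e = {y, a}" "a \<in> nb y \<inter> Y" using ab(1,2) Esym[OF ab(4)] by auto
            then show ?thesis by (rule image_eqI)
          qed
        qed
      qed
    qed
  qed
  then have "(\<Sum>y\<in>Y. card (nb y \<inter> Y)) = (\<Sum>y\<in>Y. card {e \<in> EY. y \<in> e})" by simp
  also have "\<dots> = (\<Sum>e\<in>EY. 2)"
  proof (rule sum_multicount_gen)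
    show "\<forall>e\<in>EY. card {y \<in> Y. y \<in> e} = 2"
    proof
      fix e assume "e \<in> EY"
      then obtain a b where ab: "e = {a, b}" "a \<in> Y" "b \<in> Y" "E a b" by (rule EY_E)
      then have "{y \<in> Y. y \<in> e} = {a, b}" "a \<noteq> b" using irr by auto
      then show "card {y \<in> Y. y \<in> e} = 2" by simp
    qed
  qed simp_all
  finally show ?thesis by simp
qed

lemma EY_le_6:
  assumes "card V \<le> 25" shows "card EY \<le> 6"
proof -
  have A: "2 * card EY + 4 * card SH + 3 * card SL = nat l + card CH + 3 * card Y + card YH"
    using degree_count handshake by simp
  have l: "7 \<le> nat l" "odd (nat l)" using l7 by (auto simp: even_nat_iff)
  have "2 * card CH \<le> card K" if "nat l = 7" using CH_K1 that by linarith
  then show ?thesis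
    using edge_bound_arith[OF A card_C card_M card_Hx K_Lx CH_K3 CH_indep card_high_F card_V card_Lx_Y assms l]
      two_SL by blast
qed

end

text \<open>The ends of a path are recovered from its edge set as the vertices on exactly one edge,
  so equal edge sets have equal ends.\<close>

lemma path_ends:
  assumes d: "distinct [a, b, c, d, e, f]"
  shows "{v. \<exists>g\<in>{{a,b},{b,c},{c,d},{d,e},{e,f}}. v \<in> g \<and> (\<forall>h\<in>{{a,b},{b,c},{c,d},{d,e},{e,f}}. v \<in> h \<longrightarrow> h = g)} = {a, f}"
proof -
  define W where "W = {{a,b},{b,c},{c,d},{d,e},{e,f}}"
  define Pr where "Pr v \<longleftrightarrow> (\<exists>g\<in>W. v \<in> g \<and> (\<forall>h\<in>W. v \<in> h \<longrightarrow> h = g))" for v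
  have P: "Pr v \<Longrightarrow> v = a \<or> v = b \<or> v = c \<or> v = d \<or> v = e \<or> v = f" for v
    unfolding Pr_def W_def by auto
  have af: "Pr a" "Pr f" unfolding Pr_def W_def using d by auto
  have no: "\<not> Pr v" if "g \<in> W" "h \<in> W" "v \<in> g" "v \<in> h" "g \<noteq> h" for v g h
    unfolding Pr_def using that by metis
  have "\<not> Pr b" by (rule no[of "{a,b}" "{b,c}"]) (use d in \<open>auto simp: W_def doubleton_eq_iff\<close>)
  moreover have "\<not> Pr c" by (rule no[of "{b,c}" "{c,d}"]) (use d in \<open>auto simp: W_def doubleton_eq_iff\<close>)
  moreover have "\<not> Pr d" by (rule no[of "{c,d}" "{d,e}"]) (use d in \<open>auto simp: W_def doubleton_eq_iff\<close>)
  moreover have "\<not> Pr e" by (rule no[of "{d,e}" "{e,f}"]) (use d in \<open>auto simp: W_def doubleton_eq_iff\<close>)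
  ultimately have "Pr v \<longleftrightarrow> v = a \<or> v = f" for v using P[of v] af by auto
  then have "{v. Pr v} = {a, f}" by auto
  then show ?thesis unfolding Pr_def W_def .
qed

section \<open>Packing the paths into six edges\<close>

context catlin
begin

text \<open>A second transversal vertex lies on an odd cycle of its own, which is disjoint from the
  component \<open>C\<close> and so contributes at least 7 edges to \<open>EY\<close>.\<close>

lemma X_single: assumes "card EY \<le> 6" shows "X = {x0}"
proof (rule ccontr)
  assume "X \<noteq> {x0}"
  then obtain x1 where x1: "x1 \<in> X" "x1 \<noteq> x0" using x0 by blast
  have finX: "finite X" using X fin finite_subset by blast
  have "\<not> bip (V - S - (X - {x1}))"
  proof
    assume "bip (V - S - (X - {x1}))"
    then have "card X \<le> card (X - {x1})" using Xmin[OF S, of "X - {x1}"] X by blast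
    then show False using x1(1) finX by (metis card_Diff1_less not_le)
  qed
  then obtain k d where d: "odd_cycle (V - S - (X - {x1})) k d" by (rule shortest_odd_cycle)
  have "x1 \<in> range d"
  proof (rule ccontr)
    assume "x1 \<notin> range d"
    then have "range d \<subseteq> V - S - X" using odd_cycle_range(4)[OF d] by blast
    then show False using odd_cycle_not_bip[OF d] bX bip_subset by blast
  qed
  have x1C: "x1 \<notin> C" using odd_cycle_range(4)[OF cyc] x1 unfolding C_def by blast
  have dC: "d j \<notin> C" for j
  proof
    assume "d j \<in> C"
    then obtain i where "d j = c i" unfolding C_def by blast
    then have "range d \<subseteq> range c" by (rule cycles_meet[OF S d _ cyc, rotated 2]) auto
    then show False using \<open>x1 \<in> range d\<close> x1C unfolding C_def by blast
  qed
  have dF: "d j \<in> F" for j using odd_cycleD(3)[OF d, of j] unfolding F_def by simp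
  have dY: "d j \<in> Y" for j using dC dF unfolding Y_def by simp
  have two: "card (nb y \<inter> Y) = 2" if y: "y \<in> range d" for y
  proof -
    obtain j where j: "y = d j" using y by blast
    have "nb (d j) \<inter> F = {d (j + 1), d (j - 1)}" unfolding F_def by (rule cycle_closed[OF S d]) auto
    moreover have "d (j + 1) \<noteq> d (j - 1)"
      using odd_cycle_neq[OF d, of 2 "j - 1"] odd_cycleD(2)[OF d] by (simp add: algebra_simps)
    ultimately show ?thesis using nbYF[OF dY[of j]] j by simp
  qed
  have "2 * nat k = (\<Sum>y\<in>range d. card (nb y \<inter> Y))" using two odd_cycle_range(2)[OF d] by simp
  also have "\<dots> \<le> (\<Sum>y\<in>Y. card (nb y \<inter> Y))" by (rule sum_mono2) (use dY in auto)
  finally have "nat k \<le> 6" using handshake assms by simp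
  then show False using odd_cycleD(2)[OF d] by simp
qed

text \<open>Now \<open>X - {x0}\<close> is empty, so a bipartite complement after the exchange would
  be a 3-colouring outright; no maximality of the new set is needed, and \<open>x\<close> may have
  degree 4.\<close>

lemma path_5_edges:
  assumes e6: "card EY \<le> 6" and p: "priv x (c i)"
  shows "\<exists>d::int \<Rightarrow> 'a. E x (d 1) \<and> E x (d 6) \<and> (\<forall>j\<in>{1..5}. E (d j) (d (j + 1))) \<and>
    distinct [d 1, d 2, d 3, d 4, d 5, d 6] \<and> (\<forall>j\<in>{1..6}. d j \<in> Y)"
proof -
  have X0: "X - {x0} = {}" using X_single[OF e6] by simp
  have "\<not> bip (insert x (F - (X - {x0}) - {c i}))"
  proof
    assume "bip (insert x (F - (X - {x0}) - {c i}))"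
    then have "bip (V - insert (c i) (S - {x}))" unfolding swap_indep(3)[OF p] X0 by simp
    then have col3 unfolding col3_def using swap_indep(1,2)[OF p] by blast
    then show False using nc by blast
  qed
  then obtain k d where d: "odd_cycle (insert x (F - (X - {x0}) - {c i})) k d" and d0: "d 0 = x"
    and dY: "\<And>j. 0 < j \<Longrightarrow> j < k \<Longrightarrow> d j \<in> Y" using swap_cycle[OF p] by blast
  have k: "7 \<le> k" "odd k" using odd_cycleD[OF d] by auto
  have inj: "d a \<noteq> d b" if "0 \<le> a" "a < b" "b < k" for a b
    using odd_cycle_neq[OF d, of "b - a" a] that by simp
  have dn: "E (d j) (d (j + 1))" for j using odd_cycleD(4)[OF d] .
  \<comment> \<open>The path from \<open>d 1\<close> to \<open>d (k - 1)\<close> has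
    \<open>k - 2\<close> edges in \<open>EY\<close>, hence at most 6; as \<open>k\<close> is odd and
    at least 7, \<open>k = 7\<close>.\<close>
  have "inj_on (\<lambda>j. {d j, d (j + 1)}) {1..k-2}"
  proof (rule linorder_inj_onI)
    fix a b assume ab: "a < b" "a \<in> {1..k-2}" "b \<in> {1..k-2}"
    then have "d a \<noteq> d b" "d a \<noteq> d (b + 1)" using inj[of a b] inj[of a "b + 1"] by auto
    then show "{d a, d (a + 1)} \<noteq> {d b, d (b + 1)}" by (auto simp: doubleton_eq_iff)
  qed auto
  then have "card ((\<lambda>j. {d j, d (j + 1)}) ` {1..k-2}) = nat (k - 2)" by (simp add: card_image)
  moreover have "(\<lambda>j. {d j, d (j + 1)}) ` {1..k-2} \<subseteq> EY"
  proof (rule image_subsetI)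
    fix j assume "j \<in> {1..k-2}"
    then show "{d j, d (j + 1)} \<in> EY" using EY_I[OF dY dY dn, of j] by simp
  qed
  ultimately have "nat (k - 2) \<le> 6" using card_mono[OF finEY] e6 by (metis order_trans)
  then have "k \<le> 8" by linarith
  then have k7: "k = 7" using k by presburger
  have "d 7 = x" using odd_cycleD(6)[OF d, of 0] d0 k7 by simp
  then have "E x (d 6)" using dn[of 6] Esym by simp
  moreover have "E x (d 1)" using dn[of 0] d0 by simp
  moreover have "distinct [d 1, d 2, d 3, d 4, d 5, d 6]" using odd_cycleD(5)[OF d] k7 by simp
  ultimately show ?thesis using dn dY k7 by (intro exI[of _ d]) auto
qed

text \<open>At least four paths with distinct edge sets lie in a set of at most six edges, so each
  other path differs from that of \<open>x\<close> by one edge. Three such differences cannot all be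
  end edges, and replacing an inner edge would require an edge between the two ends, which with
  \<open>x\<close> is a triangle.\<close>

lemma too_many_paths:
  assumes e6: "card EY \<le> 6" shows False
proof -
  define R where "R = Lx \<union> Hx"
  have finR: "finite R" unfolding R_def by simp
  have "card R = card M"
    unfolding R_def card_M by (rule card_Un_disjoint) (auto simp: Lx_def Hx_def)
  then have R4: "4 \<le> card R" using card_C CH_indep l7 by linarith
  have "\<forall>x\<in>R. \<exists>d::int \<Rightarrow> 'a. E x (d 1) \<and> E x (d 6) \<and> (\<forall>j\<in>{1..5}. E (d j) (d (j + 1))) \<and>
    distinct [d 1, d 2, d 3, d 4, d 5, d 6] \<and> (\<forall>j\<in>{1..6}. d j \<in> Y)"
    using path_5_edges[OF e6] unfolding R_def Lx_def Hx_def by blast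
  then obtain D where D0: "\<forall>x\<in>R. E x (D x (1::int)) \<and> E x (D x 6) \<and> (\<forall>j\<in>{1..5}. E (D x j) (D x (j + 1))) \<and>
    distinct [D x 1, D x 2, D x 3, D x 4, D x 5, D x 6] \<and> (\<forall>j\<in>{1..6}. D x j \<in> Y)" by metis
  have D: "E x (D x 1)" "E x (D x 6)" "distinct [D x 1, D x 2, D x 3, D x 4, D x 5, D x 6]" if "x \<in> R" for x
    using bspec[OF D0 that] by auto
  have DY: "D x j \<in> Y" if "x \<in> R" "j \<in> {1..6}" for x j using bspec[OF D0 that(1)] that(2) by blast
  have DE: "E (D x j) (D x (j + 1))" if "x \<in> R" "j \<in> {1..5}" for x j using bspec[OF D0 that(1)] that(2) by blast
  have DE': "E (D x 1) (D x 2)" "E (D x 2) (D x 3)" "E (D x 3) (D x 4)" "E (D x 4) (D x 5)" "E (D x 5) (D x 6)"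
    if "x \<in> R" for x
    using DE[OF that, of 1] DE[OF that, of 2] DE[OF that, of 3] DE[OF that, of 4] DE[OF that, of 5] by simp_all
  define Ed where "Ed x = {{D x 1, D x 2}, {D x 2, D x 3}, {D x 3, D x 4}, {D x 4, D x 5}, {D x 5, D x 6}}" for x
  have EdEY: "Ed x \<subseteq> EY" if "x \<in> R" for x
    unfolding Ed_def using EY_I DY[OF that] DE'[OF that] by simp
  have Ed5: "card (Ed x) = 5" if "x \<in> R" for x
    unfolding Ed_def using D(3)[OF that] by (simp add: doubleton_eq_iff)
  have finEd: "finite (Ed x)" for x unfolding Ed_def by simp
  have Ed_inj: "x = y" if "x \<in> R" "y \<in> R" "Ed x = Ed y" for x y
  proof (rule ccontr)
    assume ne: "x \<noteq> y"
    have "{D x 1, D x 6} = {D y 1, D y 6}"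
      using path_ends[OF D(3)[OF that(1)]] path_ends[OF D(3)[OF that(2)]] that(3) unfolding Ed_def by simp
    then have "E y (D x 1)" "E y (D x 6)" using D(1,2)[OF that(2)] by (metis insertCI insertE singletonD)+
    moreover have "D x 1 \<noteq> D x 6" using D(3)[OF that(1)] by simp
    ultimately show False using no4[OF D(1)[OF that(1)] _ _ Esym[OF D(2)[OF that(1)]], of y] ne Esym by blast
  qed
  have Ed_sub: "\<not> Ed x \<subseteq> Ed y" if "x \<in> R" "y \<in> R" "x \<noteq> y" for x y
    using Ed_inj[OF that(1,2)] that(3) Ed5[OF that(1)] Ed5[OF that(2)] card_subset_eq[OF finEd] by metis
  obtain x where x: "x \<in> R" using R4 by fastforce
  have "\<exists>g. g \<in> Ed x \<and> g \<notin> Ed y" if "y \<in> R - {x}" for y using Ed_sub[OF x, of y] that by blast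
  then obtain g where g: "\<And>y. y \<in> R - {x} \<Longrightarrow> g y \<in> Ed x \<and> g y \<notin> Ed y" by metis
  \<comment> \<open>\<open>Ed y\<close> has five of at most six edges and misses \<open>g y\<close>,
    so it misses nothing else.\<close>
  have Edy: "Ed y = EY - {g y}" if y: "y \<in> R - {x}" for y
  proof (rule card_subset_eq)
    have gE: "g y \<in> EY" using g[OF y] EdEY[OF x] by blast
    show "Ed y \<subseteq> EY - {g y}" using EdEY[of y] g[OF y] y by blast
    then have "card (Ed y) \<le> card (EY - {g y})" by (intro card_mono) simp_all
    then show "card (Ed y) = card (EY - {g y})" using Ed5[of y] y e6 gE by simp
  qed simp
  have g_inj: "inj_on g (R - {x})"
  proof (rule inj_onI)
    fix y z assume yz: "y \<in> R - {x}" "z \<in> R - {x}" "g y = g z"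
    then have "Ed y = Ed z" using Edy[of y] Edy[of z] by simp
    then show "y = z" using Ed_inj[of y z] yz by simp
  qed
  define a b p q e f where "a = D x 1" "b = D x 2" "p = D x 3" "q = D x 4" "e = D x 5" "f = D x 6"
  note names = a_b_p_q_e_f_def
  have dist: "distinct [a, b, p, q, e, f]" using D(3)[OF x] unfolding names by simp
  have Edx: "Ed x = {{a, b}, {b, p}, {p, q}, {q, e}, {e, f}}" unfolding Ed_def names by simp
  have "\<not> g ` (R - {x}) \<subseteq> {{a, b}, {e, f}}"
  proof
    assume "g ` (R - {x}) \<subseteq> {{a, b}, {e, f}}"
    then have "card (g ` (R - {x})) \<le> card {{a, b}, {e, f}}" by (intro card_mono) simp_all
    also have "\<dots> \<le> 2" by (simp add: card_insert_if)
    finally have "card (R - {x}) \<le> 2" using card_image[OF g_inj] by simp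
    then show False using R4 x finR by simp
  qed
  then obtain y where y: "y \<in> R - {x}" "g y \<noteq> {a, b}" "g y \<noteq> {e, f}" by blast
  \<comment> \<open>Without one inner edge the path of \<open>x\<close> still covers all its six
    vertices, so both paths have the same vertex set.\<close>
  have sub: "Ed x - {g y} \<subseteq> Ed y" using EdEY[OF x] Edy[OF y(1)] by blast
  have ne: "{b, p} \<noteq> {p, q}" "{p, q} \<noteq> {q, e}" using dist by (auto simp: doubleton_eq_iff)
  have U: "v \<in> \<Union> (Ed x - {g y})" if "v \<in> h" "h \<in> Ed x" "h \<noteq> g y" for v h using that by blast
  have mem: "{a, b} \<in> Ed x" "{b, p} \<in> Ed x" "{p, q} \<in> Ed x" "{q, e} \<in> Ed x" "{e, f} \<in> Ed x"
    unfolding Edx by simp_all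
  have "a \<in> \<Union> (Ed x - {g y})" "b \<in> \<Union> (Ed x - {g y})" using U[OF _ mem(1)] y(2) by auto
  moreover have "e \<in> \<Union> (Ed x - {g y})" "f \<in> \<Union> (Ed x - {g y})" using U[OF _ mem(5)] y(3) by auto
  moreover have "p \<in> \<Union> (Ed x - {g y})"
    using U[OF _ mem(2), of p] U[OF _ mem(3), of p] ne(1) by (cases "g y = {b, p}") auto
  moreover have "q \<in> \<Union> (Ed x - {g y})"
    using U[OF _ mem(3), of q] U[OF _ mem(4), of q] ne(2) by (cases "g y = {p, q}") auto
  ultimately have "{a, b, p, q, e, f} \<subseteq> \<Union> (Ed x - {g y})" by simp
  also have "\<dots> \<subseteq> \<Union> (Ed y)" using sub by blast
  also have "\<Union> (Ed y) = {D y 1, D y 2, D y 3, D y 4, D y 5, D y 6}" unfolding Ed_def by auto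
  finally have "{a, b, p, q, e, f} \<subseteq> {D y 1, D y 2, D y 3, D y 4, D y 5, D y 6}" .
  moreover have "card {a, b, p, q, e, f} = 6" using dist by simp
  moreover have "card {D y 1, D y 2, D y 3, D y 4, D y 5, D y 6} = 6" using D(3)[of y] y(1) by simp
  ultimately have "{a, b, p, q, e, f} = {D y 1, D y 2, D y 3, D y 4, D y 5, D y 6}"
    by (intro card_subset_eq) simp_all
  then have Uy: "\<Union> (Ed y) = {a, b, p, q, e, f}" unfolding Ed_def by auto
  \<comment> \<open>The edge \<open>m\<close> is not on the path of \<open>x\<close>. Inner vertices
    of that path already have their two neighbours in \<open>Y\<close>, so \<open>m\<close> joins
    \<open>a\<close> and \<open>f\<close>.\<close>
  obtain m where m: "m \<in> Ed y" "m \<notin> Ed x" using Ed_sub[of y x] x y(1) by blast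
  have "m \<in> EY" using m(1) EdEY[of y] y(1) by blast
  then obtain s t where st: "m = {s, t}" "s \<in> Y" "t \<in> Y" "E s t" by (rule EY_E)
  have stU: "s \<in> {a, b, p, q, e, f}" "t \<in> {a, b, p, q, e, f}" using m(1) st(1) Uy by blast+
  have only: "nb z \<inter> Y = {u, w}" if "z \<in> Y" "u \<in> Y" "w \<in> Y" "E u z" "E z w" "u \<noteq> w" for u z w
  proof -
    have "card (nb z \<inter> Y) \<le> 2"
      using maxw_deg2[OF S, of z] nbYF[OF that(1)] that(1) unfolding Y_def F_def by simp
    moreover have "{u, w} \<subseteq> nb z \<inter> Y" using that Esym[OF that(4)] by simp
    moreover have "card {u, w} = 2" using that(6) by simp
    ultimately show ?thesis by (metis card_seteq fin_nb finite_Int)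
  qed
  have aY: "a \<in> Y" "b \<in> Y" "p \<in> Y" "q \<in> Y" "e \<in> Y" "f \<in> Y" using DY[OF x] unfolding names by simp_all
  have ed: "E a b" "E b p" "E p q" "E q e" "E e f" using DE'[OF x] unfolding names by simp_all
  have nbs: "nb b \<inter> Y = {a, p}" "nb p \<inter> Y = {b, q}" "nb q \<inter> Y = {p, e}" "nb e \<inter> Y = {q, f}"
    by (rule only; use aY ed dist in simp)+
  have inner: "{z, w} \<in> Ed x" if zw: "E z w" "w \<in> Y" "z \<in> {b, p, q, e}" for z w
  proof -
    have w: "w \<in> nb z \<inter> Y" using zw by simp
    from zw(3) consider "z = b" | "z = p" | "z = q" | "z = e" by blast
    then show ?thesis
    proof cases
      case 1 then have "w = a \<or> w = p" using w nbs(1) by simp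
      then show ?thesis using 1 unfolding Edx by (auto simp: insert_commute)
    next
      case 2 then have "w = b \<or> w = q" using w nbs(2) by simp
      then show ?thesis using 2 unfolding Edx by (auto simp: insert_commute)
    next
      case 3 then have "w = p \<or> w = e" using w nbs(3) by simp
      then show ?thesis using 3 unfolding Edx by (auto simp: insert_commute)
    next
      case 4 then have "w = q \<or> w = f" using w nbs(4) by simp
      then show ?thesis using 4 unfolding Edx by (auto simp: insert_commute)
    qed
  qed
  have "s \<notin> {b, p, q, e}" using inner[of s t] st m(2) by blast
  moreover have "t \<notin> {b, p, q, e}" using inner[of t s] st m(2) Esym[OF st(4)] by (metis insert_commute)
  ultimately have "s \<in> {a, f}" "t \<in> {a, f}" using stU by auto
  then have "E a f" using st(4) irr Esym by auto
  then show False using no3[of x a f] D(1,2)[OF x] Esym unfolding names by blast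
qed

lemma card_V_gt_25: "25 < card V"
  using too_many_paths EY_le_6 by fastforce

end

context sub4
begin

lemma catlin_exists: "\<exists>S X x0 l c. catlin V E S X x0 l c"
proof -
  define I where "I = {T. T \<subseteq> V \<and> indep T}"
  have finI: "finite I" unfolding I_def using fin by simp
  have "{} \<in> I" unfolding I_def indep_def by simp
  then have "Max (wt ` I) \<in> wt ` I" using finI by (intro Max_in) auto
  then obtain S1 where S1: "S1 \<in> I" "wt S1 = Max (wt ` I)" by auto
  have "wt T \<le> wt S1" if "T \<in> I" for T unfolding S1(2) using that finI by simp
  then have "maxw S1" using S1(1) unfolding maxw_def I_def by simp
  define P where "P n \<longleftrightarrow> (\<exists>S X. maxw S \<and> X \<subseteq> V - S \<and> bip (V - S - X) \<and> card X = n)" for n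
  \<comment> \<open>Deleting the whole complement is a trivial transversal, so a least size
    exists.\<close>
  have "P (card (V - S1))"
    unfolding P_def using \<open>maxw S1\<close> by (intro exI[of _ S1] exI[of _ "V - S1"]) (simp add: bip_def)
  then have "P (LEAST n. P n)" by (rule LeastI)
  then obtain S X where SX: "maxw S" "X \<subseteq> V - S" "bip (V - S - X)" "card X = (LEAST n. P n)"
    unfolding P_def by blast
  have min: "card X \<le> card X'" if "maxw S'" "X' \<subseteq> V - S'" "bip (V - S' - X')" for S' X'
    unfolding SX(4) by (rule Least_le) (use that in \<open>auto simp: P_def\<close>)
  have "X \<noteq> {}"
  proof
    assume "X = {}"
    then have col3 using SX unfolding col3_def maxw_def by auto
    then show False using nc by blast
  qed
  then obtain x0 where x0: "x0 \<in> X" by blast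
  have "finite X" using SX(2) fin finite_subset by blast
  have "\<not> bip (V - S - (X - {x0}))"
  proof
    assume "bip (V - S - (X - {x0}))"
    then have "card X \<le> card (X - {x0})" using min[OF SX(1), of "X - {x0}"] SX(2) by blast
    then show False using x0 \<open>finite X\<close> by (metis card_Diff1_less not_le)
  qed
  then obtain l c where c: "odd_cycle (V - S - (X - {x0})) l c" by (rule shortest_odd_cycle)
  have "catlin V E S X x0 l c"
    by unfold_locales (use SX(1,2,3) min x0 c in auto)
  then show ?thesis by blast
qed

lemma card_V_gt_25: "25 < card V"
proof -
  obtain S X x0 l c where "catlin V E S X x0 l c" using catlin_exists by blast
  then show ?thesis by (rule catlin.card_V_gt_25)
qed

text \<open>The length of \<open>C\<close> is \<open>card Lx + card Hx + card CH\<close>, and the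
  last two count disjoint sets of vertices of degree 4. So \<open>card Lx\<close> is at least 3, and
  their paths take at least 18 vertices of \<open>Y\<close>.\<close>

lemma card_V_few_high:
  assumes "card {x \<in> V. deg x = 4} \<le> 4" shows "29 < card V"
proof -
  obtain S X x0 l c where "catlin V E S X x0 l c" using catlin_exists by blast
  then interpret catlin V E S X x0 l c .
  have "Hx \<inter> CH = {}" using CHF(1) unfolding Hx_def by blast
  then have "card Hx + card CH = card (Hx \<union> CH)" by (simp add: card_Un_disjoint)
  also have "\<dots> \<le> card {x \<in> V. deg x = 4}"
    by (rule card_mono) (use fin SV CHF(1,3) in \<open>auto simp: Hx_def\<close>)
  finally have h: "card Hx + card CH \<le> 4" using assms by simp
  have "7 \<le> nat l" using l7 by simp
  moreover have "nat l = card Lx + card Hx + card CH" using card_C card_M by simp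
  ultimately show ?thesis using h card_V card_Lx_Y K_Lx CH_K3 card_Hx by linarith
qed

end

lemma (in crit) card_gt_25: "25 < card V"
proof (rule ccontr)
  assume "\<not> 25 < card V"
  then interpret crit25 V E by unfold_locales simp
  interpret sub4 V E by unfold_locales (use deg_le_4 highs_indep in auto)
  show False using card_V_gt_25 n25 by simp
qed

section \<open>Girth at least 7\<close>

locale crit29 = crit +
  assumes no6: "E a b \<Longrightarrow> E b c \<Longrightarrow> E c d \<Longrightarrow> E d e \<Longrightarrow> E e f \<Longrightarrow> E f a \<Longrightarrow> distinct [a, b, c, d, e, f] \<Longrightarrow> False"
    and n29: "card V \<le> 29"
begin

text \<open>Two parents of \<open>r\<close> would close a 4-cycle if they share their own parent,
  and a 6-cycle through \<open>v\<close> otherwise.\<close>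

lemma far_unique_parent:
  assumes "a \<in> N2 v" "a' \<in> N2 v" "r \<in> far v" "E a r" "E a' r"
  shows "a = a'"
proof (rule ccontr)
  assume ne: "a \<noteq> a'"
  obtain u where u: "a \<noteq> v" "E v u" "E u a" using assms(1) unfolding N2_def by blast
  obtain u' where u': "a' \<noteq> v" "E v u'" "E u' a'" using assms(2) unfolding N2_def by blast
  have r: "r \<noteq> v" "\<not> E v r" "r \<notin> N2 v" using assms(3) unfolding far_def by auto
  have a: "\<not> E v a" "\<not> E v a'" using N2_not_nb assms by blast+
  show False
  proof (cases "u = u'")
    case True
    then have "u = r" using no4[of u a r a'] u u' assms ne Esym by blast
    then show False using r u by blast
  next
    case False
    then show False using no6[OF u(2,3) assms(4) Esym[OF assms(5)] Esym[OF u'(3)] Esym[OF u'(2)]]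
        u u' r a assms ne irr by auto
  qed
qed

lemma far_ge: "(\<Sum>a\<in>N2 v. deg a - 1) \<le> card (far v)"
proof -
  have "(\<Sum>a\<in>N2 v. deg a - 1) \<le> (\<Sum>a\<in>N2 v. card (nb a \<inter> far v))"
  proof (rule sum_mono)
    fix a assume "a \<in> N2 v"
    then show "deg a - 1 \<le> card (nb a \<inter> far v)" using card_N2_nb_far[of a v] by simp
  qed
  also have "\<dots> = card (\<Union>a\<in>N2 v. nb a \<inter> far v)"
  proof (rule card_UN_disjoint[symmetric])
    show "\<forall>i\<in>N2 v. \<forall>j\<in>N2 v. i \<noteq> j \<longrightarrow> (nb i \<inter> far v) \<inter> (nb j \<inter> far v) = {}"
      using far_unique_parent by auto
  qed auto
  also have "\<dots> \<le> card (far v)" by (rule card_mono) auto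
  finally show ?thesis .
qed

text \<open>Up to distance 3 the ball around \<open>v\<close> is a tree, whose levels at least
  double after the first. For degree 4 the first two terms already make 29, so nothing is left for
  further vertices of degree 4 within distance 2.\<close>

lemma ball_count:
  assumes "v \<in> V"
  shows "1 + 7 * deg v + 3 * card {u \<in> nb v. 4 \<le> deg u} + card {a \<in> N2 v. 4 \<le> deg a} \<le> card V"
proof -
  have two: "2 * card A + card {x \<in> A. 4 \<le> deg x} \<le> (\<Sum>x\<in>A. deg x - 1)" if A: "A \<subseteq> V" for A
  proof -
    have "finite A" using A fin finite_subset by blast
    then have "2 * card A + card {x \<in> A. 4 \<le> deg x} = (\<Sum>x\<in>A. 2 + (if 4 \<le> deg x then 1 else 0))"
      unfolding sum.distrib by (simp add: sum.If_cases Int_def)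
    also have "\<dots> \<le> (\<Sum>x\<in>A. deg x - 1)"
    proof (rule sum_mono)
      fix x assume "x \<in> A"
      then have "3 \<le> deg x" using deg3 A by blast
      then show "2 + (if 4 \<le> deg x then 1 else 0) \<le> deg x - 1" by auto
    qed
    finally show ?thesis .
  qed
  have "2 * deg v + card {u \<in> nb v. 4 \<le> deg u} \<le> card (N2 v)"
    using two[OF nb_V[of v]] card_N2[of v] unfolding deg_def[of v] by simp
  moreover have "2 * card (N2 v) + card {a \<in> N2 v. 4 \<le> deg a} \<le> card (far v)"
    using two[OF N2_V] far_ge[of v] by (rule order_trans)
  ultimately show ?thesis using card_V_far[OF assms] by linarith
qed

lemma deg_le_4': "deg v \<le> 4"
proof (cases "v \<in> V")
  case True then show ?thesis using ball_count[OF True] n29 by linarith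
next
  case False
  then have "nb v = {}" using inV by auto
  then show ?thesis unfolding deg_def by simp
qed

lemma high_isolated:
  assumes v: "v \<in> V" "deg v = 4" and w: "deg w = 4" "w \<noteq> v"
  shows "w \<notin> nb v" "w \<notin> N2 v"
proof -
  have z: "card {u \<in> nb v. 4 \<le> deg u} = 0" "card {a \<in> N2 v. 4 \<le> deg a} = 0"
    using ball_count[OF v(1)] v(2) n29 by linarith+
  have fin2: "finite {x \<in> A. 4 \<le> deg x}" if "finite A" for A using that by simp
  have "{u \<in> nb v. 4 \<le> deg u} = {}" "{a \<in> N2 v. 4 \<le> deg a} = {}"
    using z card_0_eq[OF fin2[OF fin_nb]] card_0_eq[OF fin2[OF finite_N2]] by (simp_all only:)
  then show "w \<notin> nb v" "w \<notin> N2 v" using w(1) by auto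
qed

text \<open>Closed neighbourhoods of vertices of degree 4 are disjoint, so there are at most five of
  them, and five would leave at most four vertices \<open>B\<close>. Counting \<open>N2 v\<close>
  puts all of \<open>B\<close> at distance 2 from each of the five; a vertex of \<open>B\<close>
  would then need five distinct neighbours.\<close>

lemma few_high: "card {x \<in> V. deg x = 4} \<le> 4"
proof (rule ccontr)
  define H where "H = {x \<in> V. deg x = 4}"
  have HV: "H \<subseteq> V" and Hd: "\<And>x. x \<in> H \<Longrightarrow> deg x = 4" unfolding H_def by auto
  have finH: "finite H" using HV fin finite_subset by blast
  have sep: "w \<notin> nb v" "w \<notin> N2 v" if "v \<in> H" "w \<in> H" "w \<noteq> v" for v w
    using high_isolated[of v w] that HV Hd by blast+
  assume "\<not> card {x \<in> V. deg x = 4} \<le> 4"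
  then have h5: "5 \<le> card H" unfolding H_def by simp
  define U where "U = (\<Union>w\<in>H. insert w (nb w))"
  have nbh: "card (insert w (nb w)) = 5" if "w \<in> H" for w
    using Hd[OF that] irr[of w] unfolding deg_def by simp
  have cU: "card U = (\<Sum>w\<in>H. card (insert w (nb w)))" unfolding U_def
  proof (rule card_UN_disjoint)
    show "\<forall>v\<in>H. \<forall>w\<in>H. v \<noteq> w \<longrightarrow> insert v (nb v) \<inter> insert w (nb w) = {}"
    proof (intro ballI impI)
      fix v w assume vw: "v \<in> H" "w \<in> H" "v \<noteq> w"
      have "\<not> E v w" "\<not> E w v" using sep[of v w] sep[of w v] vw by auto
      moreover have "\<not> (E v z \<and> E w z)" for z
      proof
        assume "E v z \<and> E w z"
        then have "w \<in> N2 v" unfolding N2_def using vw(3) Esym by blast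
        then show False using sep[of v w] vw by blast
      qed
      ultimately show "insert v (nb v) \<inter> insert w (nb w) = {}" using vw(3) by auto
    qed
  qed (use finH in auto)
  then have cU5: "card U = 5 * card H" using nbh by simp
  have UV: "U \<subseteq> V" unfolding U_def using HV nb_V by blast
  then have "card U \<le> card V" using fin by (rule card_mono[rotated])
  then have H5: "card H = 5" using cU5 h5 n29 by linarith
  define B where "B = V - U"
  have cB: "card B \<le> 4" unfolding B_def using cU5 H5 n29 UV fin by (simp add: card_Diff_subset finite_subset)
  have H_ne: "H \<noteq> {}" using H5 by auto
  have BN: "B \<subseteq> N2 v" and B4: "card B = 4" if v: "v \<in> H" for v
  proof -
    have "8 \<le> card (N2 v)"
    proof -
      have "2 * deg v \<le> (\<Sum>u\<in>nb v. deg u - 1)"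
      proof -
        have "(\<Sum>u\<in>nb v. 2) \<le> (\<Sum>u\<in>nb v. deg u - 1)"
        proof (rule sum_mono)
          fix u assume "u \<in> nb v"
          then have "3 \<le> deg u" using deg3 nb_V by blast
          then show "2 \<le> deg u - 1" by simp
        qed
        then show ?thesis unfolding deg_def[of v] by simp
      qed
      then show ?thesis using card_N2[of v] Hd[OF v] by simp
    qed
    \<comment> \<open>\<open>w\<close> is far from \<open>v\<close>, and a far vertex has at most
      one neighbour in \<open>N2 v\<close>.\<close>
    have one: "card (nb w \<inter> N2 v) \<le> 1" if w: "w \<in> H - {v}" for w
    proof -
      have "w \<in> far v" using sep[of v w] w v HV unfolding far_def by auto
      then have "a = a'" if "a \<in> nb w \<inter> N2 v" "a' \<in> nb w \<inter> N2 v" for a a'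
        using far_unique_parent[of a v a' w] that Esym by auto
      then show ?thesis using card_le_Suc0_iff_eq[of "nb w \<inter> N2 v"] by simp
    qed
    have "N2 v - B \<subseteq> (\<Union>w\<in>H - {v}. nb w \<inter> N2 v)"
    proof
      fix a assume a: "a \<in> N2 v - B"
      then have "a \<in> U" using N2_V unfolding B_def by blast
      then obtain w where w: "w \<in> H" "a = w \<or> E w a" unfolding U_def by auto
      have "a \<noteq> v" using a unfolding N2_def by blast
      have "a \<noteq> w" using sep(2)[of v w] w(1) v a \<open>a \<noteq> v\<close> by blast
      then have "E w a" using w by blast
      moreover have "w \<noteq> v" using N2_not_nb[of a v] a calculation by blast
      ultimately show "a \<in> (\<Union>w\<in>H - {v}. nb w \<inter> N2 v)" using w(1) a by auto
    qed
    then have "card (N2 v - B) \<le> card (\<Union>w\<in>H - {v}. nb w \<inter> N2 v)"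
      by (intro card_mono) (use finH in auto)
    also have "\<dots> \<le> (\<Sum>w\<in>H - {v}. card (nb w \<inter> N2 v))" by (rule card_UN_le) (use finH in simp)
    also have "\<dots> \<le> (\<Sum>w\<in>H - {v}. 1)" by (rule sum_mono) (use one in blast)
    also have "\<dots> = 4" using H5 v finH by simp
    finally have "card (N2 v - B) \<le> 4" .
    moreover have "card (N2 v) = card (N2 v \<inter> B) + card (N2 v - B)"
      by (metis Int_Diff_Un Int_Diff_disjoint card_Un_disjoint finite_Diff finite_Int finite_N2)
    ultimately have "4 \<le> card (N2 v \<inter> B)" using \<open>8 \<le> card (N2 v)\<close> by linarith
    moreover have finB: "finite B" unfolding B_def using fin by simp
    moreover have "card (N2 v \<inter> B) \<le> card B" using finB by (intro card_mono) auto
    ultimately have "card (N2 v \<inter> B) = card B" "card B = 4" using cB by linarith+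
    then show "B \<subseteq> N2 v" "card B = 4" using card_subset_eq[of B "N2 v \<inter> B"] finB by auto
  qed
  obtain v0 where v0: "v0 \<in> H" using H_ne by blast
  then have "B \<noteq> {}" using B4[OF v0] by auto
  then obtain z where z: "z \<in> B" by blast
  have "\<exists>u. E v u \<and> E u z" if "v \<in> H" for v using BN[OF that] z unfolding N2_def by blast
  then obtain g where g: "\<And>v. v \<in> H \<Longrightarrow> E v (g v) \<and> E (g v) z" by metis
  have "inj_on g H"
  proof (rule inj_onI)
    fix v w assume vw: "v \<in> H" "w \<in> H" "g v = g w"
    show "v = w"
    proof (rule ccontr)
      assume "v \<noteq> w"
      then have "w \<in> N2 v" unfolding N2_def using g[OF vw(1)] g[OF vw(2)] vw(3) Esym by auto
      then show False using sep[of v w] vw \<open>v \<noteq> w\<close> by blast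
    qed
  qed
  then have "card H \<le> card (nb z)"
    by (rule card_inj_on_le) (use g Esym in auto)
  then show False using H5 deg_le_4'[of z] unfolding deg_def by simp
qed

lemma contradiction: False
proof -
  interpret sub4 V E
  proof unfold_locales
    show "deg x \<le> 4" for x by (rule deg_le_4')
    show False if "E u v" "deg u = 4" "deg v = 4" for u v
      using high_isolated(1)[of u v] that inV irr by auto
  qed
  show False using card_V_few_high[OF few_high] n29 by simp
qed

end

text \<open>Colouring by a function, the form that matches \<open>proper_coloring\<close>; the
  argument itself works with \<open>col3\<close>.\<close>

definition c3 :: "('a \<Rightarrow> 'a \<Rightarrow> bool) \<Rightarrow> 'a set \<Rightarrow> bool" where
  "c3 E A \<longleftrightarrow> (\<exists>f::'a \<Rightarrow> nat. (\<forall>x\<in>A. f x < 3) \<and> (\<forall>x\<in>A. \<forall>y\<in>A. E x y \<longrightarrow> f x \<noteq> f y))"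

section \<open>Reduction to critical subgraphs\<close>

context sgraph
begin

text \<open>Take a smallest set of vertices without a 3-colouring: a vertex with at most two
  neighbours in it could be deleted and coloured afterwards.\<close>

lemma critical_subgraph:
  assumes "\<not> c3 E V"
  obtains A where "A \<subseteq> V" "crit A (\<lambda>x y. x \<in> A \<and> y \<in> A \<and> E x y)"
proof -
  define P where "P A \<longleftrightarrow> A \<subseteq> V \<and> \<not> c3 E A" for A
  have "P V" unfolding P_def using assms by simp
  then obtain A where A: "P A" "\<And>B. P B \<Longrightarrow> card A \<le> card B"
    using ex_has_least_nat[of P V card] by blast
  have AV: "A \<subseteq> V" and nA: "\<not> c3 E A" using A(1) unfolding P_def by auto
  have finA: "finite A" using AV fin finite_subset by blast
  \<comment> \<open>Edges are restricted to \<open>A\<close> because the locale demands that their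
    ends are vertices.\<close>
  define E' where "E' x y \<longleftrightarrow> x \<in> A \<and> y \<in> A \<and> E x y" for x y
  interpret G: sgraph A E'
  proof unfold_locales
    show "finite A" by (rule finA)
    show "E' x y \<Longrightarrow> E' y x" for x y unfolding E'_def using Esym by blast
    show "\<not> E' x x" for x unfolding E'_def using irr by blast
    show "E' x y \<Longrightarrow> x \<in> A" for x y unfolding E'_def by blast
    show "E' a b \<Longrightarrow> E' b c \<Longrightarrow> E' c a \<Longrightarrow> False" for a b c unfolding E'_def using no3 by blast
    show "E' a b \<Longrightarrow> E' b c \<Longrightarrow> E' c d \<Longrightarrow> E' d a \<Longrightarrow> a = c \<or> b = d" for a b c d
      unfolding E'_def using no4[of a b c d] by simp
    show "E' a b \<Longrightarrow> E' b c \<Longrightarrow> E' c d \<Longrightarrow> E' d e \<Longrightarrow> E' e a \<Longrightarrow> False" for a b c d e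
      unfolding E'_def using no5[of a b c d e] by simp
  qed
  have "3 \<le> G.deg x" if x: "x \<in> A" for x
  proof (rule ccontr)
    assume d: "\<not> 3 \<le> G.deg x"
    have "\<not> P (A - {x})"
    proof
      assume "P (A - {x})"
      then have "card A \<le> card (A - {x})" using A(2) by blast
      then show False using x finA by (metis card_Diff1_less not_le)
    qed
    then have "c3 E (A - {x})" using AV unfolding P_def by blast
    then obtain f :: "'a \<Rightarrow> nat" where f: "\<And>y. y \<in> A - {x} \<Longrightarrow> f y < 3"
      "\<And>y z. y \<in> A - {x} \<Longrightarrow> z \<in> A - {x} \<Longrightarrow> E y z \<Longrightarrow> f y \<noteq> f z" unfolding c3_def by blast
    have "card (f ` G.nb x) \<le> 2" using card_image_le[of "G.nb x" f] d unfolding G.deg_def by simp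
    have "\<not> {..<3} \<subseteq> f ` G.nb x"
    proof
      assume "{..<3} \<subseteq> f ` G.nb x"
      then have "card {..<3::nat} \<le> card (f ` G.nb x)" by (intro card_mono) simp_all
      then show False using \<open>card (f ` G.nb x) \<le> 2\<close> by simp
    qed
    then obtain k where k: "k < 3" "k \<notin> f ` G.nb x" by blast
    define h where "h y = (if y = x then k else f y)" for y
    have kx: "f y \<noteq> k" if "y \<in> A" "E x y" for y
    proof
      assume "f y = k"
      moreover have "y \<in> G.nb x" using that x by (simp add: E'_def)
      ultimately show False using k(2) by blast
    qed
    have "h y \<noteq> h z" if yz: "y \<in> A" "z \<in> A" "E y z" for y z
    proof -
      consider "y = x" "z \<noteq> x" | "z = x" "y \<noteq> x" | "y \<noteq> x" "z \<noteq> x" using yz irr by blast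
      then show ?thesis
      proof cases
        case 1 then show ?thesis using kx[of z] yz unfolding h_def by simp
      next
        case 2 then show ?thesis using kx[of y] yz Esym unfolding h_def by simp
      next
        case 3 then show ?thesis using f(2)[of y z] yz unfolding h_def by simp
      qed
    qed
    moreover have "h y < 3" if "y \<in> A" for y using that f(1) k(1) unfolding h_def by simp
    ultimately have "c3 E A" unfolding c3_def by blast
    then show False using nA by blast
  qed
  moreover have "\<not> G.col3"
  proof
    assume "G.col3"
    then obtain S where S: "S \<subseteq> A" "G.indep S" "G.bip (A - S)" unfolding G.col3_def by blast
    obtain g :: "'a \<Rightarrow> bool" where g: "\<And>x y. x \<in> A - S \<Longrightarrow> y \<in> A - S \<Longrightarrow> E' x y \<Longrightarrow> g x \<noteq> g y"
      using S(3) unfolding G.bip_def by blast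
    define f :: "'a \<Rightarrow> nat" where "f x = (if x \<in> S then 2 else if g x then 0 else 1)" for x
    have "f x \<noteq> f y" if xy: "x \<in> A" "y \<in> A" "E x y" for x y
    proof -
      have e: "E' x y" using xy unfolding E'_def by blast
      have "\<not> (x \<in> S \<and> y \<in> S)" using S(2) e unfolding G.indep_def by blast
      then show ?thesis using g[of x y] xy e unfolding f_def by auto
    qed
    moreover have "f x < 3" for x unfolding f_def by simp
    ultimately have "c3 E A" unfolding c3_def by blast
    then show False using nA by blast
  qed
  ultimately have "crit A E'" by unfold_locales
  moreover have "E' = (\<lambda>x y. x \<in> A \<and> y \<in> A \<and> E x y)" unfolding E'_def by (intro ext) simp
  ultimately show ?thesis using that AV by simp
qed

lemma card_ge_26:
  assumes "\<not> c3 E V" shows "26 \<le> card V"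
proof -
  obtain A where A: "A \<subseteq> V" "crit A (\<lambda>x y. x \<in> A \<and> y \<in> A \<and> E x y)" using critical_subgraph[OF assms] .
  have "25 < card A" using crit.card_gt_25[OF A(2)] .
  then show ?thesis using card_mono[OF fin A(1)] by simp
qed

lemma card_ge_30:
  assumes nc: "\<not> c3 E V"
    and no6: "\<And>a b c d e f. E a b \<Longrightarrow> E b c \<Longrightarrow> E c d \<Longrightarrow> E d e \<Longrightarrow> E e f \<Longrightarrow> E f a \<Longrightarrow>
      distinct [a, b, c, d, e, f] \<Longrightarrow> False"
  shows "30 \<le> card V"
proof (rule ccontr)
  assume n: "\<not> 30 \<le> card V"
  obtain A where A: "A \<subseteq> V" "crit A (\<lambda>x y. x \<in> A \<and> y \<in> A \<and> E x y)" using critical_subgraph[OF nc] .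
  have "crit29 A (\<lambda>x y. x \<in> A \<and> y \<in> A \<and> E x y)"
    by (intro crit29.intro A(2) crit29_axioms.intro) (use no6 card_mono[OF fin A(1)] n in \<open>blast | simp\<close>)+
  then show False by (rule crit29.contradiction)
qed

end

section \<open>Chromatic number and girth\<close>

lemma cycle_of_walk:
  assumes "u \<in> pverts G" "set p \<subseteq> parcs G" "pcas u p u" "distinct (tl (pawalk_verts u p))" "3 \<le> length p"
  shows "girth G \<le> enat (length p)"
proof -
  have "pre_digraph.cycle (with_proj G) p"
    unfolding pre_digraph.cycle_def pre_digraph.awalk_def
    using assms by (intro exI[of _ u]) (auto simp: cas_with_proj_eq awalk_verts_with_proj_eq)
  then show ?thesis unfolding girth_def using assms(5) by (intro INF_lower) simp
qed

lemma pair_graph_sgraph: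
  assumes "pair_graph G" and g: "enat 6 \<le> girth G"
  shows "sgraph (pverts G) (\<lambda>x y. (x, y) \<in> parcs G)"
proof -
  interpret pair_graph G by (rule assms(1))
  define E where "E x y \<longleftrightarrow> (x, y) \<in> parcs G" for x y
  have E_V: "x \<in> pverts G" if "E x y" for x y using that arc_fst_in_verts unfolding E_def by fastforce
  have ne: "x \<noteq> y" if "E x y" for x y using that pair_no_loops unfolding E_def by fastforce
  have E_sym: "E y x" if "E x y" for x y
    using that pair_sym_arcs unfolding E_def symmetric_def sym_def by auto
  have short: False if "u \<in> pverts G" "set p \<subseteq> parcs G" "pcas u p u" "distinct (tl (pawalk_verts u p))"
    "3 \<le> length p" "length p < 6" for u p
    using cycle_of_walk[OF that(1-5)] g that(6) by (metis enat_ord_simps(1) leD order_trans)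
  have no3: False if e: "E a b" "E b c" "E c a" for a b c
    using short[of a "[(a, b), (b, c), (c, a)]"] e E_V[OF e(1)] ne[OF e(1)] ne[OF e(2)] ne[OF e(3)]
    unfolding E_def by auto
  have no4: "a = c \<or> b = d" if e: "E a b" "E b c" "E c d" "E d a" for a b c d
    using short[of a "[(a, b), (b, c), (c, d), (d, a)]"] e E_V[OF e(1)] ne[OF e(1)] ne[OF e(2)] ne[OF e(3)] ne[OF e(4)]
    unfolding E_def by auto
  have no5: False if e: "E a b" "E b c" "E c d" "E d e" "E e a" for a b c d e
  proof -
    \<comment> \<open>Equality of two nonconsecutive vertices would cut off a triangle; distinctness
      is needed to apply \<open>short\<close>.\<close>
    have "a \<noteq> c" "a \<noteq> d" "b \<noteq> d" "b \<noteq> e" "c \<noteq> e"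
      using no3[of a d e] no3[of a b c] no3[of a b e] no3[of b c d] no3[of a b c] e by auto
    then show False
      using short[of a "[(a, b), (b, c), (c, d), (d, e), (e, a)]"] e E_V[OF e(1)]
        ne[OF e(1)] ne[OF e(2)] ne[OF e(3)] ne[OF e(4)] ne[OF e(5)]
      unfolding E_def by auto
  qed
  have "sgraph (pverts G) E"
  proof
    show "finite (pverts G)" by (rule pair_finite_verts)
    show "E x y \<Longrightarrow> E y x" for x y by (rule E_sym)
    show "\<not> E x x" for x using ne by blast
    show "E x y \<Longrightarrow> x \<in> pverts G" for x y by (rule E_V)
    show "E a b \<Longrightarrow> E b c \<Longrightarrow> E c a \<Longrightarrow> False" for a b c by (rule no3)
    show "E a b \<Longrightarrow> E b c \<Longrightarrow> E c d \<Longrightarrow> E d a \<Longrightarrow> a = c \<or> b = d" for a b c d by (rule no4)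
    show "E a b \<Longrightarrow> E b c \<Longrightarrow> E c d \<Longrightarrow> E d e \<Longrightarrow> E e a \<Longrightarrow> False" for a b c d e by (rule no5)
  qed
  then show ?thesis unfolding E_def .
qed

lemma chromatic_4_not_3_colourable:
  fixes G :: "'a pair_pre_digraph"
  assumes "pair_graph G" "chromatic_number G = 4"
  shows "\<not> c3 (\<lambda>x y. (x, y) \<in> parcs G) (pverts G)"
proof
  interpret pair_graph G by (rule assms(1))
  assume "c3 (\<lambda>x y. (x, y) \<in> parcs G) (pverts G)"
  then obtain f :: "'a \<Rightarrow> nat" where f: "\<forall>x\<in>pverts G. f x < 3"
    "\<forall>x\<in>pverts G. \<forall>y\<in>pverts G. (x, y) \<in> parcs G \<longrightarrow> f x \<noteq> f y" unfolding c3_def by blast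
  have "\<forall>(u, v)\<in>parcs G. f u \<noteq> f v" using f(2) in_arcsD1 in_arcsD2 by auto
  then have "proper_coloring G 3 f" unfolding proper_coloring_def using f(1) by blast
  then have "chromatic_number G \<le> 3" unfolding chromatic_number_def by (intro Least_le) blast
  then show False using assms(2) by simp
qed

lemma girth_6_order:
  assumes "pair_graph G" "chromatic_number G = 4" "6 \<le> girth G"
  shows "26 \<le> card (pverts G)"
proof -
  have "enat 6 \<le> girth G" using assms(3) by (simp add: numeral_eq_enat)
  then interpret sgraph "pverts G" "\<lambda>x y. (x, y) \<in> parcs G" by (rule pair_graph_sgraph[OF assms(1)])
  show ?thesis by (rule card_ge_26[OF chromatic_4_not_3_colourable[OF assms(1,2)]])
qed

lemma girth_7_order:
  assumes "pair_graph G" "chromatic_number G = 4" "7 \<le> girth G"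
  shows "30 \<le> card (pverts G)"
proof -
  have g7: "enat 7 \<le> girth G" using assms(3) by (simp add: numeral_eq_enat)
  have "enat 6 \<le> enat 7" by simp
  then have "enat 6 \<le> girth G" using g7 by (rule order_trans)
  then interpret sgraph "pverts G" "\<lambda>x y. (x, y) \<in> parcs G" by (rule pair_graph_sgraph[OF assms(1)])
  show ?thesis
  proof (rule card_ge_30[OF chromatic_4_not_3_colourable[OF assms(1,2)]])
    fix a b c d e f
    assume h: "(a, b) \<in> parcs G" "(b, c) \<in> parcs G" "(c, d) \<in> parcs G" "(d, e) \<in> parcs G"
      "(e, f) \<in> parcs G" "(f, a) \<in> parcs G" "distinct [a, b, c, d, e, f]"
    have "girth G \<le> enat (length [(a, b), (b, c), (c, d), (d, e), (e, f), (f, a)])"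
      by (rule cycle_of_walk[of a]) (use h inV in auto)
    from order_trans[OF g7 this] show False by simp
  qed
qed

theorem theorem4:
  shows "26 \<le> min_order 6 4 \<and> 30 \<le> min_order 7 4 \<and>
    (\<forall>G :: 'a pair_pre_digraph.
       pair_graph G \<and> chromatic_number G = 4 \<and> 6 \<le> girth G \<longrightarrow> 26 \<le> card (pverts G)) \<and>
    (\<forall>G :: 'a pair_pre_digraph.
       pair_graph G \<and> chromatic_number G = 4 \<and> 7 \<le> girth G \<longrightarrow> 30 \<le> card (pverts G))"
proof (intro conjI allI impI)
  show "26 \<le> min_order 6 4" unfolding min_order_def
    by (rule INF_greatest) (use girth_6_order in \<open>auto simp: numeral_eq_enat\<close>)
  show "30 \<le> min_order 7 4" unfolding min_order_def
    by (rule INF_greatest) (use girth_7_order in \<open>auto simp: numeral_eq_enat\<close>)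
qed (use girth_6_order girth_7_order in blast)+

end
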